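(* (i) If $n\ge 3$, there exists a sequence of rectangles (axis-parallel boxes) $\Omega_k\subset\mathbb R^n$ of fixed volume (independent of $k$) such that $O(\Omega_k)\to 0$ and such that, after any translations and rotations, the Hausdorff distance from $\Omega_k$ to every ball of the same volume tends to infinity; that is, for every choice of rigid motions $T_k$ of $\mathbb R^n$ and balls $B_k\subset\mathbb R^n$ with $|B_k|=|\Omega_k|$ one has $d_H(T_k\Omega_k,B_k)\to\infty$. (ii) If $n=2$, there exists a sequence of annuli $A_k\subset\mathbb R^2$ of fixed area (independent of $k$) such that $O(A_k)\to 0$ and such that, after any translations and rotations, the Hausdorff distance from $A_k$ to every ball of the same area tends to infinity; that is, for every choice of rigid motions $T_k$ of $\mathbb R^2$ and disks $B_k\subset\mathbb R^2$ with $|B_k|=|A_k|$ one has $d_H(T_kA_k,B_k)\to\infty$.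
   Context: For a bounded connected Lipschitz domain $\Omega\subset\mathbb R^n$ with volume $|\Omega|$, perimeter $P(\Omega)$ and outer unit normal $\nu$, $u_\Omega$ denotes the weak solution of $-\Delta u_\Omega=1$ in $\Omega$, $\partial_\nu u_\Omega=-|\Omega|/P(\Omega)$ on $\partial\Omega$, i.e. $u_\Omega\in H^1(\Omega)$ and $\int_\Omega\nabla u_\Omega\cdot\nabla\varphi\,dx=\int_\Omega\varphi\,dx-\frac{|\Omega|}{P(\Omega)}\int_{\partial\Omega}\varphi\,d\sigma$ for all $\varphi\in H^1(\Omega)$, normalized by $\int_{\partial\Omega}u_\Omega\,d\sigma=0$. It has a Hölder continuous representative on $\overline\Omega$, which is always used. The boundary oscillation is $O(\Omega):=\max_{\partial\Omega}u_\Omega-\min_{\partial\Omega}u_\Omega$ (independent of the additive constant). $d_H$ is the Hausdorff distance. *)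

theory Defs
  imports "HOL-Analysis.Analysis"
begin

subsection \<open>Hausdorff measure and surface measure\<close>

text \<open>The usual normalisation is used, so that the \<open>s\<close>-dimensional measure agrees with Lebesgue
  measure on \<open>s\<close>-dimensional affine subspaces. \<^const>\<open>diameter\<close> is meaningful on bounded sets only,
  and the empty set must cost nothing also for \<open>s = 0\<close>.\<close>

definition hausdorff_premeasure :: "nat \<Rightarrow> real \<Rightarrow> 'a::metric_space set \<Rightarrow> ennreal" where
  "hausdorff_premeasure s \<delta> A =
     (INF C \<in> {C :: nat \<Rightarrow> 'a set. A \<subseteq> (\<Union>i. C i) \<and> (\<forall>i. bounded (C i) \<and> diameter (C i) \<le> \<delta>)}.
        \<Sum>i. if C i = {} then 0 else ennreal (unit_ball_vol (real s) * (diameter (C i) / 2) ^ s))"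

definition hausdorff_outer :: "nat \<Rightarrow> 'a::metric_space set \<Rightarrow> ennreal" where
  "hausdorff_outer s A = (SUP \<delta> \<in> {0<..}. hausdorff_premeasure s \<delta> A)"

text \<open>Borel sets are Caratheodory measurable for this metric outer measure, so its restriction to
  them is a measure and \<^const>\<open>measure_of\<close> keeps its values.\<close>

definition hausdorff_measure :: "nat \<Rightarrow> 'a::metric_space measure" where
  "hausdorff_measure s = measure_of UNIV (sets borel) (hausdorff_outer s)"

definition surface_measure :: "'a::euclidean_space set \<Rightarrow> 'a measure" where
  "surface_measure \<Omega> = restrict_space (hausdorff_measure (DIM('a) - 1)) (frontier \<Omega>)"

text \<open>For Lipschitz domains the De Giorgi perimeter is the surface measure of the boundary.\<close>

definition perimeter :: "'a::euclidean_space set \<Rightarrow> real" where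
  "perimeter \<Omega> = measure (surface_measure \<Omega>) (frontier \<Omega>)"

subsection \<open>Sobolev functions and their boundary traces\<close>

definition square_integrable :: "'a measure \<Rightarrow> ('a \<Rightarrow> 'b::euclidean_space) \<Rightarrow> bool" where
  "square_integrable M f \<longleftrightarrow> f \<in> borel_measurable M \<and> integrable M (\<lambda>x. (norm (f x))\<^sup>2)"

definition L2_converges :: "'a measure \<Rightarrow> (nat \<Rightarrow> 'a \<Rightarrow> 'b::euclidean_space) \<Rightarrow> ('a \<Rightarrow> 'b) \<Rightarrow> bool" where
  "L2_converges M f g \<longleftrightarrow>
     (\<lambda>j. \<integral>\<^sup>+x. ennreal ((norm (f j x - g x))\<^sup>2) \<partial>M) \<longlonglongrightarrow> 0"

definition C1_test_function ::
  "'a::euclidean_space set \<Rightarrow> ('a \<Rightarrow> real) \<Rightarrow> ('a \<Rightarrow> 'a) \<Rightarrow> bool" where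
  "C1_test_function \<Omega> \<phi> D \<longleftrightarrow> (\<forall>x. GDERIV \<phi> x :> D x) \<and> continuous_on UNIV D \<and>
     compact (closure {x. \<phi> x \<noteq> 0}) \<and> closure {x. \<phi> x \<noteq> 0} \<subseteq> \<Omega>"

text \<open>\<open>u \<in> H\<^sup>1(\<Omega>)\<close> with weak gradient \<open>g\<close>; the weak gradient is determined up to null sets.\<close>

definition H1_with_gradient ::
  "'a::euclidean_space set \<Rightarrow> ('a \<Rightarrow> real) \<Rightarrow> ('a \<Rightarrow> 'a) \<Rightarrow> bool" where
  "H1_with_gradient \<Omega> u g \<longleftrightarrow>
     square_integrable (lebesgue_on \<Omega>) u \<and> square_integrable (lebesgue_on \<Omega>) g \<and>
     (\<forall>\<phi> D. C1_test_function \<Omega> \<phi> D \<longrightarrow>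
        (\<integral>x. u x *\<^sub>R D x \<partial>lebesgue_on \<Omega>) = - (\<integral>x. \<phi> x *\<^sub>R g x \<partial>lebesgue_on \<Omega>))"

text \<open>The graph of the trace operator from \<open>H\<^sup>1(\<Omega>)\<close> to \<open>L\<^sup>2(\<partial>\<Omega>)\<close>, i.e. of the continuous extension of
  the restriction to the boundary of functions in \<open>H\<^sup>1(\<Omega>)\<close> that are continuous on the closure. On a
  bounded Lipschitz domain every \<open>\<phi>\<close> in \<open>H\<^sup>1(\<Omega>)\<close> has exactly one trace \<open>\<tau>\<close>, up to null sets.\<close>

definition H1_with_trace ::
  "'a::euclidean_space set \<Rightarrow> ('a \<Rightarrow> real) \<Rightarrow> ('a \<Rightarrow> 'a) \<Rightarrow> ('a \<Rightarrow> real) \<Rightarrow> bool" where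
  "H1_with_trace \<Omega> \<phi> h \<tau> \<longleftrightarrow>
     H1_with_gradient \<Omega> \<phi> h \<and> square_integrable (surface_measure \<Omega>) \<tau> \<and>
     (\<exists>f D. (\<forall>j. H1_with_gradient \<Omega> (f j) (D j) \<and> continuous_on (closure \<Omega>) (f j)) \<and>
        L2_converges (lebesgue_on \<Omega>) f \<phi> \<and> L2_converges (lebesgue_on \<Omega>) D h \<and>
        L2_converges (surface_measure \<Omega>) f \<tau>)"

subsection \<open>The Neumann problem and the boundary oscillation\<close>

definition hoelder_on :: "'a::metric_space set \<Rightarrow> ('a \<Rightarrow> real) \<Rightarrow> bool" where
  "hoelder_on S u \<longleftrightarrow>
     (\<exists>\<alpha> C. 0 < \<alpha> \<and> \<alpha> \<le> 1 \<and> (\<forall>x\<in>S. \<forall>y\<in>S. \<bar>u x - u y\<bar> \<le> C * dist x y powr \<alpha>))"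

definition neumann_solution :: "'a::euclidean_space set \<Rightarrow> ('a \<Rightarrow> real) \<Rightarrow> bool" where
  "neumann_solution \<Omega> u \<longleftrightarrow>
     hoelder_on (closure \<Omega>) u \<and>
     (\<integral>x. u x \<partial>surface_measure \<Omega>) = 0 \<and>
     (\<exists>g. H1_with_gradient \<Omega> u g \<and>
        (\<forall>\<phi> h \<tau>. H1_with_trace \<Omega> \<phi> h \<tau> \<longrightarrow>
           (\<integral>x. g x \<bullet> h x \<partial>lebesgue_on \<Omega>) =
           (\<integral>x. \<phi> x \<partial>lebesgue_on \<Omega>)
             - measure lebesgue \<Omega> / perimeter \<Omega> * (\<integral>x. \<tau> x \<partial>surface_measure \<Omega>)))"

text \<open>For a bounded connected Lipschitz domain \<open>\<Omega>\<close> the solution exists and is unique on the closure; its values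
  elsewhere are arbitrary and never used.\<close>

definition u_sol :: "'a::euclidean_space set \<Rightarrow> 'a \<Rightarrow> real" where
  "u_sol \<Omega> = (SOME u. neumann_solution \<Omega> u)"

definition boundary_oscillation :: "'a::euclidean_space set \<Rightarrow> real" where
  "boundary_oscillation \<Omega> = (SUP x\<in>frontier \<Omega>. u_sol \<Omega> x) - (INF x\<in>frontier \<Omega>. u_sol \<Omega> x)"

subsection \<open>Geometry\<close>

definition open_rectangle :: "'a::euclidean_space set \<Rightarrow> bool" where
  "open_rectangle S \<longleftrightarrow> (\<exists>a b. (\<forall>i\<in>Basis. a \<bullet> i < b \<bullet> i) \<and> S = box a b)"

definition open_annulus :: "'a::euclidean_space set \<Rightarrow> bool" where
  "open_annulus S \<longleftrightarrow> (\<exists>c r R. 0 < r \<and> r < R \<and> S = {x. r < dist c x \<and> dist c x < R})"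

definition rigid_motion :: "('a::euclidean_space \<Rightarrow> 'a) \<Rightarrow> bool" where
  "rigid_motion T \<longleftrightarrow> (\<exists>a Q. orthogonal_transformation Q \<and> T = (\<lambda>x. a + Q x))"

text \<open>Only meaningful for nonempty bounded sets.\<close>

definition hausdorff_dist :: "'a::metric_space set \<Rightarrow> 'a set \<Rightarrow> real" where
  "hausdorff_dist A B = max (SUP x\<in>A. infdist x B) (SUP y\<in>B. infdist y A)"

end

theory Submission
  imports Defs "HOL-Real_Asymp.Real_Asymp"
begin

text \<open>On both families the Neumann problem has an explicit solution. On the box with half
  sides \<open>l\<^sub>i\<close> it is \<open>u x = - (\<Sum>i. \<kappa> / (2 l\<^sub>i)
  x\<^sub>i\<^sup>2)\<close>, where \<open>\<kappa> = 1 / (\<Sum>i. 1 / l\<^sub>i)\<close> is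
  the quotient of volume and perimeter; its normal derivative on the faces orthogonal to
  \<open>i\<close> is \<open>- \<kappa>\<close>, and it oscillates by at most \<open>\<kappa> /
  2\<close> times the sum of the half sides. Now \<open>\<kappa>\<close> is at most the shortest
  half side. Flattening a box of fixed volume in one direction, with half sides \<open>t ^ - (n
  - 1), t, \<dots>, t\<close>, gives oscillation of order \<open>t ^ - (n - 2)\<close>. This is
  useless in the plane, where thin annuli take over: on \<open>r < |x| < R\<close> the solution
  \<open>r R / 2 ln |x| - |x|\<^sup>2 / 4\<close> is constant on both boundary circles, and for
  \<open>R\<^sup>2 - r\<^sup>2 = 1\<close> the two constants approach each other as
  \<open>r\<close> grows. In both cases the diameter tends to infinity while the balls of the
  same volume have a fixed radius.

  What needs work is that the chosen solution \<^const>\<open>u_sol\<close> is the explicit one up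
  to a constant. Theorem \<open>boundary_oscillation_le\<close> reduces this to a Gauss-Green
  identity \<open>\<integral> \<nabla>u \<bullet> \<nabla>f = \<integral> f - \<kappa>
  \<integral> f d\<sigma>\<close> for functions \<open>f\<close> in \<open>H\<^sup>1\<close>
  that are continuous up to the boundary. Density extends it to all traces, and uniqueness holds
  because a continuous function with zero weak gradient on a connected set is constant
  (\<open>zero_weak_gradient_imp_constant\<close>). The identity may contain any factor
  \<open>\<kappa>\<close>, since \<open>f = 1\<close> identifies it afterwards. Hence it
  suffices to know the Hausdorff measure up to a factor: uniqueness of translation invariant
  measures shows that slicing by hyperplanes gives a multiple of Lebesgue measure
  (\<open>hausdorff_slicing\<close>), and rotation invariance does the same for slicing by
  circles (\<open>polar_coordinates\<close>).

  With slicing at hand the identity becomes one-dimensional. The integral of \<open>f\<close> over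
  the slice at height \<open>t\<close> is continuous in \<open>t\<close> up to the ends, the
  weak gradient of \<open>f\<close> gives its weak derivative, and cutoffs recover the values at
  the ends, which are the integrals of \<open>f\<close> over the boundary
  (\<open>boundary_values_from_test_functions\<close>).\<close>

section \<open>Hausdorff measure is a Borel measure\<close>

text \<open>The summand in the definition of the premeasure, split off so that covers can be
  compared piece by piece.\<close>

definition hausdorff_cost :: "nat \<Rightarrow> 'a::metric_space set \<Rightarrow> ennreal" where
  "hausdorff_cost s C = (if C = {} then 0 else ennreal (unit_ball_vol (real s) * (diameter C / 2) ^ s))"

definition delta_cover :: "real \<Rightarrow> 'a::metric_space set \<Rightarrow> (nat \<Rightarrow> 'a set) \<Rightarrow> bool" where
  "delta_cover \<delta> A C \<longleftrightarrow> A \<subseteq> (\<Union>i. C i) \<and> (\<forall>i. bounded (C i) \<and> diameter (C i) \<le> \<delta>)"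

lemma premeasure_alt: "hausdorff_premeasure s \<delta> A = (INF C \<in> Collect (delta_cover \<delta> A). \<Sum>i. hausdorff_cost s (C i))"
  unfolding hausdorff_premeasure_def hausdorff_cost_def delta_cover_def by simp

lemma hausdorff_cost_empty [simp]: "hausdorff_cost s {} = 0"
  by (simp add: hausdorff_cost_def)

lemma premeasure_le: "delta_cover \<delta> A C \<Longrightarrow> hausdorff_premeasure s \<delta> A \<le> (\<Sum>i. hausdorff_cost s (C i))"
  unfolding premeasure_alt by (rule INF_lower) simp

lemma premeasure_geI:
  "(\<And>C. delta_cover \<delta> A C \<Longrightarrow> x \<le> (\<Sum>i. hausdorff_cost s (C i))) \<Longrightarrow> x \<le> hausdorff_premeasure s \<delta> A"
  unfolding premeasure_alt by (rule INF_greatest) simp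

lemma premeasure_approx:
  assumes "hausdorff_premeasure s \<delta> A < y"
  obtains C where "delta_cover \<delta> A C" "(\<Sum>i. hausdorff_cost s (C i)) < y"
  using assms unfolding premeasure_alt INF_less_iff by auto

lemma premeasure_mono: "A \<subseteq> B \<Longrightarrow> hausdorff_premeasure s \<delta> A \<le> hausdorff_premeasure s \<delta> B"
  by (rule premeasure_geI, rule premeasure_le) (auto simp: delta_cover_def)

lemma premeasure_antimono: "\<delta> \<le> \<delta>' \<Longrightarrow> hausdorff_premeasure s \<delta>' A \<le> hausdorff_premeasure s \<delta> A"
  by (rule premeasure_geI, rule premeasure_le) (auto simp: delta_cover_def intro: order_trans)

lemma premeasure_le_outer: "0 < \<delta> \<Longrightarrow> hausdorff_premeasure s \<delta> A \<le> hausdorff_outer s A"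
  unfolding hausdorff_outer_def by (rule SUP_upper) simp

lemma outer_leI:
  "(\<And>\<delta>. 0 < \<delta> \<Longrightarrow> hausdorff_premeasure s \<delta> A \<le> x) \<Longrightarrow> hausdorff_outer s A \<le> x"
  unfolding hausdorff_outer_def by (rule SUP_least) simp

lemma outer_mono: "A \<subseteq> B \<Longrightarrow> hausdorff_outer s A \<le> hausdorff_outer s B"
  by (meson outer_leI order_trans premeasure_mono premeasure_le_outer)

lemma premeasure_empty: "0 < \<delta> \<Longrightarrow> hausdorff_premeasure s \<delta> ({} :: 'a::metric_space set) = 0"
  using premeasure_le[of \<delta> "{} :: 'a set" "\<lambda>_. {}" s]
  by (auto simp: delta_cover_def diameter_def)

lemma outer_empty [simp]: "hausdorff_outer s {} = 0"
  using outer_leI[of s "{}" 0] by (auto simp: premeasure_empty)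

text \<open>Near-optimal covers of the \<open>A n\<close>, with errors \<open>e / 2 ^ (n +
  1)\<close>, are merged into one cover along a bijection between pairs of numbers and
  numbers.\<close>

lemma premeasure_UN_le:
  "hausdorff_premeasure s \<delta> (\<Union>n. A n) \<le> (\<Sum>n. hausdorff_premeasure s \<delta> (A n))"
proof (cases "(\<Sum>n. hausdorff_premeasure s \<delta> (A n)) < top")
  case True
  show ?thesis
  proof (rule ennreal_le_epsilon)
    fix e :: real assume e: "0 < e"
    have fin: "hausdorff_premeasure s \<delta> (A n) < top" for n
      by (rule ennreal_suminf_lessD[OF True])
    define good where "good n C \<longleftrightarrow> delta_cover \<delta> (A n) C \<and>
        (\<Sum>i. hausdorff_cost s (C i)) \<le> hausdorff_premeasure s \<delta> (A n) + ennreal (e * (1/2) ^ Suc n)" for n C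
    have "\<exists>C. good n C" for n
    proof -
      have "0 < ennreal (e * (1/2) ^ Suc n)" using e by simp
      then have "hausdorff_premeasure s \<delta> (A n) < hausdorff_premeasure s \<delta> (A n) + ennreal (e * (1/2) ^ Suc n)"
        using ennreal_add_left_cancel_less[of "hausdorff_premeasure s \<delta> (A n)" 0 "ennreal (e * (1/2) ^ Suc n)"]
          less_imp_neq[OF fin[of n]] by simp
      then obtain C where "delta_cover \<delta> (A n) C"
        "(\<Sum>i. hausdorff_cost s (C i)) < hausdorff_premeasure s \<delta> (A n) + ennreal (e * (1/2) ^ Suc n)"
        by (rule premeasure_approx)
      then show ?thesis by (intro exI[of _ C]) (simp add: good_def less_imp_le)
    qed
    then obtain C where "\<And>n. good n (C n)" by metis
    then have C: "\<And>n. delta_cover \<delta> (A n) (C n)"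
      and Ci: "\<And>n. (\<Sum>i. hausdorff_cost s (C n i)) \<le> hausdorff_premeasure s \<delta> (A n) + ennreal (e * (1/2) ^ Suc n)"
      by (simp_all add: good_def)
    let ?D = "\<lambda>i. case prod_decode i of (n, m) \<Rightarrow> C n m"
    have "delta_cover \<delta> (\<Union>n. A n) ?D"
      unfolding delta_cover_def
    proof (intro conjI subsetI allI)
      fix x assume "x \<in> (\<Union>n. A n)"
      then obtain n m where "x \<in> C n m" using C unfolding delta_cover_def by blast
      then have "x \<in> ?D (prod_encode (n, m))" by simp
      then show "x \<in> (\<Union>i. ?D i)" by (rule UN_I[OF UNIV_I])
    next
      fix i
      show "bounded (?D i)" "diameter (?D i) \<le> \<delta>"
        using C by (simp_all add: delta_cover_def split: prod.split)
    qed
    then have "hausdorff_premeasure s \<delta> (\<Union>n. A n) \<le> (\<Sum>i. hausdorff_cost s (?D i))"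
      by (rule premeasure_le)
    also have "\<dots> = (\<Sum>i. (\<lambda>(n, m). hausdorff_cost s (C n m)) (prod_decode i))"
      by (simp add: case_prod_beta)
    also have "\<dots> = (\<Sum>n. \<Sum>m. hausdorff_cost s (C n m))"
      by (subst suminf_ennreal_2dimen[where g="\<lambda>n. \<Sum>m. hausdorff_cost s (C n m)"]) auto
    also have "\<dots> \<le> (\<Sum>n. hausdorff_premeasure s \<delta> (A n) + ennreal (e * (1/2) ^ Suc n))"
      by (rule suminf_le[OF Ci]) auto
    also have "\<dots> = (\<Sum>n. hausdorff_premeasure s \<delta> (A n)) + (\<Sum>n. ennreal (e * (1/2) ^ Suc n))"
      by (rule suminf_add[symmetric]) auto
    also have "(\<Sum>n. ennreal (e * (1/2) ^ Suc n)) = ennreal e"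
    proof (rule suminf_ennreal_eq)
      show "(\<lambda>n. e * (1/2) ^ Suc n) sums e"
        using sums_mult[OF power_half_series, of e] by simp
    qed (use e in simp)
    finally show "hausdorff_premeasure s \<delta> (\<Union>n. A n) \<le> (\<Sum>n. hausdorff_premeasure s \<delta> (A n)) + ennreal e" .
  qed
qed (simp add: not_less top_unique)

lemma outer_UN_le: "hausdorff_outer s (\<Union>n. A n) \<le> (\<Sum>n. hausdorff_outer s (A n))"
proof (rule outer_leI)
  fix \<delta> :: real assume "0 < \<delta>"
  then have "(\<Sum>n. hausdorff_premeasure s \<delta> (A n)) \<le> (\<Sum>n. hausdorff_outer s (A n))"
    by (intro suminf_le premeasure_le_outer) auto
  then show "hausdorff_premeasure s \<delta> (\<Union>n. A n) \<le> (\<Sum>n. hausdorff_outer s (A n))"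
    using premeasure_UN_le order_trans by blast
qed

lemma outer_Un_le: "hausdorff_outer s (A \<union> B) \<le> hausdorff_outer s A + hausdorff_outer s B"
proof -
  define X where "X n = (if n = 0 then A else if n = Suc 0 then B else {})" for n :: nat
  have "(\<Union>n. X n) = A \<union> B" by (auto simp: X_def split: if_splits)
  moreover have "(\<Sum>n. hausdorff_outer s (X n)) = (\<Sum>n\<in>{0, Suc 0}. hausdorff_outer s (X n))"
    by (rule suminf_finite) (auto simp: X_def)
  ultimately show ?thesis
    using outer_UN_le[of s X] by (simp add: X_def)
qed

text \<open>Below the distance of \<open>A\<close> and \<open>B\<close> no set of a cover meets
  both, so a cover of the union splits into a cover of \<open>A\<close> and a cover of
  \<open>B\<close>.\<close>

lemma premeasure_separated:
  assumes sep: "\<And>x y. x \<in> A \<Longrightarrow> y \<in> B \<Longrightarrow> d \<le> dist x y" and \<delta>: "0 < \<delta>" "\<delta> < d"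
  shows "hausdorff_premeasure s \<delta> A + hausdorff_premeasure s \<delta> B \<le> hausdorff_premeasure s \<delta> (A \<union> B)"
proof (rule premeasure_geI)
  fix C assume C: "delta_cover \<delta> (A \<union> B) C"
  define CA where "CA i = (if C i \<inter> A = {} then {} else C i)" for i
  define CB where "CB i = (if C i \<inter> B = {} then {} else C i)" for i
  have "delta_cover \<delta> A CA" "delta_cover \<delta> B CB"
    using C \<delta> unfolding delta_cover_def CA_def CB_def by (fastforce simp: diameter_empty)+
  then have "hausdorff_premeasure s \<delta> A + hausdorff_premeasure s \<delta> B
      \<le> (\<Sum>i. hausdorff_cost s (CA i)) + (\<Sum>i. hausdorff_cost s (CB i))"
    by (intro add_mono premeasure_le)
  also have "\<dots> = (\<Sum>i. hausdorff_cost s (CA i) + hausdorff_cost s (CB i))"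
    by (rule suminf_add) auto
  also have "\<dots> \<le> (\<Sum>i. hausdorff_cost s (C i))"
  proof (rule suminf_le)
    fix i
    have "C i \<inter> A = {} \<or> C i \<inter> B = {}"
    proof (rule ccontr)
      assume "\<not> ?thesis"
      then obtain x y where xy: "x \<in> C i" "x \<in> A" "y \<in> C i" "y \<in> B" by auto
      have "dist x y \<le> diameter (C i)"
        using C xy by (intro diameter_bounded_bound) (auto simp: delta_cover_def)
      also have "\<dots> \<le> \<delta>" using C by (auto simp: delta_cover_def)
      finally show False using sep xy \<delta> by fastforce
    qed
    then show "hausdorff_cost s (CA i) + hausdorff_cost s (CB i) \<le> hausdorff_cost s (C i)"
      by (auto simp: CA_def CB_def)
  qed auto
  finally show "hausdorff_premeasure s \<delta> A + hausdorff_premeasure s \<delta> B \<le> (\<Sum>i. hausdorff_cost s (C i))" .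
qed

text \<open>The premeasures increase to the outer measure as \<open>\<delta>\<close> tends to
  \<open>0\<close>, so additivity on separated sets survives the limit.\<close>

lemma outer_separated:
  assumes sep: "\<And>x y. x \<in> A \<Longrightarrow> y \<in> B \<Longrightarrow> d \<le> dist x y" and d: "0 < d"
  shows "hausdorff_outer s A + hausdorff_outer s B = hausdorff_outer s (A \<union> B)"
proof (rule antisym)
  have lim: "((\<lambda>\<delta>. hausdorff_premeasure s \<delta> X) \<longlongrightarrow> hausdorff_outer s X) (at_right 0)" for X :: "'a set"
  proof (rule order_tendstoI)
    fix a assume "a < hausdorff_outer s X"
    then obtain e where e: "0 < e" "a < hausdorff_premeasure s e X"
      unfolding hausdorff_outer_def less_SUP_iff by auto
    then have "a < hausdorff_premeasure s \<delta> X" if "0 < \<delta>" "\<delta> < e" for \<delta>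
      using premeasure_antimono[of \<delta> e s X] that by (auto intro: less_le_trans)
    then show "\<forall>\<^sub>F \<delta> in at_right 0. a < hausdorff_premeasure s \<delta> X"
      using e(1) unfolding eventually_at_right_field by blast
  next
    fix a assume "hausdorff_outer s X < a"
    then have "hausdorff_premeasure s \<delta> X < a" if "0 < \<delta>" for \<delta>
      using premeasure_le_outer[OF that] by (auto intro: le_less_trans)
    then show "\<forall>\<^sub>F \<delta> in at_right 0. hausdorff_premeasure s \<delta> X < a"
      unfolding eventually_at_right_field by (auto intro: exI[of _ 1])
  qed
  show "hausdorff_outer s A + hausdorff_outer s B \<le> hausdorff_outer s (A \<union> B)"
  proof (rule tendsto_upperbound[OF tendsto_add[OF lim lim]])
    show "\<forall>\<^sub>F \<delta> in at_right 0. hausdorff_premeasure s \<delta> A + hausdorff_premeasure s \<delta> B \<le> hausdorff_outer s (A \<union> B)"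
      unfolding eventually_at_right_field
    proof (intro exI[of _ d] conjI allI impI)
      fix \<delta> :: real assume "0 < \<delta>" "\<delta> < d"
      then show "hausdorff_premeasure s \<delta> A + hausdorff_premeasure s \<delta> B \<le> hausdorff_outer s (A \<union> B)"
        using premeasure_separated[of A B d \<delta> s] sep premeasure_le_outer[of \<delta> s "A \<union> B"]
        by (meson order_trans)
    qed (rule d)
  qed simp
qed (rule outer_Un_le)

lemma outer_separated_finite:
  fixes R :: "nat \<Rightarrow> 'a::metric_space set"
  assumes sep: "\<And>j k x y. j < k \<Longrightarrow> x \<in> R j \<Longrightarrow> y \<in> R k \<Longrightarrow> d k \<le> dist x y" and d: "\<And>k. 0 < d k"
  shows "(\<Sum>k<N. hausdorff_outer s (R k)) = hausdorff_outer s (\<Union>k<N. R k)"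
proof (induction N)
  case (Suc N)
  have "hausdorff_outer s (\<Union>k<N. R k) + hausdorff_outer s (R N) = hausdorff_outer s ((\<Union>k<N. R k) \<union> R N)"
    by (rule outer_separated[OF _ d[of N]]) (use sep in auto)
  then show ?case using Suc by (simp add: lessThan_Suc Un_commute add.commute)
qed simp

lemma ennreal_suminf_tail:
  fixes f :: "nat \<Rightarrow> ennreal"
  assumes "suminf f \<noteq> top" "0 < e"
  shows "\<exists>n. (\<Sum>k. f (k + n)) \<le> ennreal e"
proof (cases "suminf f = 0")
  case True
  then show ?thesis by (intro exI[of _ 0]) simp
next
  case False
  have "suminf f - ennreal e < suminf f"
    using assms False by (intro ennreal_between) (simp_all add: zero_less_iff_neq_zero top.not_eq_extremum)
  then obtain n where n: "suminf f - ennreal e < (\<Sum>k<n. f k)"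
    unfolding suminf_eq_SUP less_SUP_iff by auto
  have eq: "suminf f = (\<Sum>k. f (k + n)) + (\<Sum>k<n. f k)"
    by (rule suminf_offset) auto
  have fin: "(\<Sum>k<n. f k) \<noteq> top" using eq assms(1) by auto
  have "suminf f \<le> ennreal e + (\<Sum>k<n. f k)"
    using less_imp_le[OF n] unfolding ennreal_minus_le_iff by simp
  then have "(\<Sum>k<n. f k) + (\<Sum>k. f (k + n)) \<le> (\<Sum>k<n. f k) + ennreal e"
    unfolding eq by (simp add: add.commute)
  then show ?thesis using fin unfolding ennreal_add_left_cancel_le by auto
qed

text \<open>Caratheodory's criterion for metric outer measures. The points of \<open>A\<close>
  at distance at least \<open>t n\<close> from \<open>F\<close> form a set \<open>E n\<close>
  that is separated from \<open>F\<close>, so only the part of \<open>A - F\<close> closer to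
  \<open>F\<close> has to be shown small. That part is a union of distance shells \<open>R
  k\<close>; shells whose indices differ by at least two are separated, so the even and the odd
  ones have total measure at most that of \<open>A\<close> each, and the tail of the convergent
  sum is small.\<close>

lemma closed_caratheodory:
  fixes F :: "'a::metric_space set"
  assumes "closed F"
  shows "hausdorff_outer s (A \<inter> F) + hausdorff_outer s (A - F) \<le> hausdorff_outer s A"
proof (cases "F = {} \<or> hausdorff_outer s A = top")
  case True
  then show ?thesis by auto
next
  case False
  then have ne: "F \<noteq> {}" and fin: "hausdorff_outer s A \<noteq> top" by auto
  define t where "t k = 1 / (real k + 1)" for k
  have t_mono: "t k \<le> t j" if "j \<le> k" for j k
    using that by (auto simp: t_def frac_le)
  have t_less: "t (Suc k) < t k" for k
    by (simp add: t_def field_simps)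
  define E where "E k = {x \<in> A. t k \<le> infdist x F}" for k
  define R where "R k = {x \<in> A. t (Suc k) \<le> infdist x F \<and> infdist x F < t k}" for k
  have Rsep: "t (k - 1) - t k \<le> dist x y" if "Suc j < k" "x \<in> R j" "y \<in> R k" for j k x y
  proof -
    have "t (k - 1) \<le> t (Suc j)" using that by (intro t_mono) auto
    moreover have "infdist x F \<le> infdist y F + dist x y" by (rule infdist_triangle)
    ultimately show ?thesis using that by (auto simp: R_def)
  qed
  \<comment> \<open>The shells with even index (\<open>p = 0\<close>) and those with odd index
    (\<open>p = 1\<close>) are pairwise separated.\<close>
  have par: "(\<Sum>k<N. hausdorff_outer s (R (2 * k + p))) \<le> hausdorff_outer s A" for N p
  proof -
    have "(\<Sum>k<N. hausdorff_outer s (R (2 * k + p))) = hausdorff_outer s (\<Union>k<N. R (2 * k + p))"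
    proof (rule outer_separated_finite[where d="\<lambda>k. if k = 0 then 1 else t (2 * k + p - 1) - t (2 * k + p)"])
      fix k show "0 < (if k = 0 then 1 else t (2 * k + p - 1) - t (2 * k + p))"
        using t_less[of "2 * k + p - 1"] by auto
    next
      fix j k x y assume "j < k" "x \<in> R (2 * j + p)" "y \<in> R (2 * k + p)"
      then show "(if k = 0 then 1 else t (2 * k + p - 1) - t (2 * k + p)) \<le> dist x y"
        using Rsep[of "2 * j + p" "2 * k + p" x y] by simp
    qed
    also have "\<dots> \<le> hausdorff_outer s A" by (rule outer_mono) (auto simp: R_def)
    finally show ?thesis .
  qed
  have "(\<Sum>k<N. hausdorff_outer s (R k)) \<le> hausdorff_outer s A + hausdorff_outer s A" for N
  proof -
    have "(\<Sum>k<N. hausdorff_outer s (R k)) \<le> (\<Sum>k<2 * N. hausdorff_outer s (R k))"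
      by (rule sum_mono2) auto
    also have "(\<Sum>k<2 * N. hausdorff_outer s (R k)) =
        (\<Sum>k<N. hausdorff_outer s (R (2 * k + 0))) + (\<Sum>k<N. hausdorff_outer s (R (2 * k + 1)))"
      by (induction N) (auto simp: algebra_simps)
    also have "\<dots> \<le> hausdorff_outer s A + hausdorff_outer s A" by (intro add_mono par)
    finally show ?thesis .
  qed
  then have "(\<Sum>k. hausdorff_outer s (R k)) \<le> hausdorff_outer s A + hausdorff_outer s A"
    by (intro suminf_le_const) auto
  then have Rfin: "(\<Sum>k. hausdorff_outer s (R k)) \<noteq> top" using fin by (auto simp: top_unique)
  show ?thesis
  proof (rule ennreal_le_epsilon)
    fix e :: real assume "0 < e"
    then obtain n where n: "(\<Sum>k. hausdorff_outer s (R (k + n))) \<le> ennreal e"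
      using ennreal_suminf_tail[OF Rfin] by blast
    have "A - F \<subseteq> E n \<union> (\<Union>k. R (k + n))"
    proof
      fix x assume x: "x \<in> A - F"
      then have pos: "0 < infdist x F"
        using \<open>closed F\<close> ne by (metis DiffD2 in_closed_iff_infdist_zero infdist_nonneg less_eq_real_def)
      show "x \<in> E n \<union> (\<Union>k. R (k + n))"
      proof (cases "t n \<le> infdist x F")
        case False
        define m where "m = (LEAST m. t m \<le> infdist x F)"
        obtain m0 where "t m0 \<le> infdist x F"
          using reals_Archimedean[OF pos] by (auto simp: t_def inverse_eq_divide add.commute dest!: less_imp_le)
        then have m: "t m \<le> infdist x F" unfolding m_def by (rule LeastI)
        have mn: "n < m" using m False t_mono[of m n] by (metis not_less order_trans)
        then have "\<not> t (m - 1) \<le> infdist x F"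
          using not_less_Least[of "m - 1" "\<lambda>m. t m \<le> infdist x F"] unfolding m_def by (simp add: m_def)
        then have "x \<in> R (m - 1)" using m mn x by (auto simp: R_def)
        then have "x \<in> R ((m - 1 - n) + n)" using mn by auto
        then show ?thesis by blast
      qed (use x in \<open>auto simp: E_def\<close>)
    qed
    then have "hausdorff_outer s (A - F) \<le> hausdorff_outer s (E n) + hausdorff_outer s (\<Union>k. R (k + n))"
      using outer_mono outer_Un_le order_trans by blast
    also have "\<dots> \<le> hausdorff_outer s (E n) + ennreal e"
      using n outer_UN_le[of s "\<lambda>k. R (k + n)"] by (intro add_left_mono) (rule order_trans)
    finally have *: "hausdorff_outer s (A - F) \<le> hausdorff_outer s (E n) + ennreal e" .
    have "hausdorff_outer s (A \<inter> F) + hausdorff_outer s (E n) = hausdorff_outer s ((A \<inter> F) \<union> E n)"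
    proof (rule outer_separated[where d="t n"])
      fix x y assume "x \<in> A \<inter> F" "y \<in> E n"
      then show "t n \<le> dist x y"
        using infdist_le[of x F y] by (auto simp: E_def dist_commute)
    qed (simp add: t_def)
    also have "\<dots> \<le> hausdorff_outer s A" by (rule outer_mono) (auto simp: E_def)
    finally have "hausdorff_outer s (A \<inter> F) + hausdorff_outer s (E n) \<le> hausdorff_outer s A" .
    note E_le = this
    have "hausdorff_outer s (A \<inter> F) + hausdorff_outer s (A - F)
        \<le> hausdorff_outer s (A \<inter> F) + (hausdorff_outer s (E n) + ennreal e)"
      by (rule add_left_mono) (rule *)
    also have "\<dots> \<le> hausdorff_outer s A + ennreal e"
      using add_right_mono[OF E_le, of "ennreal e"] by (simp add: add.assoc)
    finally show "hausdorff_outer s (A \<inter> F) + hausdorff_outer s (A - F) \<le> hausdorff_outer s A + ennreal e" .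
  qed
qed

lemma measure_space_hausdorff:
  "measure_space (UNIV :: 'a::metric_space set) (sets borel) (hausdorff_outer s)"
proof -
  interpret sigma_algebra "UNIV :: 'a set" "Pow UNIV" by (rule sigma_algebra_Pow)
  let ?L = "lambda_system (UNIV :: 'a set) (Pow UNIV) (hausdorff_outer s)"
  have "outer_measure_space (Pow (UNIV :: 'a set)) (hausdorff_outer s)"
    unfolding outer_measure_space_def positive_def increasing_def countably_subadditive_def
    by (auto intro: outer_mono outer_UN_le)
  from caratheodory_lemma[OF this] have ms: "measure_space UNIV ?L (hausdorff_outer s)" .
  have "F \<in> ?L" if "closed F" for F
    unfolding lambda_system_eq
  proof (intro CollectI conjI ballI antisym)
    fix x :: "'a set"
    show "hausdorff_outer s (x \<inter> F) + hausdorff_outer s (x - F) \<le> hausdorff_outer s x"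
      by (rule closed_caratheodory[OF that])
    show "hausdorff_outer s x \<le> hausdorff_outer s (x \<inter> F) + hausdorff_outer s (x - F)"
      using outer_Un_le[of s "x \<inter> F" "x - F"] by (simp add: Int_Diff_Un)
  qed simp
  then have "sigma_sets UNIV (Collect closed) \<subseteq> ?L"
    using ms sigma_algebra.sigma_sets_subset[of UNIV ?L "Collect closed"]
    by (auto simp: measure_space_def)
  then have sub: "sets borel \<subseteq> ?L"
    by (simp add: borel_eq_closed)
  show ?thesis
    unfolding measure_space_def
  proof (intro conjI)
    show "sigma_algebra UNIV (sets (borel :: 'a measure))"
      using sets.sigma_algebra_axioms[of "borel :: 'a measure"] by simp
    show "countably_additive (sets (borel :: 'a measure)) (hausdorff_outer s)"
      using ms sub unfolding measure_space_def countably_additive_def by blast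
  qed (simp add: positive_def)
qed

lemma sets_hausdorff_measure [simp, measurable_cong]: "sets (hausdorff_measure s) = sets borel"
  unfolding hausdorff_measure_def using sets.sigma_sets_eq[of borel] by (subst sets_measure_of) auto

lemma space_hausdorff_measure [simp]: "space (hausdorff_measure s) = UNIV"
  unfolding hausdorff_measure_def by (subst space_measure_of) auto

lemma emeasure_hausdorff_measure:
  "A \<in> sets borel \<Longrightarrow> emeasure (hausdorff_measure s) A = hausdorff_outer s A"
  unfolding hausdorff_measure_def
  using measure_space_hausdorff[of s] sets.sigma_algebra_axioms[of borel]
  by (intro emeasure_measure_of_sigma) (auto simp: measure_space_def)

text \<open>The images of the sets of a cover of \<open>A\<close>, intersected with
  \<open>A\<close>, cover the image, and their diameters grow by the factor \<open>L\<close> at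
  most. A scale \<open>\<delta>\<close> in the image corresponds to \<open>\<delta> / L\<close>
  upstairs.\<close>

lemma outer_Lipschitz_image:
  fixes f :: "'a::metric_space \<Rightarrow> 'b::metric_space"
  assumes L: "0 < L" and f: "\<And>x y. x \<in> A \<Longrightarrow> y \<in> A \<Longrightarrow> dist (f x) (f y) \<le> L * dist x y"
  shows "hausdorff_outer s (f ` A) \<le> ennreal (L ^ s) * hausdorff_outer s A"
proof (rule outer_leI)
  fix \<delta> :: real assume \<delta>: "0 < \<delta>"
  have "hausdorff_premeasure s \<delta> (f ` A) \<le> ennreal (L ^ s) * hausdorff_premeasure s (\<delta> / L) A"
  proof -
    have *: "hausdorff_premeasure s \<delta> (f ` A) \<le> ennreal (L ^ s) * (\<Sum>i. hausdorff_cost s (C i))"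
      if C: "delta_cover (\<delta> / L) A C" for C
    proof -
      define D where "D i = f ` (C i \<inter> A)" for i
      have diam: "bounded (D i) \<and> diameter (D i) \<le> L * diameter (C i)" for i
      proof -
        have b: "bounded (C i)" using C by (auto simp: delta_cover_def)
        have le: "dist u v \<le> L * diameter (C i)" if uv: "u \<in> D i" "v \<in> D i" for u v
        proof -
          obtain x y where xy: "x \<in> C i" "x \<in> A" "y \<in> C i" "y \<in> A" "u = f x" "v = f y"
            using uv by (auto simp: D_def)
          have "dist u v \<le> L * dist x y" using f xy by simp
          also have "\<dots> \<le> L * diameter (C i)"
            using L diameter_bounded_bound[OF b xy(1,3)] by simp
          finally show ?thesis .
        qed
        then have "bounded (D i)" unfolding bounded_two_points by blast
        moreover have "diameter (D i) \<le> L * diameter (C i)"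
        proof (cases "D i = {}")
          case True
          then show ?thesis using diameter_ge_0[OF b] L by (simp add: diameter_empty)
        next
          case False
          then show ?thesis unfolding diameter_def[of "D i"] by (auto intro!: cSUP_least le)
        qed
        ultimately show ?thesis by blast
      qed
      have "delta_cover \<delta> (f ` A) D"
        unfolding delta_cover_def
      proof (intro conjI allI)
        show "f ` A \<subseteq> (\<Union>i. D i)" using C unfolding delta_cover_def D_def by blast
        fix i
        show "bounded (D i)" using diam by blast
        have "L * diameter (C i) \<le> L * (\<delta> / L)" using C L by (intro mult_left_mono) (auto simp: delta_cover_def)
        then show "diameter (D i) \<le> \<delta>" using diam[of i] L by auto
      qed
      then have "hausdorff_premeasure s \<delta> (f ` A) \<le> (\<Sum>i. hausdorff_cost s (D i))"
        by (rule premeasure_le)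
      also have "\<dots> \<le> (\<Sum>i. ennreal (L ^ s) * hausdorff_cost s (C i))"
      proof (rule suminf_le)
        fix i
        show "hausdorff_cost s (D i) \<le> ennreal (L ^ s) * hausdorff_cost s (C i)"
        proof (cases "D i = {}")
          case False
          then have "C i \<noteq> {}" by (auto simp: D_def)
          have dn: "0 \<le> diameter (D i)" using diam diameter_ge_0 by blast
          have "(diameter (D i) / 2) ^ s \<le> (L * (diameter (C i) / 2)) ^ s"
            using diam[of i] dn by (intro power_mono) auto
          then have "unit_ball_vol (real s) * (diameter (D i) / 2) ^ s
              \<le> L ^ s * (unit_ball_vol (real s) * (diameter (C i) / 2) ^ s)"
            using mult_left_mono[of "(diameter (D i) / 2) ^ s" "(L * (diameter (C i) / 2)) ^ s" "unit_ball_vol (real s)"]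
            by (simp add: power_mult_distrib mult.left_commute del: times_divide_eq_right)
          then have "ennreal (unit_ball_vol (real s) * (diameter (D i) / 2) ^ s)
              \<le> ennreal (L ^ s) * ennreal (unit_ball_vol (real s) * (diameter (C i) / 2) ^ s)"
            using L by (subst ennreal_mult'[symmetric]) (auto intro: ennreal_leI)
          then show ?thesis using False \<open>C i \<noteq> {}\<close> by (simp add: hausdorff_cost_def)
        qed simp
      qed auto
      also have "\<dots> = ennreal (L ^ s) * (\<Sum>i. hausdorff_cost s (C i))" by (rule ennreal_suminf_cmult)
      finally show ?thesis .
    qed
    have pos: "0 < L ^ s" using L by simp
    have "hausdorff_premeasure s \<delta> (f ` A) / ennreal (L ^ s) \<le> hausdorff_premeasure s (\<delta> / L) A"
    proof (rule premeasure_geI)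
      fix C assume "delta_cover (\<delta> / L) A C"
      from *[OF this] show "hausdorff_premeasure s \<delta> (f ` A) / ennreal (L ^ s) \<le> (\<Sum>i. hausdorff_cost s (C i))"
        using pos by (subst divide_le_posI_ennreal) (auto simp: mult.commute)
    qed
    then have "(hausdorff_premeasure s \<delta> (f ` A) / ennreal (L ^ s)) * ennreal (L ^ s)
        \<le> hausdorff_premeasure s (\<delta> / L) A * ennreal (L ^ s)"
      by (rule mult_right_mono) simp
    moreover have "(hausdorff_premeasure s \<delta> (f ` A) / ennreal (L ^ s)) * ennreal (L ^ s) = hausdorff_premeasure s \<delta> (f ` A)"
    proof -
      have "ennreal (L ^ s) / ennreal (L ^ s) = 1"
        by (rule ennreal_divide_self) (use pos L in auto)
      then show ?thesis by (metis ennreal_times_divide ennreal_divide_times mult.right_neutral)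
    qed
    ultimately show ?thesis by (simp add: mult.commute)
  qed
  also have "\<dots> \<le> ennreal (L ^ s) * hausdorff_outer s A"
    using \<delta> L by (intro mult_left_mono premeasure_le_outer) auto
  finally show "hausdorff_premeasure s \<delta> (f ` A) \<le> ennreal (L ^ s) * hausdorff_outer s A" .
qed

text \<open>The Lipschitz bound for the map and for its inverse.\<close>

lemma outer_similarity_image:
  fixes f :: "'a::metric_space \<Rightarrow> 'b::metric_space"
  assumes L: "0 < L" and f: "\<And>x y. dist (f x) (f y) = L * dist x y"
  shows "hausdorff_outer s (f ` A) = ennreal (L ^ s) * hausdorff_outer s A"
proof (rule antisym)
  show "hausdorff_outer s (f ` A) \<le> ennreal (L ^ s) * hausdorff_outer s A"
    using L f by (intro outer_Lipschitz_image) auto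
  have "inj f" using f L by (metis dist_eq_0_iff injI mult_eq_0_iff less_irrefl)
  then have "hausdorff_outer s (inv f ` f ` A) \<le> ennreal ((1/L) ^ s) * hausdorff_outer s (f ` A)"
    using L f by (intro outer_Lipschitz_image) (auto)
  then have "hausdorff_outer s A \<le> ennreal ((1/L) ^ s) * hausdorff_outer s (f ` A)"
    using \<open>inj f\<close> by (simp add: image_image)
  then have "ennreal (L ^ s) * hausdorff_outer s A
      \<le> ennreal (L ^ s) * (ennreal ((1/L) ^ s) * hausdorff_outer s (f ` A))"
    by (rule mult_left_mono) simp
  also have "\<dots> = hausdorff_outer s (f ` A)"
    using L by (simp add: mult.assoc[symmetric] ennreal_mult'[symmetric] power_divide)
  finally show "ennreal (L ^ s) * hausdorff_outer s A \<le> hausdorff_outer s (f ` A)" .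
qed

section \<open>Area on hyperplanes and Lebesgue measure\<close>

lemma hausdorff_measure_distr_isometry:
  fixes f :: "'a::metric_space \<Rightarrow> 'a"
  assumes iso: "\<And>x y. dist (f x) (f y) = dist x y" and "surj f"
  shows "distr (hausdorff_measure s) borel f = hausdorff_measure s"
proof (rule measure_eqI)
  have "continuous_on UNIV f" unfolding continuous_on_iff using iso by auto
  then have [measurable]: "f \<in> borel_measurable borel" by (rule borel_measurable_continuous_onI)
  fix A assume "A \<in> sets (distr (hausdorff_measure s) borel f)"
  then have [measurable]: "A \<in> sets borel" by simp
  have "f -` A \<in> sets borel" using measurable_sets[of f borel borel A] by simp
  then have "emeasure (distr (hausdorff_measure s) borel f) A = hausdorff_outer s (f -` A)"
    by (subst emeasure_distr) (simp_all add: emeasure_hausdorff_measure)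
  also have "\<dots> = hausdorff_outer s (f ` (f -` A))"
    using outer_similarity_image[of 1 f s "f -` A"] iso by simp
  also have "f ` (f -` A) = A" using \<open>surj f\<close> by (simp add: surj_image_vimage_eq)
  finally show "emeasure (distr (hausdorff_measure s) borel f) A = emeasure (hausdorff_measure s) A"
    by (simp add: emeasure_hausdorff_measure)
qed simp

lemma premeasure_le_finite_cover:
  assumes K: "finite K" and cov: "A \<subseteq> (\<Union>k\<in>K. C k)"
    and C: "\<And>k. k \<in> K \<Longrightarrow> bounded (C k) \<and> diameter (C k) \<le> \<delta>" and \<delta>: "0 \<le> \<delta>"
  shows "hausdorff_premeasure s \<delta> A \<le> (\<Sum>k\<in>K. hausdorff_cost s (C k))"
proof -
  obtain e where e: "bij_betw e {0..<card K} K" using ex_bij_betw_nat_finite[OF K] by blast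
  define D where "D m = (if m < card K then C (e m) else {})" for m
  have eK: "e m \<in> K" if "m < card K" for m using e that by (auto simp: bij_betw_def)
  have "delta_cover \<delta> A D"
    unfolding delta_cover_def
  proof (intro conjI allI subsetI)
    fix x assume "x \<in> A"
    then obtain k where k: "k \<in> K" "x \<in> C k" using cov by blast
    then obtain m where "m < card K" "e m = k" using e unfolding bij_betw_def by (metis atLeastLessThan_iff imageE)
    then have "x \<in> D m" using k by (simp add: D_def)
    then show "x \<in> (\<Union>i. D i)" by blast
  next
    fix m show "bounded (D m)" "diameter (D m) \<le> \<delta>" using C eK \<delta> by (auto simp: D_def diameter_empty)
  qed
  then have "hausdorff_premeasure s \<delta> A \<le> (\<Sum>m. hausdorff_cost s (D m))" by (rule premeasure_le)
  also have "\<dots> = (\<Sum>m\<in>{0..<card K}. hausdorff_cost s (D m))"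
    by (rule suminf_finite) (auto simp: D_def)
  also have "\<dots> = (\<Sum>m\<in>{0..<card K}. hausdorff_cost s (C (e m)))"
    by (rule sum.cong) (auto simp: D_def)
  also have "\<dots> = (\<Sum>k\<in>K. hausdorff_cost s (C k))"
    by (rule sum.reindex_bij_betw[OF e])
  finally show ?thesis .
qed

text \<open>A grid of \<open>N ^ (n - 1)\<close> cubes of side \<open>2 L / N\<close> covers the
  slice, and the sum of their costs does not depend on \<open>N\<close>. The strict bound on the
  coordinates makes the integer part a valid grid index.\<close>

lemma hyperplane_cube_finite:
  fixes i :: "'a::euclidean_space"
  assumes i: "i \<in> Basis" and L: "0 < L"
  shows "hausdorff_outer (DIM('a) - 1) {x::'a. x \<bullet> i = 0 \<and> (\<forall>j\<in>Basis. \<bar>x \<bullet> j\<bar> < L)} < top"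
proof -
  let ?A = "{x::'a. x \<bullet> i = 0 \<and> (\<forall>j\<in>Basis. \<bar>x \<bullet> j\<bar> < L)}"
  let ?s = "DIM('a) - 1" and ?n = "real DIM('a)"
  let ?W = "unit_ball_vol (real ?s) * (?n * L) ^ ?s"
  have "hausdorff_outer ?s ?A \<le> ennreal ?W"
  proof (rule outer_leI)
    fix \<delta> :: real assume \<delta>: "0 < \<delta>"
    obtain N :: nat where N: "2 * ?n * L / \<delta> < real N" using reals_Archimedean2 by blast
    have N0: "0 < N" using N \<delta> L by (metis divide_pos_pos gr0I less_asym mult_pos_pos of_nat_0 of_nat_0_less_iff DIM_positive zero_less_numeral)
    define K where "K = PiE (Basis - {i}) (\<lambda>_. {..<N})"
    define C where "C k = {x::'a. x \<bullet> i = 0 \<and> (\<forall>j\<in>Basis - {i}. 2 * L * real (k j) / N \<le> x \<bullet> j + L \<and> x \<bullet> j + L \<le> 2 * L * (real (k j) + 1) / N)}" for k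
    have dist_C: "dist x y \<le> ?n * (2 * L / N)" if "x \<in> C k" "y \<in> C k" for x y k
    proof -
      have "\<bar>(x - y) \<bullet> b\<bar> \<le> 2 * L / N" if b: "b \<in> Basis" for b
      proof (cases "b = i")
        case True then show ?thesis using \<open>x \<in> C k\<close> \<open>y \<in> C k\<close> L by (simp add: C_def inner_diff_left)
      next
        case False
        have "2 * L * (real (k b) + 1) / N = 2 * L * real (k b) / N + 2 * L / N"
          by (simp add: distrib_left add_divide_distrib)
        then show ?thesis using \<open>x \<in> C k\<close> \<open>y \<in> C k\<close> b False
          by (force simp: C_def inner_diff_left abs_le_iff)
      qed
      then have "(\<Sum>b\<in>Basis. \<bar>(x - y) \<bullet> b\<bar>) \<le> (\<Sum>b\<in>(Basis::'a set). 2 * L / N)" by (rule sum_mono)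
      then show ?thesis using norm_le_l1[of "x - y"] by (simp add: dist_norm)
    qed
    have small: "?n * (2 * L / N) \<le> \<delta>" using N N0 \<delta> by (simp add: field_simps)
    have bC: "bounded (C k)" for k unfolding bounded_two_points using dist_C by blast
    have diam: "diameter (C k) \<le> ?n * (2 * L / N)" for k
      by (rule diameter_le) (use dist_C L in \<open>auto simp: dist_norm\<close>)
    have "hausdorff_premeasure ?s \<delta> ?A \<le> (\<Sum>k\<in>K. hausdorff_cost ?s (C k))"
    proof (rule premeasure_le_finite_cover)
      show "finite K" unfolding K_def by (intro finite_PiE) auto
      show "?A \<subseteq> (\<Union>k\<in>K. C k)"
      proof
        fix x assume x: "x \<in> ?A"
        define k where "k = restrict (\<lambda>j. nat \<lfloor>(x \<bullet> j + L) * N / (2 * L)\<rfloor>) (Basis - {i})"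
        have kj: "k j < N \<and> 2 * L * real (k j) / N \<le> x \<bullet> j + L \<and> x \<bullet> j + L \<le> 2 * L * (real (k j) + 1) / N"
          if j: "j \<in> Basis - {i}" for j
        proof -
          define q where "q = (x \<bullet> j + L) * N / (2 * L)"
          have xj: "\<bar>x \<bullet> j\<bar> < L" using x j by auto
          have q0: "0 \<le> q" using xj L by (auto simp: q_def)
          have "x \<bullet> j + L < 2 * L" using xj by auto
          then have qN: "q < N" using L N0 by (simp add: q_def field_simps)
          have kq: "k j = nat \<lfloor>q\<rfloor>" using j by (simp add: k_def q_def)
          have rk: "real (k j) = of_int \<lfloor>q\<rfloor>" using q0 by (simp add: kq)
          have 1: "real (k j) \<le> q" "q \<le> real (k j) + 1" unfolding rk by linarith+
          have eq: "x \<bullet> j + L = 2 * L * q / N" using L N0 by (simp add: q_def)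
          have "real (k j) < N" using 1 qN by linarith
          then show ?thesis unfolding eq using 1 L N0 by (auto intro!: divide_right_mono mult_left_mono)
        qed
        then have "k \<in> K" "x \<in> C k" using x by (auto simp: K_def C_def k_def)
        then show "x \<in> (\<Union>k\<in>K. C k)" by blast
      qed
    qed (use bC order_trans[OF diam small] \<delta> in \<open>auto\<close>)
    also have "\<dots> \<le> (\<Sum>k\<in>K. ennreal (unit_ball_vol (real ?s) * (?n * (2 * L / N) / 2) ^ ?s))"
    proof (rule sum_mono)
      fix k
      have "(diameter (C k) / 2) ^ ?s \<le> (?n * (2 * L / N) / 2) ^ ?s"
        using divide_right_mono[OF diam[of k], of 2] diameter_ge_0[OF bC[of k]] by (intro power_mono) simp_all
      then show "hausdorff_cost ?s (C k) \<le> ennreal (unit_ball_vol (real ?s) * (?n * (2 * L / N) / 2) ^ ?s)"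
        unfolding hausdorff_cost_def by (auto intro!: ennreal_leI mult_left_mono)
    qed
    also have "\<dots> = of_nat (card K) * ennreal (unit_ball_vol (real ?s) * (?n * L / N) ^ ?s)"
      by simp
    also have "\<dots> = ennreal (real (card K) * (unit_ball_vol (real ?s) * (?n * L / N) ^ ?s))"
      by (simp add: ennreal_mult' ennreal_of_nat_eq_real_of_nat)
    also have "card K = N ^ ?s" using i by (simp add: K_def card_PiE)
    also have "real (N ^ ?s) * (unit_ball_vol (real ?s) * (?n * L / N) ^ ?s) = ?W"
      using N0 by (simp add: power_divide)
    finally show "hausdorff_premeasure ?s \<delta> ?A \<le> ennreal ?W" .
  qed
  then show ?thesis by (rule le_less_trans) simp
qed

definition unit_face :: "'a::euclidean_space \<Rightarrow> 'a set" where
  "unit_face i = {x. x \<bullet> i = 0 \<and> (\<forall>j\<in>Basis - {i}. 0 \<le> x \<bullet> j \<and> x \<bullet> j \<le> 1)}"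

text \<open>A set of diameter \<open>d\<close> in the face is contained in a box with sides
  \<open>2 d\<close>; thickened by \<open>1\<close> in the direction \<open>i\<close>, such
  boxes cover the unit cube. Comparing Lebesgue measures bounds the cost of every cover from
  below.\<close>

lemma unit_face_pos:
  fixes i :: "'a::euclidean_space"
  assumes i: "i \<in> Basis"
  shows "0 < hausdorff_outer (DIM('a) - 1) (unit_face i)"
proof -
  let ?s = "DIM('a) - 1"
  let ?w = "unit_ball_vol (real ?s)"
  have w: "0 < ?w" by simp
  have "ennreal (?w / 4 ^ ?s) \<le> hausdorff_premeasure ?s 1 (unit_face i)"
  proof (rule premeasure_geI)
    fix C assume C: "delta_cover 1 (unit_face i) C"
    define y where "y m = (SOME y. y \<in> C m)" for m
    define d where "d m = diameter (C m)" for m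
    have d0: "0 \<le> d m" for m using C by (auto simp: d_def delta_cover_def intro: diameter_ge_0)
    define l where "l m = (\<Sum>j\<in>Basis. (if j = i then 0 else y m \<bullet> j - d m) *\<^sub>R j)" for m
    define u where "u m = (\<Sum>j\<in>Basis. (if j = i then 1 else y m \<bullet> j + d m) *\<^sub>R j)" for m
    define B where "B m = (if C m = {} then {} else cbox (l m) (u m))" for m
    have lu: "l m \<bullet> j = (if j = i then 0 else y m \<bullet> j - d m)" "u m \<bullet> j = (if j = i then 1 else y m \<bullet> j + d m)"
      if "j \<in> Basis" for m j using that by (simp_all add: l_def u_def)
    have "emeasure lborel (B m) \<le> ennreal (4 ^ ?s / ?w) * hausdorff_cost ?s (C m)" for m
    proof (cases "C m = {}")
      case False
      have "emeasure lborel (B m) = ennreal (\<Prod>b\<in>Basis. (u m - l m) \<bullet> b)"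
        using False d0[of m] by (auto simp: B_def lu intro!: emeasure_lborel_cbox)
      also have "(\<Prod>b\<in>Basis. (u m - l m) \<bullet> b) = (\<Prod>b\<in>Basis. if b = i then 1 else 2 * d m)"
        by (rule prod.cong) (auto simp: lu inner_diff_left)
      also have "\<dots> = (2 * d m) ^ ?s"
        using i by (subst prod.remove[OF _ i]) simp_all
      also have "\<dots> = 4 ^ ?s / ?w * (?w * (d m / 2) ^ ?s)"
      proof -
        have "2 * d m = 4 * (d m / 2)" by simp
        then show ?thesis using w by (metis nonzero_mult_div_cancel_left order_less_irrefl power_mult_distrib times_divide_eq_left times_divide_eq_right mult.commute)
      qed
      also have "ennreal \<dots> = ennreal (4 ^ ?s / ?w) * hausdorff_cost ?s (C m)"
        using False by (subst ennreal_mult') (auto simp: hausdorff_cost_def d_def)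
      finally show ?thesis by simp
    qed (simp add: B_def)
    moreover have "cbox 0 One \<subseteq> (\<Union>m. B m)"
    proof
      fix x :: 'a assume x: "x \<in> cbox 0 One"
      define x' where "x' = x - (x \<bullet> i) *\<^sub>R i"
      have x'j: "x' \<bullet> j = (if j = i then 0 else x \<bullet> j)" if "j \<in> Basis" for j
        using that i by (simp add: x'_def inner_diff_left inner_Basis)
      have "x' \<in> unit_face i" using x i by (auto simp: unit_face_def x'j mem_box)
      then obtain m where m: "x' \<in> C m" using C by (auto simp: delta_cover_def)
      then have ym: "y m \<in> C m" unfolding y_def by (metis someI)
      have "dist x' (y m) \<le> d m" using C m ym unfolding d_def
        by (intro diameter_bounded_bound) (auto simp: delta_cover_def)
      then have "\<bar>(x' - y m) \<bullet> j\<bar> \<le> d m" if "j \<in> Basis" for j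
        using Basis_le_norm[OF that, of "x' - y m"] by (simp add: dist_norm)
      then have "x \<in> cbox (l m) (u m)"
        using x i unfolding mem_box by (force simp: lu x'j inner_diff_left abs_le_iff)
      then show "x \<in> (\<Union>m. B m)" using m by (auto simp: B_def)
    qed
    ultimately have "emeasure lborel (cbox 0 One :: 'a set) \<le> (\<Sum>m. ennreal (4 ^ ?s / ?w) * hausdorff_cost ?s (C m))"
    proof -
      have "emeasure lborel (cbox 0 One :: 'a set) \<le> emeasure lborel (\<Union>m. B m)"
        using \<open>cbox 0 One \<subseteq> (\<Union>m. B m)\<close> by (intro emeasure_mono) (auto simp: B_def)
      also have "\<dots> \<le> (\<Sum>m. emeasure lborel (B m))"
        by (intro emeasure_subadditive_countably) (auto simp: B_def)
      also have "\<dots> \<le> (\<Sum>m. ennreal (4 ^ ?s / ?w) * hausdorff_cost ?s (C m))"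
        by (rule suminf_le) (use \<open>\<And>m. emeasure lborel (B m) \<le> _ m\<close> in auto)
      finally show ?thesis .
    qed
    also have "\<dots> = ennreal (4 ^ ?s / ?w) * (\<Sum>m. hausdorff_cost ?s (C m))" by (rule ennreal_suminf_cmult)
    finally have "1 \<le> ennreal (4 ^ ?s / ?w) * (\<Sum>m. hausdorff_cost ?s (C m))" by simp
    then have "ennreal (?w / 4 ^ ?s) * 1 \<le> ennreal (?w / 4 ^ ?s) * (ennreal (4 ^ ?s / ?w) * (\<Sum>m. hausdorff_cost ?s (C m)))"
      by (rule mult_left_mono) simp
    also have "\<dots> = (\<Sum>m. hausdorff_cost ?s (C m))"
    proof -
      have "ennreal (?w / 4 ^ ?s) * ennreal (4 ^ ?s / ?w) = 1"
        using w by (subst ennreal_mult'[symmetric]) (simp_all del: of_nat_diff add: less_imp_neq[THEN not_sym])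
      then show ?thesis by (simp add: mult.assoc[symmetric])
    qed
    finally show "ennreal (?w / 4 ^ ?s) \<le> (\<Sum>m. hausdorff_cost ?s (C m))" by simp
  qed
  also have "\<dots> \<le> hausdorff_outer ?s (unit_face i)" by (rule premeasure_le_outer) simp
  finally show ?thesis using w by (meson divide_pos_pos ennreal_less_zero_iff less_le_trans zero_less_numeral zero_less_power)
qed

lemma nn_integral_lborel_reflect:
  fixes F :: "'a::euclidean_space \<Rightarrow> ennreal"
  assumes [measurable]: "F \<in> borel_measurable borel"
  shows "(\<integral>\<^sup>+z. F (x - z) \<partial>lborel) = (\<integral>\<^sup>+z. F z \<partial>lborel)"
proof -
  have "(\<integral>\<^sup>+z. F z \<partial>lborel) = (\<integral>\<^sup>+z. F z \<partial>density (distr lborel borel (\<lambda>z. x + (-1) *\<^sub>R z)) (\<lambda>_. ennreal (\<bar>-1\<bar> ^ DIM('a))))"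
    using lborel_affine[of "-1" x] by simp
  also have "\<dots> = (\<integral>\<^sup>+z. F (x - z) \<partial>lborel)"
    by (simp add: density_1 nn_integral_distr)
  finally show ?thesis ..
qed

lemma nn_integral_lborel_translate:
  fixes F :: "'a::euclidean_space \<Rightarrow> ennreal"
  assumes [measurable]: "F \<in> borel_measurable borel"
  shows "(\<integral>\<^sup>+z. F (x + z) \<partial>lborel) = (\<integral>\<^sup>+z. F z \<partial>lborel)"
proof -
  have "(\<integral>\<^sup>+z. F z \<partial>lborel) = (\<integral>\<^sup>+z. F z \<partial>distr lborel borel ((+) x))"
    by (simp add: lborel_distr_plus)
  then show ?thesis by (simp add: nn_integral_distr)
qed

text \<open>Uniqueness of Haar measure by the usual double integral: for \<open>F\<close> the
  indicator of \<open>A\<close> and \<open>G\<close> that of the unit cube, \<open>F x * G (z +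
  x)\<close> is integrated over \<open>x\<close> with \<open>M\<close> and over \<open>z\<close>
  with Lebesgue measure. Integrating over \<open>z\<close> first gives the measure of
  \<open>A\<close> times \<open>1\<close>; shifting \<open>x\<close> by \<open>- z\<close>
  before gives the Lebesgue measure of \<open>A\<close> times that of the cube under
  \<open>M\<close>.\<close>

lemma translation_invariant_eq_lborel:
  fixes M :: "'a::euclidean_space measure"
  assumes sets [simp, measurable_cong]: "sets M = sets borel" and sf: "sigma_finite_measure M"
    and inv: "\<And>z. distr M borel ((+) z) = M"
  shows "M = density lborel (\<lambda>_. emeasure M (cbox 0 One))"
proof (rule measure_eqI)
  interpret M: sigma_finite_measure M by (rule sf)
  interpret pair_sigma_finite M lborel ..
  fix A assume "A \<in> sets M"
  then have [measurable]: "A \<in> sets borel" by simp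
  let ?F = "indicator A :: 'a \<Rightarrow> ennreal" and ?G = "indicator (cbox 0 One) :: 'a \<Rightarrow> ennreal"
  have shift: "(\<integral>\<^sup>+x. h (z + x) \<partial>M) = (\<integral>\<^sup>+x. h x \<partial>M)" if [measurable]: "h \<in> borel_measurable borel"
    for h :: "'a \<Rightarrow> ennreal" and z
  proof -
    have "(\<integral>\<^sup>+x. h x \<partial>M) = (\<integral>\<^sup>+x. h x \<partial>distr M borel ((+) z))" by (simp add: inv)
    then show ?thesis by (simp add: nn_integral_distr)
  qed
  have G1: "(\<integral>\<^sup>+z. ?G (z + x) \<partial>lborel) = 1" for x
    using nn_integral_lborel_translate[of ?G x] by (simp add: add.commute)
  have "emeasure M A = (\<integral>\<^sup>+x. ?F x * (\<integral>\<^sup>+z. ?G (z + x) \<partial>lborel) \<partial>M)"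
    by (simp add: G1)
  also have "\<dots> = (\<integral>\<^sup>+x. (\<integral>\<^sup>+z. ?F x * ?G (z + x) \<partial>lborel) \<partial>M)"
    by (subst nn_integral_cmult[symmetric]) simp_all
  also have "\<dots> = (\<integral>\<^sup>+z. (\<integral>\<^sup>+x. ?F x * ?G (z + x) \<partial>M) \<partial>lborel)"
    by (rule Fubini'[symmetric]) measurable
  also have "\<dots> = (\<integral>\<^sup>+z. (\<integral>\<^sup>+x. ?F (x - z) * ?G x \<partial>M) \<partial>lborel)"
    using shift[of "\<lambda>x. ?F x * ?G (z + x)" "- z" for z] by (simp add: algebra_simps)
  also have "\<dots> = (\<integral>\<^sup>+x. (\<integral>\<^sup>+z. ?F (x - z) * ?G x \<partial>lborel) \<partial>M)"
    by (rule Fubini') measurable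
  also have "\<dots> = (\<integral>\<^sup>+x. emeasure lborel A * ?G x \<partial>M)"
    by (subst nn_integral_multc) (simp_all add: nn_integral_lborel_reflect)
  also have "\<dots> = emeasure lborel A * emeasure M (cbox 0 One)"
    by (subst nn_integral_cmult) simp_all
  also have "\<dots> = emeasure M (cbox 0 One) * emeasure lborel A" by (rule mult.commute)
  finally show "emeasure M A = emeasure (density lborel (\<lambda>_. emeasure M (cbox 0 One))) A"
    by (simp add: emeasure_density nn_integral_cmult_indicator)
qed simp

text \<open>The area on the hyperplane through the origin, kept as a measure on the whole space
  so that all translations act on it.\<close>

definition plane_measure :: "'a::euclidean_space \<Rightarrow> 'a measure" where
  "plane_measure i = density (hausdorff_measure (DIM('a) - 1)) (indicator {x. x \<bullet> i = 0})"

lemma sets_plane_measure [simp, measurable_cong]: "sets (plane_measure i) = sets borel"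
  and space_plane_measure [simp]: "space (plane_measure i) = UNIV"
  by (simp_all add: plane_measure_def)

lemma hyperplane_borel [measurable]: "{x::'a::euclidean_space. x \<bullet> i = c} \<in> sets borel"
  using closed_hyperplane[of i c] by (simp add: inner_commute borel_closed)

lemma emeasure_plane_measure:
  fixes i :: "'a::euclidean_space"
  assumes [measurable]: "A \<in> sets borel"
  shows "emeasure (plane_measure i) A = hausdorff_outer (DIM('a) - 1) ({x. x \<bullet> i = 0} \<inter> A)"
proof -
  have "emeasure (plane_measure i) A
      = (\<integral>\<^sup>+x. indicator {x. x \<bullet> i = 0} x * indicator A x \<partial>hausdorff_measure (DIM('a) - 1))"
    unfolding plane_measure_def by (rule emeasure_density) simp_all
  also have "\<dots> = (\<integral>\<^sup>+x. indicator ({x. x \<bullet> i = 0} \<inter> A) x \<partial>hausdorff_measure (DIM('a) - 1))"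
    by (rule nn_integral_cong) (simp split: split_indicator)
  finally have "emeasure (plane_measure i) A
      = (\<integral>\<^sup>+x. indicator ({x. x \<bullet> i = 0} \<inter> A) x \<partial>hausdorff_measure (DIM('a) - 1))" .
  then show ?thesis by (simp add: emeasure_hausdorff_measure)
qed

lemma plane_measure_bounded_finite:
  fixes i :: "'a::euclidean_space"
  assumes i: "i \<in> Basis" and A: "A \<in> sets borel" "bounded A"
  shows "emeasure (plane_measure i) A < top"
proof -
  obtain B where B: "\<And>x. x \<in> A \<Longrightarrow> norm x \<le> B" using A(2) by (auto simp: bounded_iff)
  let ?L = "\<bar>B\<bar> + 1"
  have "emeasure (plane_measure i) A \<le> hausdorff_outer (DIM('a) - 1) {x::'a. x \<bullet> i = 0 \<and> (\<forall>j\<in>Basis. \<bar>x \<bullet> j\<bar> < ?L)}"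
    unfolding emeasure_plane_measure[OF A(1)]
  proof (rule outer_mono, safe)
    fix x j :: 'a assume "x \<in> A" "j \<in> Basis"
    then show "\<bar>x \<bullet> j\<bar> < ?L" using Basis_le_norm[of j x] B[of x] by linarith
  qed
  also have "\<dots> < top" by (rule hyperplane_cube_finite[OF i]) simp
  finally show ?thesis .
qed

lemma sigma_finite_bounded_sets:
  fixes M :: "'a::euclidean_space measure"
  assumes [simp]: "sets M = sets borel" and fin: "\<And>A. A \<in> sets borel \<Longrightarrow> bounded A \<Longrightarrow> emeasure M A < top"
  shows "sigma_finite_measure M"
proof
  have sp: "space M = UNIV" using sets_eq_imp_space_eq[OF assms(1)] by simp
  have "(\<Union>n::nat. ball 0 (real n)) = (UNIV :: 'a set)" using reals_Archimedean2 by (auto simp: dist_norm)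
  moreover have "emeasure M (ball 0 (real n)) \<noteq> \<infinity>" for n
    using fin[of "ball 0 (real n)"] by simp
  ultimately show "\<exists>A. countable A \<and> A \<subseteq> sets M \<and> \<Union> A = space M \<and> (\<forall>a\<in>A. emeasure M a \<noteq> \<infinity>)"
    by (intro exI[of _ "range (\<lambda>n::nat. ball 0 (real n))"]) (auto simp: sp)
qed

lemma sigma_finite_plane_measure:
  "i \<in> Basis \<Longrightarrow> sigma_finite_measure (plane_measure i)"
  by (rule sigma_finite_bounded_sets) (auto intro: plane_measure_bounded_finite)

lemma plane_measure_translate:
  fixes i p :: "'a::euclidean_space"
  assumes p: "p \<bullet> i = 0" and [measurable]: "F \<in> borel_measurable borel"
  shows "(\<integral>\<^sup>+y. F (p + y) \<partial>plane_measure i) = (\<integral>\<^sup>+y. F y \<partial>plane_measure i)"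
proof -
  let ?H = "hausdorff_measure (DIM('a) - 1) :: 'a measure"
  have "(\<integral>\<^sup>+y. F y \<partial>plane_measure i) = (\<integral>\<^sup>+y. indicator {x. x \<bullet> i = 0} y * F y \<partial>?H)"
    unfolding plane_measure_def by (subst nn_integral_density) simp_all
  also have "\<dots> = (\<integral>\<^sup>+y. indicator {x. x \<bullet> i = 0} y * F y \<partial>distr ?H borel ((+) p))"
    by (subst hausdorff_measure_distr_isometry) (auto simp: surj_plus)
  also have "\<dots> = (\<integral>\<^sup>+y. indicator {x. x \<bullet> i = 0} (p + y) * F (p + y) \<partial>?H)"
    by (subst nn_integral_distr) simp_all
  also have "\<dots> = (\<integral>\<^sup>+y. indicator {x. x \<bullet> i = 0} y * F (p + y) \<partial>?H)"
    by (intro nn_integral_cong) (auto simp: inner_add_left p split: split_indicator)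
  also have "\<dots> = (\<integral>\<^sup>+y. F (p + y) \<partial>plane_measure i)"
    unfolding plane_measure_def by (subst nn_integral_density) simp_all
  finally show ?thesis ..
qed

definition slice_measure :: "'a::euclidean_space \<Rightarrow> 'a measure" where
  "slice_measure i = distr (plane_measure i \<Otimes>\<^sub>M lborel) borel (\<lambda>(y, t). y + t *\<^sub>R i)"

lemma sets_slice_measure [simp, measurable_cong]: "sets (slice_measure i) = sets borel"
  by (simp add: slice_measure_def)

lemma nn_integral_slice_measure:
  fixes i :: "'a::euclidean_space"
  assumes i: "i \<in> Basis" and [measurable]: "F \<in> borel_measurable borel"
  shows "(\<integral>\<^sup>+x. F x \<partial>slice_measure i) = (\<integral>\<^sup>+t. (\<integral>\<^sup>+y. F (y + t *\<^sub>R i) \<partial>plane_measure i) \<partial>lborel)"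
proof -
  interpret P: sigma_finite_measure "plane_measure i" by (rule sigma_finite_plane_measure[OF i])
  interpret pair_sigma_finite "plane_measure i" lborel ..
  have "(\<integral>\<^sup>+x. F x \<partial>slice_measure i) = (\<integral>\<^sup>+z. F (fst z + snd z *\<^sub>R i) \<partial>(plane_measure i \<Otimes>\<^sub>M lborel))"
    unfolding slice_measure_def by (subst nn_integral_distr) (auto simp: case_prod_beta)
  also have "\<dots> = (\<integral>\<^sup>+t. (\<integral>\<^sup>+y. F (y + t *\<^sub>R i) \<partial>plane_measure i) \<partial>lborel)"
    by (subst nn_integral_snd[symmetric]) simp_all
  finally show ?thesis .
qed

lemma slice_measure_bounded_finite:
  fixes i :: "'a::euclidean_space"
  assumes i: "i \<in> Basis" and [measurable]: "A \<in> sets borel" and A: "bounded A"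
  shows "emeasure (slice_measure i) A < top"
proof -
  obtain B where B: "\<And>x. x \<in> A \<Longrightarrow> norm x \<le> B" using A by (auto simp: bounded_iff)
  have [measurable]: "cball (0::'a) (2 * \<bar>B\<bar>) \<in> sets borel" by simp
  have "emeasure (slice_measure i) A = (\<integral>\<^sup>+x. indicator A x \<partial>slice_measure i)" by simp
  also have "\<dots> = (\<integral>\<^sup>+t. (\<integral>\<^sup>+y. indicator A (y + t *\<^sub>R i) \<partial>plane_measure i) \<partial>lborel)"
    by (rule nn_integral_slice_measure[OF i]) simp
  also have "\<dots> \<le> (\<integral>\<^sup>+t. emeasure (plane_measure i) (cball 0 (2 * \<bar>B\<bar>)) * indicator {-\<bar>B\<bar>..\<bar>B\<bar>} t \<partial>lborel)"
  proof (rule nn_integral_mono)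
    fix t :: real
    have "(\<integral>\<^sup>+y. indicator A (y + t *\<^sub>R i) \<partial>plane_measure i)
        = (\<integral>\<^sup>+y. indicator {x. x \<bullet> i = 0} y * indicator A (y + t *\<^sub>R i) \<partial>hausdorff_measure (DIM('a) - 1))"
      unfolding plane_measure_def by (subst nn_integral_density) simp_all
    also have "\<dots> \<le> (\<integral>\<^sup>+y. indicator {x. x \<bullet> i = 0} y * (indicator (cball 0 (2 * \<bar>B\<bar>)) y * indicator {-\<bar>B\<bar>..\<bar>B\<bar>} t) \<partial>hausdorff_measure (DIM('a) - 1))"
    proof (rule nn_integral_mono)
      fix y :: 'a
      have "y \<in> cball 0 (2 * \<bar>B\<bar>) \<and> t \<in> {-\<bar>B\<bar>..\<bar>B\<bar>}" if y: "y \<bullet> i = 0" "y + t *\<^sub>R i \<in> A"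
      proof -
        have n: "norm (y + t *\<^sub>R i) \<le> B" using B y by simp
        have "\<bar>(y + t *\<^sub>R i) \<bullet> i\<bar> \<le> B" using Basis_le_norm[OF i, of "y + t *\<^sub>R i"] n by linarith
        then have t: "\<bar>t\<bar> \<le> B" using y i by (simp add: inner_add_left)
        have "norm y \<le> norm (y + t *\<^sub>R i) + norm (t *\<^sub>R i)" using norm_triangle_ineq4[of "y + t *\<^sub>R i" "t *\<^sub>R i"] by simp
        also have "\<dots> \<le> 2 * \<bar>B\<bar>" using n t i by simp
        finally show ?thesis using t by auto
      qed
      then show "indicator {x. x \<bullet> i = 0} y * indicator A (y + t *\<^sub>R i)
          \<le> (indicator {x. x \<bullet> i = 0} y * (indicator (cball 0 (2 * \<bar>B\<bar>)) y * indicator {-\<bar>B\<bar>..\<bar>B\<bar>} t) :: ennreal)"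
        by (auto split: split_indicator)
    qed
    also have "\<dots> = (\<integral>\<^sup>+y. indicator (cball 0 (2 * \<bar>B\<bar>)) y * indicator {-\<bar>B\<bar>..\<bar>B\<bar>} t \<partial>plane_measure i)"
      unfolding plane_measure_def by (subst nn_integral_density) simp_all
    also have "\<dots> = emeasure (plane_measure i) (cball 0 (2 * \<bar>B\<bar>)) * indicator {-\<bar>B\<bar>..\<bar>B\<bar>} t"
      by (subst nn_integral_multc) simp_all
    finally show "(\<integral>\<^sup>+y. indicator A (y + t *\<^sub>R i) \<partial>plane_measure i)
      \<le> emeasure (plane_measure i) (cball 0 (2 * \<bar>B\<bar>)) * indicator {-\<bar>B\<bar>..\<bar>B\<bar>} t" .
  qed
  also have "\<dots> = emeasure (plane_measure i) (cball 0 (2 * \<bar>B\<bar>)) * ennreal (2 * \<bar>B\<bar>)"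
    by (subst nn_integral_cmult) simp_all
  also have "\<dots> < top"
    using plane_measure_bounded_finite[OF i, of "cball 0 (2 * \<bar>B\<bar>)"] by (simp add: ennreal_mult_less_top)
  finally show ?thesis .
qed

text \<open>A translation is split into a part inside the hyperplane, which preserves the area,
  and a part along \<open>i\<close>, which preserves the length of the normal
  coordinate.\<close>

lemma slice_measure_translate:
  fixes i z :: "'a::euclidean_space"
  assumes i: "i \<in> Basis"
  shows "distr (slice_measure i) borel ((+) z) = slice_measure i"
proof (rule measure_eqI)
  interpret P: sigma_finite_measure "plane_measure i" by (rule sigma_finite_plane_measure[OF i])
  fix A assume "A \<in> sets (distr (slice_measure i) borel ((+) z))"
  then have [measurable]: "A \<in> sets borel" by simp
  define p where "p = z - (z \<bullet> i) *\<^sub>R i"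
  have p: "p \<bullet> i = 0" using i by (simp add: p_def inner_diff_left)
  let ?F = "indicator A :: 'a \<Rightarrow> ennreal"
  have "emeasure (distr (slice_measure i) borel ((+) z)) A = (\<integral>\<^sup>+x. ?F x \<partial>distr (slice_measure i) borel ((+) z))"
    by simp
  also have "\<dots> = (\<integral>\<^sup>+x. ?F (z + x) \<partial>slice_measure i)"
    by (subst nn_integral_distr) simp_all
  also have "\<dots> = (\<integral>\<^sup>+t. (\<integral>\<^sup>+y. ?F (z + (y + t *\<^sub>R i)) \<partial>plane_measure i) \<partial>lborel)"
    by (rule nn_integral_slice_measure[OF i]) simp
  also have "\<dots> = (\<integral>\<^sup>+t. (\<integral>\<^sup>+y. ?F ((p + y) + (z \<bullet> i + t) *\<^sub>R i) \<partial>plane_measure i) \<partial>lborel)"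
    by (simp add: p_def algebra_simps)
  also have "\<dots> = (\<integral>\<^sup>+t. (\<integral>\<^sup>+y. ?F (y + (z \<bullet> i + t) *\<^sub>R i) \<partial>plane_measure i) \<partial>lborel)"
    by (intro nn_integral_cong plane_measure_translate[OF p]) simp
  also have "\<dots> = (\<integral>\<^sup>+t. (\<integral>\<^sup>+y. ?F (y + t *\<^sub>R i) \<partial>plane_measure i) \<partial>lborel)"
    by (rule nn_integral_lborel_translate[where F="\<lambda>t. \<integral>\<^sup>+y. ?F (y + t *\<^sub>R i) \<partial>plane_measure i"]) measurable
  also have "\<dots> = emeasure (slice_measure i) A"
    by (subst nn_integral_slice_measure[OF i, symmetric]) simp_all
  finally show "emeasure (distr (slice_measure i) borel ((+) z)) A = emeasure (slice_measure i) A" .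
qed simp

lemma unit_face_closed: "closed (unit_face i)"
proof -
  have "unit_face i = {x. x \<bullet> i = 0} \<inter> (\<Inter>j\<in>Basis - {i}. {x. 0 \<le> x \<bullet> j} \<inter> {x. x \<bullet> j \<le> 1})"
    by (auto simp: unit_face_def)
  moreover have "closed \<dots>"
    by (intro closed_Int closed_INT ballI closed_Collect_eq closed_Collect_le continuous_intros)
  ultimately show ?thesis by simp
qed

lemma slice_measure_unit_cube:
  fixes i :: "'a::euclidean_space"
  assumes i: "i \<in> Basis"
  shows "emeasure (slice_measure i) (cbox 0 One) = hausdorff_outer (DIM('a) - 1) (unit_face i)"
proof -
  have [measurable]: "unit_face i \<in> sets borel" using unit_face_closed borel_closed by blast
  have "emeasure (slice_measure i) (cbox 0 One) = (\<integral>\<^sup>+x. indicator (cbox 0 One) x \<partial>slice_measure i)" by simp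
  also have "\<dots> = (\<integral>\<^sup>+t. (\<integral>\<^sup>+y. indicator (cbox 0 One) (y + t *\<^sub>R i) \<partial>plane_measure i) \<partial>lborel)"
    by (rule nn_integral_slice_measure[OF i]) simp
  also have "\<dots> = (\<integral>\<^sup>+t. emeasure (plane_measure i) (unit_face i) * indicator {0..1::real} t \<partial>lborel)"
  proof (rule nn_integral_cong)
    fix t :: real
    have "(\<integral>\<^sup>+y. indicator (cbox 0 One) (y + t *\<^sub>R i) \<partial>plane_measure i)
        = (\<integral>\<^sup>+y. indicator {x. x \<bullet> i = 0} y * indicator (cbox 0 One) (y + t *\<^sub>R i) \<partial>hausdorff_measure (DIM('a) - 1))"
      unfolding plane_measure_def by (subst nn_integral_density) simp_all
    also have "\<dots> = (\<integral>\<^sup>+y. indicator {x. x \<bullet> i = 0} y * (indicator (unit_face i) y * indicator {0..1} t) \<partial>hausdorff_measure (DIM('a) - 1))"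
    proof (rule nn_integral_cong)
      fix y :: 'a
      have "y + t *\<^sub>R i \<in> cbox 0 One \<longleftrightarrow> y \<in> unit_face i \<and> t \<in> {0..1}" if y: "y \<bullet> i = 0"
      proof -
        have "(y + t *\<^sub>R i) \<bullet> j = (if j = i then t else y \<bullet> j)" if "j \<in> Basis" for j
          using that i y by (auto simp: inner_add_left inner_Basis)
        then show ?thesis using i y by (force simp: mem_box unit_face_def)
      qed
      then show "indicator {x. x \<bullet> i = 0} y * indicator (cbox 0 One) (y + t *\<^sub>R i)
          = (indicator {x. x \<bullet> i = 0} y * (indicator (unit_face i) y * indicator {0..1} t) :: ennreal)"
        by (auto split: split_indicator)
    qed
    also have "\<dots> = (\<integral>\<^sup>+y. indicator (unit_face i) y * indicator {0..1} t \<partial>plane_measure i)"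
      unfolding plane_measure_def by (subst nn_integral_density) simp_all
    also have "\<dots> = emeasure (plane_measure i) (unit_face i) * indicator {0..1} t"
      by (subst nn_integral_multc) simp_all
    finally show "(\<integral>\<^sup>+y. indicator (cbox 0 One) (y + t *\<^sub>R i) \<partial>plane_measure i)
      = emeasure (plane_measure i) (unit_face i) * indicator {0..1} t" .
  qed
  also have "\<dots> = emeasure (plane_measure i) (unit_face i)"
    by (subst nn_integral_cmult) simp_all
  also have "\<dots> = hausdorff_outer (DIM('a) - 1) ({x. x \<bullet> i = 0} \<inter> unit_face i)"
    by (rule emeasure_plane_measure) simp
  also have "{x. x \<bullet> i = 0} \<inter> unit_face i = unit_face i" by (auto simp: unit_face_def)
  finally show ?thesis .
qed

text \<open>Exchanging the coordinates \<open>i\<close> and \<open>j\<close> is an isometry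
  between the two faces. This makes the constant below independent of the direction.\<close>

lemma unit_face_swap:
  fixes i j :: "'a::euclidean_space"
  assumes i: "i \<in> Basis" and j: "j \<in> Basis"
  shows "hausdorff_outer s (unit_face i) = hausdorff_outer s (unit_face j)"
proof -
  define f where "f x = x - (x \<bullet> i - x \<bullet> j) *\<^sub>R (i - j)" for x :: 'a
  have fk: "f x \<bullet> k = (if k = i then x \<bullet> j else if k = j then x \<bullet> i else x \<bullet> k)" if "k \<in> Basis" for x k
    using that i j by (auto simp: f_def inner_diff_left inner_Basis)
  have ff: "f (f x) = x" for x by (rule euclidean_eqI) (auto simp: fk i j)
  have nf: "norm (f x) = norm x" for x
  proof -
    have "(f x) \<bullet> (f x) = x \<bullet> x"
    proof (cases "i = j")
      case False
      then have "i \<bullet> j = 0" "j \<bullet> i = 0" "i \<bullet> i = 1" "j \<bullet> j = 1" using i j by (auto simp: inner_Basis)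
      then show ?thesis by (simp add: f_def inner_diff_left inner_diff_right inner_commute algebra_simps)
    qed (simp add: f_def)
    then show ?thesis by (simp add: norm_eq)
  qed
  have "f x - f y = f (x - y)" for x y by (simp add: f_def inner_diff_left algebra_simps)
  then have iso: "dist (f x) (f y) = dist x y" for x y by (simp add: dist_norm nf)
  have sub: "f ` unit_face i \<subseteq> unit_face j" "f ` unit_face j \<subseteq> unit_face i"
    using i j by (auto simp: unit_face_def fk)
  have "f ` unit_face i = unit_face j"
  proof
    show "unit_face j \<subseteq> f ` unit_face i" using sub(2) ff by (metis image_eqI image_subset_iff subsetI)
  qed (rule sub)
  then show ?thesis using outer_similarity_image[of 1 f s "unit_face i"] iso by simp
qed

text \<open>Slicing by hyperplanes computes Lebesgue measure up to a factor \<open>c\<close>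
  that is common to all coordinate directions. The factor cancels in the Neumann problem, where
  the surface measure occurs only relative to the perimeter.\<close>

theorem hausdorff_slicing:
  obtains c :: real where "0 < c"
    "\<And>i::'a::euclidean_space. i \<in> Basis \<Longrightarrow> distr (plane_measure i \<Otimes>\<^sub>M lborel) borel (\<lambda>(y, t). y + t *\<^sub>R i) = density lborel (\<lambda>_. ennreal c)"
proof -
  obtain b :: 'a where b: "b \<in> Basis" using nonempty_Basis by blast
  let ?c = "hausdorff_outer (DIM('a) - 1) (unit_face b)"
  have "0 < ?c" by (rule unit_face_pos[OF b])
  moreover have "?c < top"
    using slice_measure_bounded_finite[OF b, of "cbox 0 One"] by (simp add: slice_measure_unit_cube[OF b])
  ultimately obtain c where c: "?c = ennreal c" "0 < c"
    by (cases ?c) (auto simp: ennreal_less_zero_iff)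
  have "distr (plane_measure i \<Otimes>\<^sub>M lborel) borel (\<lambda>(y, t). y + t *\<^sub>R i) = density lborel (\<lambda>_. ennreal c)"
    if i: "i \<in> Basis" for i :: 'a
  proof -
    have "slice_measure i = density lborel (\<lambda>_. emeasure (slice_measure i) (cbox 0 One))"
      by (rule translation_invariant_eq_lborel)
        (auto intro!: sigma_finite_bounded_sets slice_measure_bounded_finite slice_measure_translate i)
    also have "emeasure (slice_measure i) (cbox 0 One) = ennreal c"
      using slice_measure_unit_cube[OF i] unit_face_swap[OF i b] c by simp
    finally show ?thesis by (simp add: slice_measure_def)
  qed
  then show thesis using that c by blast
qed

section \<open>Boundary values of one-dimensional weak derivatives\<close>

text \<open>A function of class \<open>C\<^sup>1\<close> with Lipschitz derivative from which
  steps and bumps with compact support are built.\<close>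

definition sq_pos :: "real \<Rightarrow> real" where "sq_pos t = (max 0 t)\<^sup>2"

text \<open>The quadratic Taylor remainder, uniformly in both points. It yields the derivative,
  and it is also what makes averages against moving bumps vary only to second order.\<close>

lemma sq_pos_remainder: "\<bar>sq_pos y - sq_pos x - 2 * max 0 x * (y - x)\<bar> \<le> (y - x)\<^sup>2"
proof -
  consider "0 \<le> x" "0 \<le> y" | "0 \<le> x" "y < 0" | "x < 0" "0 \<le> y" | "x < 0" "y < 0" by linarith
  then show ?thesis
  proof cases
    case 1
    then have "sq_pos y - sq_pos x - 2 * max 0 x * (y - x) = (y - x)\<^sup>2"
      by (simp add: sq_pos_def power2_eq_square algebra_simps)
    then show ?thesis by simp
  next
    case 2
    then have eq: "sq_pos y - sq_pos x - 2 * max 0 x * (y - x) = x\<^sup>2 - 2 * (x * y)"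
      by (simp add: sq_pos_def power2_eq_square algebra_simps)
    have "x * y \<le> 0" using 2 by (simp add: mult_nonneg_nonpos)
    moreover have "0 \<le> x\<^sup>2" by simp
    ultimately have "\<bar>x\<^sup>2 - 2 * (x * y)\<bar> = x\<^sup>2 - 2 * (x * y)" by linarith
    then show ?thesis unfolding eq by (simp add: power2_diff algebra_simps)
  next
    case 3
    have "y\<^sup>2 \<le> (y - x)\<^sup>2" using 3 by (intro power_mono) auto
    then show ?thesis using 3 by (simp add: sq_pos_def)
  qed (simp add: sq_pos_def)
qed

lemma DERIV_quadratic_remainder:
  fixes f :: "real \<Rightarrow> real"
  assumes "\<And>y. \<bar>f y - f x - D * (y - x)\<bar> \<le> (y - x)\<^sup>2"
  shows "DERIV f x :> D"
  unfolding has_field_derivative_iff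
proof (rule LIM_I)
  fix r :: real assume r: "0 < r"
  have "norm ((f y - f x) / (y - x) - D) < r" if y: "y \<noteq> x" "norm (y - x) < r" for y
  proof -
    have "(f y - f x) / (y - x) - D = (f y - f x - D * (y - x)) / (y - x)"
      using y by (simp add: field_simps)
    then have "norm ((f y - f x) / (y - x) - D) \<le> (y - x)\<^sup>2 / \<bar>y - x\<bar>"
      using assms[of y] by (simp add: abs_divide divide_right_mono)
    also have "(y - x)\<^sup>2 = \<bar>y - x\<bar> * \<bar>y - x\<bar>" by (simp add: power2_eq_square)
    also have "\<bar>y - x\<bar> * \<bar>y - x\<bar> / \<bar>y - x\<bar> = \<bar>y - x\<bar>" using y by (simp del: abs_mult_self_eq)
    finally show ?thesis using y by simp
  qed
  then show "\<exists>s>0. \<forall>y. y \<noteq> x \<and> norm (y - x) < s \<longrightarrow> norm ((f y - f x) / (y - x) - D) < r"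
    using r by blast
qed

lemma DERIV_sq_pos: "DERIV sq_pos x :> 2 * max 0 x"
  by (rule DERIV_quadratic_remainder) (rule sq_pos_remainder)

text \<open>A quadratic spline rising from \<open>0\<close> at \<open>0\<close> to
  \<open>1\<close> at \<open>1\<close>, whose derivative is a tent.\<close>

definition smooth_step :: "real \<Rightarrow> real" where
  "smooth_step t = 2 * (sq_pos t - 2 * sq_pos (t - 1/2) + sq_pos (t - 1))"

definition smooth_step' :: "real \<Rightarrow> real" where
  "smooth_step' t = 4 * (max 0 t - 2 * max 0 (t - 1/2) + max 0 (t - 1))"

lemma DERIV_smooth_step: "DERIV smooth_step t :> smooth_step' t"
  unfolding smooth_step_def smooth_step'_def
  by (auto intro!: derivative_eq_intros DERIV_chain2[OF DERIV_sq_pos])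

lemma continuous_smooth_step': "continuous_on A smooth_step'"
  unfolding smooth_step'_def by (intro continuous_intros)

lemma smooth_step'_nonneg: "0 \<le> smooth_step' t"
  unfolding smooth_step'_def by (simp add: max_def)

lemma smooth_step'_outside: "t \<le> 0 \<or> 1 \<le> t \<Longrightarrow> smooth_step' t = 0"
  unfolding smooth_step'_def by (auto simp: max_def)

lemma smooth_step_left: "t \<le> 0 \<Longrightarrow> smooth_step t = 0"
  unfolding smooth_step_def sq_pos_def by simp

lemma smooth_step_right: "1 \<le> t \<Longrightarrow> smooth_step t = 1"
  unfolding smooth_step_def sq_pos_def by (simp add: power2_eq_square algebra_simps)

lemma smooth_step_mono: "s \<le> t \<Longrightarrow> smooth_step s \<le> smooth_step t"
  using DERIV_nonneg_imp_nondecreasing[of s t smooth_step] DERIV_smooth_step smooth_step'_nonneg by blast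

lemma smooth_step_range: "0 \<le> smooth_step t" "smooth_step t \<le> 1"
  using smooth_step_mono[of "min t 0" t] smooth_step_mono[of t "max t 1"]
  by (auto simp: smooth_step_left smooth_step_right min_def max_def split: if_splits)

lemma mollifier_limit:
  fixes K :: "real \<Rightarrow> real"
  assumes K: "continuous_on {a..b} K" and c: "c \<in> {a..b}"
    and \<rho>: "\<And>n. continuous_on {a..b} (\<rho> n)" "\<And>n t. 0 \<le> \<rho> n t"
    and mass: "\<forall>\<^sub>F n in sequentially. (LINT t:{a..b}|lborel. \<rho> n t) = 1"
    and supp: "\<And>n t. \<rho> n t \<noteq> 0 \<Longrightarrow> \<bar>t - c\<bar> \<le> r n" and r: "r \<longlonglongrightarrow> 0"
  shows "(\<lambda>n. LINT t:{a..b}|lborel. K t * \<rho> n t) \<longlonglongrightarrow> K c"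
proof (rule LIMSEQ_I)
  fix e :: real assume e: "0 < e"
  then obtain d where d: "0 < d" "\<And>t. t \<in> {a..b} \<Longrightarrow> \<bar>t - c\<bar> < d \<Longrightarrow> \<bar>K t - K c\<bar> < e / 2"
    using K[unfolded continuous_on_iff, rule_format, OF c, of "e / 2"] by (auto simp: dist_real_def)
  have "\<forall>\<^sub>F n in sequentially. r n < d" using r d(1) by (rule order_tendstoD)
  then have "\<forall>\<^sub>F n in sequentially. norm ((LINT t:{a..b}|lborel. K t * \<rho> n t) - K c) < e"
    using mass
  proof eventually_elim
    case (elim n)
    have i1: "set_integrable lborel {a..b} (\<lambda>t. K t * \<rho> n t)" "set_integrable lborel {a..b} (\<lambda>t. K c * \<rho> n t)"
      "set_integrable lborel {a..b} (\<lambda>t. e / 2 * \<rho> n t)"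
      by (intro borel_integrable_atLeastAtMost' continuous_intros K \<rho>)+
    have "(LINT t:{a..b}|lborel. K t * \<rho> n t) - K c = (LINT t:{a..b}|lborel. K t * \<rho> n t) - (LINT t:{a..b}|lborel. K c * \<rho> n t)"
      using elim by simp
    also have "\<dots> = (LINT t:{a..b}|lborel. K t * \<rho> n t - K c * \<rho> n t)"
      using i1 by (simp add: set_integral_diff)
    finally have "norm ((LINT t:{a..b}|lborel. K t * \<rho> n t) - K c) \<le> (LINT t:{a..b}|lborel. norm (K t * \<rho> n t - K c * \<rho> n t))"
      using set_integral_norm_bound[OF set_integral_diff(1)[OF i1(1,2)]] by simp
    also have "\<dots> \<le> (LINT t:{a..b}|lborel. e / 2 * \<rho> n t)"
    proof (rule set_integral_mono)
      show "set_integrable lborel {a..b} (\<lambda>t. norm (K t * \<rho> n t - K c * \<rho> n t))"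
        by (intro borel_integrable_atLeastAtMost' continuous_intros K \<rho>)
      fix t assume t: "t \<in> {a..b}"
      show "norm (K t * \<rho> n t - K c * \<rho> n t) \<le> e / 2 * \<rho> n t"
      proof (cases "\<rho> n t = 0")
        case False
        then have "\<bar>K t - K c\<bar> < e / 2" using d(2)[OF t] supp[OF False] elim by linarith
        then show ?thesis using \<rho>(2)[of n t] mult_right_mono[of "\<bar>K t - K c\<bar>" "e / 2" "\<rho> n t"]
          by (simp add: left_diff_distrib[symmetric] abs_mult)
      qed simp
    qed (rule i1)
    also have "\<dots> = e / 2" using elim by simp
    finally show ?case using e by simp
  qed
  then show "\<exists>N. \<forall>n\<ge>N. norm ((LINT t:{a..b}|lborel. K t * \<rho> n t) - K c) < e"
    unfolding eventually_sequentially .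
qed

text \<open>Test functions on the open interval: class \<open>C\<^sup>1\<close> with support in
  a compact subinterval.\<close>

definition interval_test :: "real \<Rightarrow> real \<Rightarrow> (real \<Rightarrow> real) \<Rightarrow> (real \<Rightarrow> real) \<Rightarrow> bool" where
  "interval_test a b \<theta> \<theta>' \<longleftrightarrow> (\<forall>t. DERIV \<theta> t :> \<theta>' t) \<and> continuous_on UNIV \<theta>' \<and>
     (\<exists>\<alpha> \<beta>. a < \<alpha> \<and> \<beta> < b \<and> (\<forall>t. t \<notin> {\<alpha>..\<beta>} \<longrightarrow> \<theta> t = 0))"

lemma interval_test_continuous: "interval_test a b \<theta> \<theta>' \<Longrightarrow> continuous_on A \<theta>"
  unfolding interval_test_def by (meson DERIV_continuous_on has_field_derivative_at_within)

lemma interval_test_mult: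
  assumes "interval_test a b \<theta> \<theta>'" "\<And>t. DERIV G t :> G' t" "continuous_on UNIV G'"
  shows "interval_test a b (\<lambda>t. \<theta> t * G t) (\<lambda>t. \<theta>' t * G t + \<theta> t * G' t)"
proof -
  have cG: "continuous_on UNIV G" using assms(2) by (meson DERIV_continuous_on has_field_derivative_at_within)
  have "DERIV (\<lambda>t. \<theta> t * G t) t :> \<theta>' t * G t + \<theta> t * G' t" for t
    using assms(1,2) unfolding interval_test_def by (auto intro!: derivative_eq_intros)
  moreover have "continuous_on UNIV (\<lambda>t. \<theta>' t * G t + \<theta> t * G' t)"
    using assms cG interval_test_continuous[OF assms(1)] unfolding interval_test_def
    by (intro continuous_intros) auto
  ultimately show ?thesis using assms(1) unfolding interval_test_def by (metis mult_zero_left)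
qed

text \<open>Test functions converging to the indicator of the interval. Their derivatives are a
  unit mass concentrating at \<open>a\<close> minus a unit mass concentrating at
  \<open>b\<close>.\<close>

lemma interval_cutoffs:
  fixes a b :: real
  assumes ab: "a < b"
  obtains \<eta> \<eta>' :: "nat \<Rightarrow> real \<Rightarrow> real" where
    "\<And>n. interval_test a b (\<eta> n) (\<eta>' n)" "\<And>n t. 0 \<le> \<eta> n t \<and> \<eta> n t \<le> 1"
    "\<And>t. a < t \<Longrightarrow> t < b \<Longrightarrow> (\<lambda>n. \<eta> n t) \<longlonglongrightarrow> 1"
    "\<And>K. continuous_on {a..b} K \<Longrightarrow> (\<lambda>n. LINT t:{a..b}|lborel. K t * \<eta>' n t) \<longlonglongrightarrow> K a - K b"
proof -
  \<comment> \<open>The slope of the cutoffs. The summand \<open>4 / (b - a)\<close> keeps the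
    rising part, inside \<open>[a, a + 2 / m]\<close>, to the left of the falling part, inside
    \<open>[b - 2 / m, b]\<close>.\<close>
  define m where "m n = real n + 4 / (b - a)" for n
  have m_pos: "0 < m n" for n using ab by (simp add: m_def add_nonneg_pos)
  define q where "q n = inverse (m n)" for n
  have q_pos: "0 < q n" for n using m_pos by (simp add: q_def)
  have m_ge: "4 \<le> m n * (b - a)" for n
  proof -
    have "4 / (b - a) * (b - a) \<le> m n * (b - a)" using ab by (intro mult_right_mono) (auto simp: m_def)
    moreover have "4 / (b - a) * (b - a) = 4" using ab by (subst nonzero_eq_divide_eq[symmetric]) simp_all
    ultimately show ?thesis by linarith
  qed
  have q_le: "4 * q n \<le> b - a" for n using m_ge[of n] m_pos[of n] by (simp add: q_def field_simps)
  have lim: "(\<lambda>n. 2 * q n) \<longlonglongrightarrow> 0"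
    unfolding q_def
  proof (intro tendsto_mult_right_zero tendsto_inverse_0_at_top)
    have "filterlim (\<lambda>n. 4 / (b - a) + real n) at_top sequentially"
      by (rule filterlim_tendsto_add_at_top[OF tendsto_const filterlim_real_sequentially])
    then show "filterlim m at_top sequentially"
      unfolding m_def by (simp add: add.commute)
  qed
  define l where "l n t = smooth_step (m n * (t - a) - 1)" for n t
  define u where "u n t = smooth_step (m n * (t - b) + 2)" for n t
  define l' where "l' n t = m n * smooth_step' (m n * (t - a) - 1)" for n t
  define u' where "u' n t = m n * smooth_step' (m n * (t - b) + 2)" for n t
  have Dl: "DERIV (l n) t :> l' n t" for n t
    unfolding l_def l'_def by (rule DERIV_chain2[OF DERIV_smooth_step, THEN DERIV_cong]) (auto intro!: derivative_eq_intros)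
  have Du: "DERIV (u n) t :> u' n t" for n t
    unfolding u_def u'_def by (rule DERIV_chain2[OF DERIV_smooth_step, THEN DERIV_cong]) (auto intro!: derivative_eq_intros)
  have cl: "continuous_on A (l' n)" and cu: "continuous_on A (u' n)" for A n
    unfolding l'_def u'_def
    by (intro continuous_intros continuous_on_compose2[OF continuous_smooth_step'[of UNIV]]; simp)+
  have ge: "x \<le> m n * y \<longleftrightarrow> x * q n \<le> y" for x y n using m_pos[of n] by (simp add: q_def field_simps)
  have le: "m n * y \<le> x \<longleftrightarrow> y \<le> x * q n" for x y n using m_pos[of n] by (simp add: q_def field_simps)
  have gt: "x < m n * y \<longleftrightarrow> x * q n < y" for x y n using m_pos[of n] by (simp add: q_def field_simps)
  have lt: "m n * y < x \<longleftrightarrow> y < x * q n" for x y n using m_pos[of n] by (simp add: q_def field_simps)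
  have l0: "l n t = 0" if "t \<le> a + q n" for n t
    unfolding l_def by (rule smooth_step_left) (use le[of n "t - a" 1] that in auto)
  have l1: "l n t = 1" if "a + 2 * q n \<le> t" for n t
    unfolding l_def by (rule smooth_step_right) (use ge[of 2 n "t - a"] that in auto)
  have u0: "u n t = 0" if "t \<le> b - 2 * q n" for n t
    unfolding u_def by (rule smooth_step_left) (use le[of n "t - b" "-2"] that in auto)
  have u1: "u n t = 1" if "b - q n \<le> t" for n t
    unfolding u_def by (rule smooth_step_right) (use ge[of "-1" n "t - b"] that in auto)
  define \<eta> where "\<eta> n t = l n t - u n t" for n t
  define \<eta>' where "\<eta>' n t = l' n t - u' n t" for n t
  have 1: "interval_test a b (\<eta> n) (\<eta>' n)" for n
    unfolding interval_test_def
  proof (intro conjI allI exI)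
    show "DERIV (\<eta> n) t :> \<eta>' n t" for t
      unfolding \<eta>_def \<eta>'_def by (intro derivative_intros Dl Du)
    show "continuous_on UNIV (\<eta>' n)" unfolding \<eta>'_def by (intro continuous_intros cl cu)
    show "a < a + q n" "b - q n < b" using q_pos[of n] by auto
    show "t \<notin> {a + q n..b - q n} \<longrightarrow> \<eta> n t = 0" for t
    proof
      assume "t \<notin> {a + q n..b - q n}"
      then consider "t < a + q n" | "b - q n < t" by fastforce
      then show "\<eta> n t = 0"
      proof cases
        case 1
        then have "t \<le> a + q n" "t \<le> b - 2 * q n" using q_le[of n] q_pos[of n] by linarith+
          then show ?thesis by (simp add: \<eta>_def l0 u0)
      next
        case 2
        then have "a + 2 * q n \<le> t" "b - q n \<le> t" using q_le[of n] q_pos[of n] by linarith+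
          then show ?thesis by (simp add: \<eta>_def l1 u1)
      qed
    qed
  qed
  have 2: "0 \<le> \<eta> n t \<and> \<eta> n t \<le> 1" for n t
  proof (cases "a + 2 * q n \<le> t")
    case True
    then show ?thesis using l1 smooth_step_range[of "m n * (t - b) + 2"] unfolding \<eta>_def u_def by simp
  next
    case False
    then have "t \<le> b - 2 * q n" using q_le[of n] q_pos[of n] by linarith
    then have "u n t = 0" by (rule u0)
    then show ?thesis using smooth_step_range[of "m n * (t - a) - 1"] unfolding \<eta>_def l_def by simp
  qed
  have 3: "(\<lambda>n. \<eta> n t) \<longlonglongrightarrow> 1" if t: "a < t" "t < b" for t
  proof (rule tendsto_eventually)
    have "\<forall>\<^sub>F n in sequentially. 2 * q n < t - a" "\<forall>\<^sub>F n in sequentially. 2 * q n < b - t"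
      using order_tendstoD(2)[OF lim] t by auto
    then show "\<forall>\<^sub>F n in sequentially. \<eta> n t = 1"
      by eventually_elim (simp add: \<eta>_def l1 u0)
  qed
  have 4: "(\<lambda>n. LINT t:{a..b}|lborel. K t * \<eta>' n t) \<longlonglongrightarrow> K a - K b" if K: "continuous_on {a..b} K" for K
  proof -
    have FTC: "(LINT t:{a..b}|lborel. f' t) = f b - f a"
      if "\<And>t. DERIV f t :> f' t" "continuous_on UNIV f'" for f f' :: "real \<Rightarrow> real"
    proof -
      have "(\<integral>t. indicator {a..b} t *\<^sub>R f' t \<partial>lborel) = f b - f a"
        using ab that by (intro integral_FTC_Icc)
          (auto intro: has_field_derivative_at_within continuous_on_subset simp: has_real_derivative_iff_has_vector_derivative[symmetric])
      then show ?thesis by (simp add: set_lebesgue_integral_def)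
    qed
    have A: "(\<lambda>n. LINT t:{a..b}|lborel. K t * l' n t) \<longlonglongrightarrow> K a"
    proof (rule mollifier_limit[OF K, where r="\<lambda>n. 2 * q n"])
      show "\<forall>\<^sub>F n in sequentially. (LINT t:{a..b}|lborel. l' n t) = 1"
      proof (rule always_eventually, rule allI)
        fix n
        have "l n b - l n a = 1" using l1[of n b] l0[of a n] q_le[of n] q_pos[of n] by simp
        then show "(LINT t:{a..b}|lborel. l' n t) = 1" using FTC[OF Dl[of n] cl[of UNIV n]] by metis
      qed
      show "\<bar>t - a\<bar> \<le> 2 * q n" if "l' n t \<noteq> 0" for n t
      proof -
        have "0 < m n * (t - a) - 1" "m n * (t - a) - 1 < 1"
          using that smooth_step'_outside[of "m n * (t - a) - 1"] unfolding l'_def by force+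
        then have "1 < m n * (t - a)" "m n * (t - a) < 2" by linarith+
        then show ?thesis using q_pos[of n] unfolding gt lt by linarith
      qed
      show "0 \<le> l' n t" for n t unfolding l'_def using m_pos[of n] smooth_step'_nonneg by simp
    qed (use ab cl lim in auto)
    have B: "(\<lambda>n. LINT t:{a..b}|lborel. K t * u' n t) \<longlonglongrightarrow> K b"
    proof (rule mollifier_limit[OF K, where r="\<lambda>n. 2 * q n"])
      show "\<forall>\<^sub>F n in sequentially. (LINT t:{a..b}|lborel. u' n t) = 1"
      proof (rule always_eventually, rule allI)
        fix n
        have "u n b - u n a = 1" using u1[of n b] u0[of a n] q_le[of n] q_pos[of n] by simp
        then show "(LINT t:{a..b}|lborel. u' n t) = 1" using FTC[OF Du[of n] cu[of UNIV n]] by metis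
      qed
      show "\<bar>t - b\<bar> \<le> 2 * q n" if "u' n t \<noteq> 0" for n t
      proof -
        have "0 < m n * (t - b) + 2" "m n * (t - b) + 2 < 1"
          using that smooth_step'_outside[of "m n * (t - b) + 2"] unfolding u'_def by force+
        then have "-2 < m n * (t - b)" "m n * (t - b) < -1" by linarith+
        then show ?thesis using q_pos[of n] unfolding gt lt by linarith
      qed
      show "0 \<le> u' n t" for n t unfolding u'_def using m_pos[of n] smooth_step'_nonneg by simp
    qed (use ab cu lim in auto)
    have "(LINT t:{a..b}|lborel. K t * \<eta>' n t) = (LINT t:{a..b}|lborel. K t * l' n t) - (LINT t:{a..b}|lborel. K t * u' n t)" for n
      unfolding \<eta>'_def right_diff_distrib
      by (intro set_integral_diff borel_integrable_atLeastAtMost' continuous_intros K cl cu)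
    then show ?thesis using tendsto_diff[OF A B] by simp
  qed
  show thesis by (rule that[of \<eta> \<eta>']) (use 1 2 3 4 in auto)
qed

text \<open>\<open>E\<close> pushed forward along \<open>p\<close> is the weak derivative of
  \<open>F\<close>. Testing with \<open>\<eta>\<^sub>n G\<close>, where
  \<open>\<eta>\<^sub>n\<close> are the cutoffs, and letting \<open>n\<close> tend to infinity
  turns the compactly supported identity into integration by parts with boundary terms: the
  derivative of \<open>\<eta>\<^sub>n\<close> picks out the values of the continuous function
  \<open>F G\<close> at the endpoints. In the applications \<open>p\<close> is a coordinate or
  the distance from the origin and \<open>F t\<close> is an integral over the slice \<open>p =
  t\<close>.\<close>

theorem boundary_values_from_test_functions:
  fixes F G G' :: "real \<Rightarrow> real" and E :: "'b \<Rightarrow> real"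
  assumes ab: "a < b" and F: "continuous_on {a..b} F"
    and p [measurable]: "p \<in> borel_measurable M" and p_in: "\<And>x. x \<in> space M \<Longrightarrow> a < p x \<and> p x < b"
    and E: "integrable M E"
    and weak: "\<And>\<theta> \<theta>'. interval_test a b \<theta> \<theta>' \<Longrightarrow>
      (LINT t:{a..b}|lborel. F t * \<theta>' t) = - (\<integral>x. \<theta> (p x) * E x \<partial>M)"
    and G: "\<And>t. DERIV G t :> G' t" "continuous_on UNIV G'"
  shows "F b * G b - F a * G a = (LINT t:{a..b}|lborel. F t * G' t) + (\<integral>x. G (p x) * E x \<partial>M)"
proof -
  obtain \<eta> \<eta>' :: "nat \<Rightarrow> real \<Rightarrow> real" where \<eta>: "\<And>n. interval_test a b (\<eta> n) (\<eta>' n)" "\<And>n t. 0 \<le> \<eta> n t \<and> \<eta> n t \<le> 1"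
    "\<And>t. a < t \<Longrightarrow> t < b \<Longrightarrow> (\<lambda>n. \<eta> n t) \<longlonglongrightarrow> 1"
    "\<And>K. continuous_on {a..b} K \<Longrightarrow> (\<lambda>n. LINT t:{a..b}|lborel. K t * \<eta>' n t) \<longlonglongrightarrow> K a - K b"
    using interval_cutoffs[OF ab] by blast
  have cG: "continuous_on A G" for A using G(1) by (meson DERIV_continuous_on has_field_derivative_at_within)
  have cG': "continuous_on A G'" for A using G(2) continuous_on_subset by blast
  have c\<eta>: "continuous_on A (\<eta> n)" for A n by (rule interval_test_continuous[OF \<eta>(1)])
  have c\<eta>': "continuous_on A (\<eta>' n)" for A n using \<eta>(1)[of n] continuous_on_subset unfolding interval_test_def by blast
  have mG [measurable]: "G \<in> borel_measurable borel" "G' \<in> borel_measurable borel" "\<eta> n \<in> borel_measurable borel" for n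
    by (auto intro!: borel_measurable_continuous_onI cG cG' c\<eta>)
  have A: "(\<lambda>n. LINT t:{a..b}|lborel. (F t * G t) * \<eta>' n t) \<longlonglongrightarrow> F a * G a - F b * G b"
    by (rule \<eta>(4)) (intro continuous_intros F cG)
  have B: "(\<lambda>n. LINT t:{a..b}|lborel. \<eta> n t * (F t * G' t)) \<longlonglongrightarrow> (LINT t:{a..b}|lborel. F t * G' t)"
    unfolding set_lebesgue_integral_def
  proof (rule integral_dominated_convergence)
    have int: "set_integrable lborel {a..b} (\<lambda>t. F t * G' t)"
      by (intro borel_integrable_atLeastAtMost' continuous_intros F cG')
    then show w: "integrable lborel (\<lambda>t. norm (indicator {a..b} t *\<^sub>R (F t * G' t)))"
      unfolding set_integrable_def by (rule integrable_norm)
    show "(\<lambda>t. indicator {a..b} t *\<^sub>R (F t * G' t)) \<in> borel_measurable lborel"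
      using int unfolding set_integrable_def by (rule borel_measurable_integrable)
    show "(\<lambda>t. indicator {a..b} t *\<^sub>R (\<eta> n t * (F t * G' t))) \<in> borel_measurable lborel" for n
    proof -
      have "set_integrable lborel {a..b} (\<lambda>t. \<eta> n t * (F t * G' t))"
        by (intro borel_integrable_atLeastAtMost' continuous_intros F cG' c\<eta>)
      then show ?thesis unfolding set_integrable_def by (rule borel_measurable_integrable)
    qed
    show "AE t in lborel. norm (indicator {a..b} t *\<^sub>R (\<eta> n t * (F t * G' t))) \<le> norm (indicator {a..b} t *\<^sub>R (F t * G' t))" for n
      using \<eta>(2)[of n] by (auto simp: abs_mult mult_left_le_one_le split: split_indicator)
    have "AE t in lborel. t \<noteq> a \<and> t \<noteq> b" using AE_lborel_singleton[of a] AE_lborel_singleton[of b] by eventually_elim auto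
    then show "AE t in lborel. (\<lambda>n. indicator {a..b} t *\<^sub>R (\<eta> n t * (F t * G' t))) \<longlonglongrightarrow> indicator {a..b} t *\<^sub>R (F t * G' t)"
    proof eventually_elim
      case (elim t)
      then show ?case using tendsto_mult_right[OF \<eta>(3)[of t], of "F t * G' t"] by (auto split: split_indicator)
    qed
  qed
  have C: "(\<lambda>n. \<integral>x. (\<eta> n (p x) * G (p x)) * E x \<partial>M) \<longlonglongrightarrow> (\<integral>x. G (p x) * E x \<partial>M)"
  proof -
    have "bounded (G ` {a..b})" using compact_continuous_image[OF cG compact_Icc] compact_imp_bounded by blast
    then obtain B where B: "\<And>t. t \<in> {a..b} \<Longrightarrow> \<bar>G t\<bar> \<le> B" unfolding bounded_iff by fastforce
    have [measurable]: "E \<in> borel_measurable M" using E by simp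
    show ?thesis
    proof (rule integral_dominated_convergence)
      show "integrable M (\<lambda>x. B * \<bar>E x\<bar>)" using E by simp
      show "AE x in M. norm ((\<eta> n (p x) * G (p x)) * E x) \<le> B * \<bar>E x\<bar>" for n
      proof (rule AE_I2)
        fix x assume "x \<in> space M"
        then have "\<bar>G (p x)\<bar> \<le> B" using B p_in[of x] by auto
        moreover have "\<bar>\<eta> n (p x)\<bar> \<le> 1" using \<eta>(2)[of n "p x"] by simp
        ultimately have "\<bar>\<eta> n (p x)\<bar> * \<bar>G (p x)\<bar> \<le> 1 * B" by (intro mult_mono) auto
        then show "norm ((\<eta> n (p x) * G (p x)) * E x) \<le> B * \<bar>E x\<bar>" by (simp add: abs_mult mult_right_mono)
      qed
      show "AE x in M. (\<lambda>n. (\<eta> n (p x) * G (p x)) * E x) \<longlonglongrightarrow> G (p x) * E x"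
      proof (rule AE_I2)
        fix x assume "x \<in> space M"
        then have "(\<lambda>n. \<eta> n (p x)) \<longlonglongrightarrow> 1" using \<eta>(3) p_in by blast
        from tendsto_mult_right[OF this, of "G (p x) * E x"]
        show "(\<lambda>n. (\<eta> n (p x) * G (p x)) * E x) \<longlonglongrightarrow> G (p x) * E x" by (simp add: mult.assoc)
      qed
    qed measurable
  qed
  have "(LINT t:{a..b}|lborel. (F t * G t) * \<eta>' n t) + (LINT t:{a..b}|lborel. \<eta> n t * (F t * G' t))
      = - (\<integral>x. (\<eta> n (p x) * G (p x)) * E x \<partial>M)" for n
  proof -
    have "(LINT t:{a..b}|lborel. (F t * G t) * \<eta>' n t) + (LINT t:{a..b}|lborel. \<eta> n t * (F t * G' t))
        = (LINT t:{a..b}|lborel. (F t * G t) * \<eta>' n t + \<eta> n t * (F t * G' t))"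
      by (intro set_integral_add(2)[symmetric] borel_integrable_atLeastAtMost' continuous_intros F cG cG' c\<eta> c\<eta>')
    also have "\<dots> = (LINT t:{a..b}|lborel. F t * (\<eta>' n t * G t + \<eta> n t * G' t))"
      by (simp add: algebra_simps)
    also have "\<dots> = - (\<integral>x. (\<eta> n (p x) * G (p x)) * E x \<partial>M)"
      by (rule weak) (rule interval_test_mult[OF \<eta>(1) G])
    finally show ?thesis .
  qed
  then have "(\<lambda>n. - (\<integral>x. (\<eta> n (p x) * G (p x)) * E x \<partial>M)) \<longlonglongrightarrow> (F a * G a - F b * G b) + (LINT t:{a..b}|lborel. F t * G' t)"
    using tendsto_add[OF A B] by simp
  from LIMSEQ_unique[OF this tendsto_minus[OF C]] show ?thesis by simp
qed

section \<open>Weak gradients\<close>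

lemma integral_lebesgue_on_borel:
  fixes f :: "'a::euclidean_space \<Rightarrow> 'b::{banach, second_countable_topology}"
  assumes \<Omega>: "\<Omega> \<in> sets borel" and f: "(\<lambda>x. indicator \<Omega> x *\<^sub>R f x) \<in> borel_measurable borel"
  shows "(\<integral>x. f x \<partial>lebesgue_on \<Omega>) = (\<integral>x. indicator \<Omega> x *\<^sub>R f x \<partial>lborel)"
    and "integrable (lebesgue_on \<Omega>) f \<longleftrightarrow> integrable lborel (\<lambda>x. indicator \<Omega> x *\<^sub>R f x)"
  using \<Omega> f by (simp_all add: integral_restrict_space integral_completion integrable_restrict_space integrable_completion)

lemma open_indicator_measurable:
  fixes f :: "'a::euclidean_space \<Rightarrow> 'b::euclidean_space"
  assumes "open \<Omega>" "continuous_on \<Omega> f"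
  shows "(\<lambda>x. indicator \<Omega> x *\<^sub>R f x) \<in> borel_measurable borel"
  using assms by (intro borel_measurable_continuous_on_indicator) auto

lemma integrable_continuous_closure:
  fixes f :: "'a::euclidean_space \<Rightarrow> 'b::euclidean_space"
  assumes "open \<Omega>" "bounded \<Omega>" and f: "continuous_on (closure \<Omega>) f"
  shows "integrable (lebesgue_on \<Omega>) f"
proof -
  have c: "compact (closure \<Omega>)" using \<open>bounded \<Omega>\<close> by (simp add: compact_closure)
  have "integrable lborel (\<lambda>x. indicator \<Omega> x *\<^sub>R (indicator (closure \<Omega>) x *\<^sub>R f x))"
    by (intro integrable_mult_indicator borel_integrable_compact c f) (use \<open>open \<Omega>\<close> in simp)
  moreover have "(\<lambda>x. indicator \<Omega> x *\<^sub>R (indicator (closure \<Omega>) x *\<^sub>R f x)) = (\<lambda>x. indicator \<Omega> x *\<^sub>R f x)"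
    using closure_subset[of \<Omega>] by (auto simp: fun_eq_iff split: split_indicator)
  ultimately show ?thesis
    using assms continuous_on_subset[OF f closure_subset]
    by (subst integral_lebesgue_on_borel(2)) (auto intro: open_indicator_measurable)
qed

lemma square_integrable_continuous_closure:
  fixes f :: "'a::euclidean_space \<Rightarrow> 'b::euclidean_space"
  assumes "open \<Omega>" "bounded \<Omega>" and f: "continuous_on (closure \<Omega>) f"
  shows "square_integrable (lebesgue_on \<Omega>) f"
  unfolding square_integrable_def
proof
  show "f \<in> borel_measurable (lebesgue_on \<Omega>)"
    using integrable_continuous_closure[OF assms] by (rule borel_measurable_integrable)
  show "integrable (lebesgue_on \<Omega>) (\<lambda>x. (norm (f x))\<^sup>2)"
    by (intro integrable_continuous_closure assms(1,2) continuous_intros f)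
qed

lemma square_integrable_inner:
  fixes f g :: "'a \<Rightarrow> 'b::euclidean_space"
  assumes "square_integrable M f" "square_integrable M g"
  shows "integrable M (\<lambda>x. f x \<bullet> g x)"
proof (rule Bochner_Integration.integrable_bound)
  show "integrable M (\<lambda>x. (norm (f x))\<^sup>2 + (norm (g x))\<^sup>2)"
    using assms by (simp add: square_integrable_def)
  show "(\<lambda>x. f x \<bullet> g x) \<in> borel_measurable M"
    using assms by (intro borel_measurable_inner) (auto simp: square_integrable_def)
  have "\<bar>f x \<bullet> g x\<bar> \<le> (norm (f x))\<^sup>2 + (norm (g x))\<^sup>2" for x
  proof -
    have "\<bar>f x \<bullet> g x\<bar> \<le> norm (f x) * norm (g x)" by (rule Cauchy_Schwarz_ineq2)
    moreover have "0 \<le> (norm (f x) - norm (g x))\<^sup>2" by simp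
    moreover have "0 \<le> (norm (f x))\<^sup>2 + (norm (g x))\<^sup>2" by simp
    ultimately show ?thesis unfolding power2_diff by linarith
  qed
  then show "AE x in M. norm (f x \<bullet> g x) \<le> norm ((norm (f x))\<^sup>2 + (norm (g x))\<^sup>2)" by simp
qed

lemma square_integrable_diff:
  fixes f g :: "'a \<Rightarrow> 'b::euclidean_space"
  assumes "square_integrable M f" "square_integrable M g"
  shows "square_integrable M (\<lambda>x. f x - g x)"
  unfolding square_integrable_def
proof
  show "(\<lambda>x. f x - g x) \<in> borel_measurable M"
    using assms by (intro borel_measurable_diff) (auto simp: square_integrable_def)
  have "(norm (f x - g x))\<^sup>2 = (norm (f x))\<^sup>2 + (norm (g x))\<^sup>2 - 2 * (f x \<bullet> g x)" for x
    unfolding power2_norm_eq_inner by (simp add: inner_diff_left inner_diff_right inner_commute)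
  then show "integrable M (\<lambda>x. (norm (f x - g x))\<^sup>2)"
    using assms square_integrable_inner[OF assms] by (simp add: square_integrable_def)
qed

lemma (in finite_measure) square_integrable_const: "square_integrable M (\<lambda>_. c)"
  by (simp add: square_integrable_def)

lemma (in finite_measure) square_integrable_integrable:
  fixes f :: "'a \<Rightarrow> 'b::euclidean_space"
  assumes "square_integrable M f"
  shows "integrable M f"
proof (rule Bochner_Integration.integrable_bound)
  show "integrable M (\<lambda>x. 1 + (norm (f x))\<^sup>2)" using assms by (simp add: square_integrable_def)
  show "f \<in> borel_measurable M" using assms by (simp add: square_integrable_def)
  have "norm (f x) \<le> 1 + (norm (f x))\<^sup>2" for x
  proof -
    have "0 \<le> (norm (f x) - 1)\<^sup>2" by simp
    then show ?thesis unfolding power2_diff by (smt (verit) norm_ge_zero one_power2 mult_1_right)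
  qed
  then show "AE x in M. norm (f x) \<le> norm (1 + (norm (f x))\<^sup>2)"
    by (intro AE_I2) (smt (verit) real_norm_def)
qed

text \<open>Weak continuity of integration under convergence in \<open>L\<^sup>2\<close>, from
  \<open>2 a b \<le> e a\<^sup>2 + b\<^sup>2 / e\<close>.\<close>

lemma L2_limit_inner:
  fixes f :: "nat \<Rightarrow> 'a \<Rightarrow> 'b::euclidean_space"
  assumes w: "square_integrable M w" and f: "\<And>j. square_integrable M (f j)" and g: "square_integrable M g"
    and conv: "L2_converges M f g"
  shows "(\<lambda>j. \<integral>x. w x \<bullet> f j x \<partial>M) \<longlonglongrightarrow> (\<integral>x. w x \<bullet> g x \<partial>M)"
proof (rule LIMSEQ_I)
  fix r :: real assume r: "0 < r"
  define W where "W = (\<integral>x. (norm (w x))\<^sup>2 \<partial>M)"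
  have W0: "0 \<le> W" by (simp add: W_def)
  \<comment> \<open>With this weight the contribution of \<open>w\<close> is at most \<open>r /
    2\<close>.\<close>
  define e where "e = r / (W + 1)"
  have e: "0 < e" using r W0 by (simp add: e_def)
  define d where "d j = (\<integral>x. (norm (f j x - g x))\<^sup>2 \<partial>M)" for j
  have sq: "square_integrable M (\<lambda>x. f j x - g x)" for j by (rule square_integrable_diff[OF f g])
  have d0: "0 \<le> d j" for j by (simp add: d_def)
  have "(\<integral>\<^sup>+x. ennreal ((norm (f j x - g x))\<^sup>2) \<partial>M) = ennreal (d j)" for j
    unfolding d_def using sq[of j] by (intro nn_integral_eq_integral) (auto simp: square_integrable_def)
  then have "(\<lambda>j. ennreal (d j)) \<longlonglongrightarrow> ennreal 0" using conv by (simp add: L2_converges_def)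
  then have "d \<longlonglongrightarrow> 0" using d0 by (subst (asm) tendsto_ennreal_iff) auto
  then have "\<forall>\<^sub>F j in sequentially. d j < e * r" using e r by (intro order_tendstoD) auto
  then obtain N where N: "\<And>j. N \<le> j \<Longrightarrow> d j < e * r" unfolding eventually_sequentially by blast
  have "norm ((\<integral>x. w x \<bullet> f j x \<partial>M) - (\<integral>x. w x \<bullet> g x \<partial>M)) < r" if j: "N \<le> j" for j
  proof -
    have "(\<integral>x. w x \<bullet> f j x \<partial>M) - (\<integral>x. w x \<bullet> g x \<partial>M) = (\<integral>x. w x \<bullet> (f j x - g x) \<partial>M)"
      by (simp add: inner_diff_right square_integrable_inner[OF w f] square_integrable_inner[OF w g])
    also have "norm \<dots> \<le> (\<integral>x. norm (w x \<bullet> (f j x - g x)) \<partial>M)" by (rule integral_norm_bound)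
    also have "\<dots> \<le> (\<integral>x. (e * (norm (w x))\<^sup>2 + (norm (f j x - g x))\<^sup>2 / e) / 2 \<partial>M)"
    proof (rule integral_mono)
      show "integrable M (\<lambda>x. norm (w x \<bullet> (f j x - g x)))"
        using square_integrable_inner[OF w sq] by (rule integrable_norm)
      show "integrable M (\<lambda>x. (e * (norm (w x))\<^sup>2 + (norm (f j x - g x))\<^sup>2 / e) / 2)"
        using w sq[of j] by (auto simp: square_integrable_def)
      fix x
      let ?a = "norm (w x)" and ?b = "norm (f j x - g x)"
      have "norm (w x \<bullet> (f j x - g x)) \<le> ?a * ?b" by (simp add: Cauchy_Schwarz_ineq2)
      also have "?a * ?b \<le> (e * ?a\<^sup>2 + ?b\<^sup>2 / e) / 2"
      proof -
        have "0 \<le> (e * ?a - ?b)\<^sup>2 / e" using e by simp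
        also have "\<dots> = e * ?a\<^sup>2 + ?b\<^sup>2 / e - 2 * (?a * ?b)"
          using e by (simp add: field_simps power2_eq_square)
        finally show ?thesis by simp
      qed
      finally show "norm (w x \<bullet> (f j x - g x)) \<le> (e * ?a\<^sup>2 + ?b\<^sup>2 / e) / 2" .
    qed
    also have "\<dots> = (e * W + d j / e) / 2"
      using w sq[of j] by (simp add: square_integrable_def W_def d_def)
    also have "\<dots> < r"
    proof -
      have "e * W \<le> r" using W0 r by (simp add: e_def field_simps)
      moreover have "d j / e < r" using N[OF j] e by (simp add: pos_divide_less_eq mult.commute)
      ultimately show ?thesis by simp
    qed
    finally show ?thesis .
  qed
  then show "\<exists>N. \<forall>j\<ge>N. norm ((\<integral>x. w x \<bullet> f j x \<partial>M) - (\<integral>x. w x \<bullet> g x \<partial>M)) < r" by blast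
qed

lemma compact_if_closed_subset:
  fixes K :: "'a::t2_space set"
  shows "closed S \<Longrightarrow> S \<subseteq> K \<Longrightarrow> compact K \<Longrightarrow> compact S"
  by (metis closed_Int_compact inf.absorb1)

lemma GDERIV_unique:
  assumes "GDERIV f x :> D" "GDERIV f x :> E" shows "D = E"
proof -
  have "(\<lambda>h. h \<bullet> D) = (\<lambda>h. h \<bullet> E)"
    using assms unfolding gderiv_def by (rule has_derivative_unique)
  then have "(D - E) \<bullet> D = (D - E) \<bullet> E" by meson
  then have "(D - E) \<bullet> (D - E) = 0" by (simp add: inner_diff_right)
  then show ?thesis by simp
qed

lemma GDERIV_zero_outside:
  assumes "x \<notin> closure {x. \<phi> x \<noteq> 0}" shows "GDERIV \<phi> x :> 0"
proof -
  have "((\<lambda>_. 0) has_derivative (\<lambda>h. h \<bullet> 0)) (at x)" by simp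
  then show ?thesis unfolding gderiv_def
  proof (rule has_derivative_transform_within_open)
    show "open (- closure {x. \<phi> x \<noteq> 0})" by auto
    show "x \<in> - closure {x. \<phi> x \<noteq> 0}" using assms by simp
    fix y assume "y \<in> - closure {x. \<phi> x \<noteq> 0}"
    then show "0 = \<phi> y" using closure_subset[of "{x. \<phi> x \<noteq> 0}"] by auto
  qed
qed

lemma GDERIV_continuous_on: "(\<And>x. x \<in> S \<Longrightarrow> GDERIV f x :> D x) \<Longrightarrow> continuous_on S f"
  unfolding gderiv_def by (meson continuous_at_imp_continuous_on has_derivative_continuous)

lemma test_function_outside:
  assumes "C1_test_function \<Omega> \<phi> D" "x \<notin> closure {x. \<phi> x \<noteq> 0}"
  shows "\<phi> x = 0" "D x = 0"
  using assms closure_subset[of "{x. \<phi> x \<noteq> 0}"] GDERIV_unique[OF _ GDERIV_zero_outside[OF assms(2)]]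
  unfolding C1_test_function_def by auto

lemma integral_lborel_translate:
  fixes f :: "'a::euclidean_space \<Rightarrow> real"
  assumes [measurable]: "f \<in> borel_measurable borel"
  shows "(\<integral>x. f (c + x) \<partial>lborel) = (\<integral>x. f x \<partial>lborel)"
proof -
  have "(\<integral>x. f x \<partial>lborel) = (\<integral>x. f x \<partial>distr lborel borel ((+) c))" by (simp add: lborel_distr_plus)
  then show ?thesis by (simp add: integral_distr)
qed

text \<open>The integral of \<open>(w (x + h v) - w x) / h\<close> vanishes by translation
  invariance, and these quotients converge to the directional derivative under a bound by the
  Lipschitz constant of \<open>w\<close> on a fixed ball.\<close>

lemma integral_gradient_zero:
  fixes w :: "'a::euclidean_space \<Rightarrow> real"
  assumes w: "C1_test_function UNIV w D"
  shows "integrable lborel D" "(\<integral>x. D x \<partial>lborel) = 0"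
proof -
  define K where "K = closure {x. w x \<noteq> 0}"
  have GD: "\<And>x. GDERIV w x :> D x" and cD: "continuous_on UNIV D" and K: "compact K"
    using w by (auto simp: C1_test_function_def K_def)
  have cw: "continuous_on UNIV w" using GD by (rule GDERIV_continuous_on)
  have [measurable]: "w \<in> borel_measurable borel" "D \<in> borel_measurable borel"
    using cw cD by (auto intro: borel_measurable_continuous_onI)
  have D0: "D x = 0" and w0: "w x = 0" if "x \<notin> K" for x using test_function_outside[OF w, of x] that unfolding K_def by blast+
  have ind: "(\<lambda>x. indicator K x *\<^sub>R D x) = D" "(\<lambda>x. indicator K x *\<^sub>R w x) = w"
  proof (rule_tac [!] ext)
    show "indicator K x *\<^sub>R D x = D x" "indicator K x *\<^sub>R w x = w x" for x
      using D0[of x] w0[of x] by (cases "x \<in> K"; simp)+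
  qed
  show intD: "integrable lborel D"
    using borel_integrable_compact[OF K continuous_on_subset[OF cD]] by (simp add: ind)
  have intw: "integrable lborel w"
    using borel_integrable_compact[OF K continuous_on_subset[OF cw]] by (simp add: ind(2)[simplified])
  have "bounded (D ` K)" using compact_continuous_image[OF continuous_on_subset[OF cD] K] compact_imp_bounded by blast
  then obtain B0 where "\<And>x. x \<in> K \<Longrightarrow> norm (D x) \<le> B0" unfolding bounded_iff by fastforce
  then have B: "norm (D x) \<le> max 0 B0" for x using D0[of x] by (cases "x \<in> K") (auto intro: max.coboundedI2)
  define B where "B = max 0 B0"
  obtain R where R: "\<And>x. x \<in> K \<Longrightarrow> norm x \<le> R" using compact_imp_bounded[OF K] unfolding bounded_iff by blast
  have Lip: "norm (w x - w y) \<le> B * norm (x - y)" for x y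
  proof (rule differentiable_bound[of UNIV w "\<lambda>x h. h \<bullet> D x"])
    show "(w has_derivative (\<lambda>h. h \<bullet> D x)) (at x within UNIV)" for x using GD[of x] by (simp add: gderiv_def)
    show "onorm (\<lambda>h. h \<bullet> D x) \<le> B" for x
    proof (rule onorm_le)
      fix h show "norm (h \<bullet> D x) \<le> B * norm h"
        using Cauchy_Schwarz_ineq2[of h "D x"] mult_left_mono[OF B[of x], of "norm h"]
        by (simp add: B_def mult.commute)
    qed
  qed auto
  have dir: "(\<integral>x. v \<bullet> D x \<partial>lborel) = 0" for v :: 'a
  proof -
    define h where "h k = inverse (real (Suc k))" for k
    have h: "0 < h k" "h k \<le> 1" for k by (auto simp: h_def field_simps)
    have hlim: "h \<longlonglongrightarrow> 0" unfolding h_def by (rule LIMSEQ_inverse_real_of_nat)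
    define s where "s k x = (w (h k *\<^sub>R v + x) - w x) / h k" for k x
    have [measurable]: "s k \<in> borel_measurable borel" for k unfolding s_def by measurable
    have "(\<lambda>k. \<integral>x. s k x \<partial>lborel) \<longlonglongrightarrow> (\<integral>x. v \<bullet> D x \<partial>lborel)"
    proof (rule integral_dominated_convergence)
      show "integrable lborel (\<lambda>x. indicator (cball (0::'a) (R + norm v)) x *\<^sub>R (B * norm v))"
        by (rule borel_integrable_compact) auto
      show "AE x in lborel. norm (s k x) \<le> indicator (cball 0 (R + norm v)) x *\<^sub>R (B * norm v)" for k
      proof (rule AE_I2)
        fix x :: 'a
        show "norm (s k x) \<le> indicator (cball 0 (R + norm v)) x *\<^sub>R (B * norm v)"
        proof (cases "norm x \<le> R + norm v")
          case True
          have "\<bar>w (h k *\<^sub>R v + x) - w x\<bar> \<le> B * (h k * norm v)"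
            using Lip[of "h k *\<^sub>R v + x" x] h[of k] by simp
          then have "norm (s k x) \<le> B * norm v" using h[of k] by (simp add: s_def field_simps)
          then show ?thesis using True by simp
        next
          case False
          have "h k * norm v \<le> norm v" using h[of k] by (simp add: mult_left_le_one_le)
          then have "R < norm (h k *\<^sub>R v + x)" using False norm_triangle_ineq4[of "h k *\<^sub>R v + x" "h k *\<^sub>R v"] h[of k] by simp
          moreover have "R < norm x" using False norm_ge_zero[of v] by linarith
          ultimately have "s k x = 0"
          proof -
            have "w (h k *\<^sub>R v + x) = 0" "w x = 0"
              using R w0 \<open>R < norm (h k *\<^sub>R v + x)\<close> \<open>R < norm x\<close> by (metis not_less)+
            then show ?thesis by (simp add: s_def)
          qed
          then show ?thesis using False by simp
        qed
      qed
      show "AE x in lborel. (\<lambda>k. s k x) \<longlonglongrightarrow> v \<bullet> D x"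
      proof (rule AE_I2)
        fix x :: 'a
        have "((\<lambda>t. w (t *\<^sub>R v + x)) has_derivative (\<lambda>t. (t *\<^sub>R v) \<bullet> D x)) (at 0)"
        proof (rule has_derivative_compose[of "\<lambda>t. t *\<^sub>R v + x" "\<lambda>t. t *\<^sub>R v" 0 UNIV w "\<lambda>h. h \<bullet> D x"])
          show "((\<lambda>t. t *\<^sub>R v + x) has_derivative (\<lambda>t. t *\<^sub>R v)) (at 0)" by (auto intro!: derivative_eq_intros)
          show "(w has_derivative (\<lambda>h. h \<bullet> D x)) (at (0 *\<^sub>R v + x))" using GD[of x] by (simp add: gderiv_def)
        qed
        then have "DERIV (\<lambda>t. w (t *\<^sub>R v + x)) 0 :> v \<bullet> D x"
          unfolding has_field_derivative_def by (simp add: mult.commute[of _ "v \<bullet> D x"])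
        then have "((\<lambda>t. (w (t *\<^sub>R v + x) - w x) / t) \<longlongrightarrow> v \<bullet> D x) (at 0)"
          unfolding DERIV_def by simp
        moreover have "filterlim h (at 0) sequentially"
          unfolding filterlim_at using hlim h by (auto simp: less_le)
        ultimately show "(\<lambda>k. s k x) \<longlonglongrightarrow> v \<bullet> D x"
          unfolding s_def by (rule filterlim_compose)
      qed
    qed measurable
    moreover have "(\<integral>x. s k x \<partial>lborel) = 0" for k
    proof -
      have "integrable lborel (\<lambda>x. w (h k *\<^sub>R v + x))"
      proof -
        have "integrable (distr lborel borel ((+) (h k *\<^sub>R v))) w" using intw by (simp add: lborel_distr_plus)
        then show ?thesis by (simp add: integrable_distr_eq)
      qed
      then show ?thesis using intw by (simp add: s_def integral_lborel_translate)
    qed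
    ultimately show ?thesis by (simp add: LIMSEQ_const_iff)
  qed
  have "(\<integral>x. D x \<partial>lborel) \<bullet> (\<integral>x. D x \<partial>lborel) = (\<integral>x. (\<integral>x. D x \<partial>lborel) \<bullet> D x \<partial>lborel)"
    using intD by (simp add: integral_inner_right)
  then show "(\<integral>x. D x \<partial>lborel) = 0" using dir by simp
qed

lemma continuous_extend_zero:
  fixes f :: "'a::euclidean_space \<Rightarrow> 'b::euclidean_space"
  assumes "open \<Omega>" "closed K" "K \<subseteq> \<Omega>" and f: "continuous_on \<Omega> f" and f0: "\<And>x. x \<in> \<Omega> - K \<Longrightarrow> f x = 0"
  shows "continuous_on UNIV (\<lambda>x. if x \<in> \<Omega> then f x else 0)"
proof -
  have "continuous_on (\<Omega> \<union> - K) (\<lambda>x. if x \<in> \<Omega> then f x else 0)"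
  proof (rule continuous_on_open_Un)
    show "continuous_on \<Omega> (\<lambda>x. if x \<in> \<Omega> then f x else 0)" using f by (simp cong: continuous_on_cong)
    have "continuous_on (- K) (\<lambda>x. 0 :: 'b)" by simp
    then show "continuous_on (- K) (\<lambda>x. if x \<in> \<Omega> then f x else 0)"
      by (rule continuous_on_eq) (use f0 in auto)
  qed (use assms in auto)
  moreover have "\<Omega> \<union> - K = UNIV" using \<open>K \<subseteq> \<Omega>\<close> by blast
  ultimately show ?thesis by simp
qed

text \<open>The product of \<open>u\<close> with a test function, extended by zero, is a test
  function on the whole space, so the integral of its gradient vanishes.\<close>

lemma H1_with_gradient_C1:
  fixes u :: "'a::euclidean_space \<Rightarrow> real"
  assumes \<Omega>: "open \<Omega>" "bounded \<Omega>" and u: "\<And>x. x \<in> \<Omega> \<Longrightarrow> GDERIV u x :> g x"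
    and cu: "continuous_on (closure \<Omega>) u" and cg: "continuous_on (closure \<Omega>) g"
  shows "H1_with_gradient \<Omega> u g"
  unfolding H1_with_gradient_def
proof (intro conjI allI impI)
  show "square_integrable (lebesgue_on \<Omega>) u" "square_integrable (lebesgue_on \<Omega>) g"
    by (intro square_integrable_continuous_closure \<Omega> cu cg)+
  fix \<phi> D assume \<phi>: "C1_test_function \<Omega> \<phi> D"
  define K where "K = closure {x. \<phi> x \<noteq> 0}"
  have K: "compact K" "K \<subseteq> \<Omega>" and GD: "\<And>x. GDERIV \<phi> x :> D x" and cD: "continuous_on UNIV D"
    using \<phi> by (auto simp: C1_test_function_def K_def)
  have c\<phi>: "continuous_on UNIV \<phi>" using GD by (rule GDERIV_continuous_on)
  define w where "w x = (if x \<in> \<Omega> then \<phi> x * u x else 0)" for x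
  define E where "E x = (if x \<in> \<Omega> then \<phi> x *\<^sub>R g x + u x *\<^sub>R D x else 0)" for x
  have supp: "closure {x. w x \<noteq> 0} \<subseteq> K" unfolding K_def by (rule closure_mono) (auto simp: w_def)
  have "C1_test_function UNIV w E"
    unfolding C1_test_function_def
  proof (intro conjI allI)
    fix x
    show "GDERIV w x :> E x"
    proof (cases "x \<in> \<Omega>")
      case True
      have "GDERIV (\<lambda>x. \<phi> x * u x) x :> \<phi> x *\<^sub>R g x + u x *\<^sub>R D x" by (rule GDERIV_mult[OF GD u[OF True]])
      then have "GDERIV w x :> \<phi> x *\<^sub>R g x + u x *\<^sub>R D x" unfolding gderiv_def
        by (rule has_derivative_transform_within_open[OF _ \<Omega>(1) True]) (simp add: w_def)
      then show ?thesis using True by (simp add: E_def)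
    next
      case False
      then have "x \<notin> closure {x. w x \<noteq> 0}" using supp K by auto
      then show ?thesis using GDERIV_zero_outside False by (simp add: E_def)
    qed
  next
    show "continuous_on UNIV E" unfolding E_def
    proof (rule continuous_extend_zero[OF \<Omega>(1) _ K(2)])
      show "continuous_on \<Omega> (\<lambda>x. \<phi> x *\<^sub>R g x + u x *\<^sub>R D x)"
        using continuous_on_subset[OF cu closure_subset] continuous_on_subset[OF cg closure_subset]
          continuous_on_subset[OF cD subset_UNIV] continuous_on_subset[OF c\<phi> subset_UNIV]
        by (intro continuous_intros)
      show "closed K" by (simp add: K_def)
      show "\<phi> x *\<^sub>R g x + u x *\<^sub>R D x = 0" if "x \<in> \<Omega> - K" for x
        using test_function_outside[OF \<phi>, of x] that by (simp add: K_def)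
    qed
    show "compact (closure {x. w x \<noteq> 0})" using supp K by (meson closed_closure compact_if_closed_subset)
  qed simp
  from integral_gradient_zero(2)[OF this] have E0: "(\<integral>x. E x \<partial>lborel) = 0" .
  have Eind: "(\<lambda>x. indicator \<Omega> x *\<^sub>R (\<phi> x *\<^sub>R g x + u x *\<^sub>R D x)) = E"
    by (auto simp: E_def fun_eq_iff split: split_indicator)
  have c2: "continuous_on (closure \<Omega>) (\<lambda>x. \<phi> x *\<^sub>R g x)" "continuous_on (closure \<Omega>) (\<lambda>x. u x *\<^sub>R D x)"
    by (intro continuous_intros cu cg continuous_on_subset[OF cD subset_UNIV] continuous_on_subset[OF c\<phi> subset_UNIV])+
  have c3: "continuous_on \<Omega> (\<lambda>x. \<phi> x *\<^sub>R g x + u x *\<^sub>R D x)"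
    using continuous_on_add[OF c2] closure_subset by (rule continuous_on_subset)
  have "(\<integral>x. \<phi> x *\<^sub>R g x + u x *\<^sub>R D x \<partial>lebesgue_on \<Omega>) = (\<integral>x. E x \<partial>lborel)"
    unfolding Eind[symmetric]
    by (rule integral_lebesgue_on_borel(1)[OF _ open_indicator_measurable[OF \<Omega>(1) c3]]) (use \<Omega> in simp)
  then have "(\<integral>x. \<phi> x *\<^sub>R g x + u x *\<^sub>R D x \<partial>lebesgue_on \<Omega>) = 0" using E0 by simp
  then have "(\<integral>x. \<phi> x *\<^sub>R g x \<partial>lebesgue_on \<Omega>) + (\<integral>x. u x *\<^sub>R D x \<partial>lebesgue_on \<Omega>) = 0"
    using integrable_continuous_closure[OF \<Omega> c2(1)] integrable_continuous_closure[OF \<Omega> c2(2)] by simp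
  then show "(\<integral>x. u x *\<^sub>R D x \<partial>lebesgue_on \<Omega>) = - (\<integral>x. \<phi> x *\<^sub>R g x \<partial>lebesgue_on \<Omega>)"
    by (simp add: eq_neg_iff_add_eq_0 add.commute)
qed

lemma finite_measure_lebesgue_bounded_open:
  assumes "open (\<Omega> :: 'a::euclidean_space set)" "bounded \<Omega>"
  shows "finite_measure (lebesgue_on \<Omega>)"
  using assms by (intro finite_measure_lebesgue_on) (simp add: lmeasurable_open)

lemma integrable_test_mult:
  fixes f :: "'a::euclidean_space \<Rightarrow> 'b::euclidean_space" and c :: "'a \<Rightarrow> real"
  assumes f: "integrable (lebesgue_on \<Omega>) f" and c: "continuous_on UNIV c" "bounded (range c)"
    and \<Omega>: "open \<Omega>"
  shows "integrable (lebesgue_on \<Omega>) (\<lambda>x. c x *\<^sub>R f x)"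
proof -
  obtain B where B: "\<And>x. \<bar>c x\<bar> \<le> B" using c(2) by (auto simp: bounded_iff)
  have c_borel: "c \<in> borel_measurable borel" using c(1) by (rule borel_measurable_continuous_onI)
  then have [measurable]: "c \<in> borel_measurable (lebesgue_on \<Omega>)"
    by (intro measurable_restrict_space1 measurable_completion) simp
  have [measurable]: "f \<in> borel_measurable (lebesgue_on \<Omega>)" using f by simp
  show ?thesis
  proof (rule Bochner_Integration.integrable_bound)
    show "integrable (lebesgue_on \<Omega>) (\<lambda>x. B *\<^sub>R f x)" using f by simp
    show "AE x in lebesgue_on \<Omega>. norm (c x *\<^sub>R f x) \<le> norm (B *\<^sub>R f x)"
      using B by (intro AE_I2) (auto intro!: mult_right_mono intro: order_trans[OF _ abs_ge_self])
  qed measurable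
qed

lemma test_function_bounded:
  assumes \<phi>: "C1_test_function \<Omega> \<phi> D"
  shows "bounded (range \<phi>)" "bounded (range D)" "continuous_on UNIV \<phi>" "continuous_on UNIV D"
proof -
  let ?K = "closure {x. \<phi> x \<noteq> 0}"
  have K: "compact ?K" and GD: "\<And>x. GDERIV \<phi> x :> D x" and cD: "continuous_on UNIV D"
    using \<phi> by (auto simp: C1_test_function_def)
  show "continuous_on UNIV D" by (rule cD)
  show c\<phi>: "continuous_on UNIV \<phi>" using GD by (rule GDERIV_continuous_on)
  have "range \<phi> \<subseteq> insert 0 (\<phi> ` ?K)" "range D \<subseteq> insert 0 (D ` ?K)"
    using test_function_outside[OF \<phi>] by blast+
  moreover have "bounded (\<phi> ` ?K)" "bounded (D ` ?K)"
    using compact_continuous_image[OF continuous_on_subset[OF c\<phi>] K]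
      compact_continuous_image[OF continuous_on_subset[OF cD] K] compact_imp_bounded by blast+
  ultimately show "bounded (range \<phi>)" "bounded (range D)" by (meson bounded_insert bounded_subset)+
qed

lemma integrable_test_gradient:
  fixes u :: "'a::euclidean_space \<Rightarrow> real" and D :: "'a \<Rightarrow> 'a"
  assumes u: "integrable (lebesgue_on \<Omega>) u" and D: "continuous_on UNIV D" "bounded (range D)" and \<Omega>: "open \<Omega>"
  shows "integrable (lebesgue_on \<Omega>) (\<lambda>x. u x *\<^sub>R D x)"
proof -
  obtain B where B: "\<And>x. norm (D x) \<le> B" using D(2) by (auto simp: bounded_iff)
  have "D \<in> borel_measurable borel" using D(1) by (rule borel_measurable_continuous_onI)
  then have [measurable]: "D \<in> borel_measurable (lebesgue_on \<Omega>)"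
    by (intro measurable_restrict_space1 measurable_completion) simp
  have [measurable]: "u \<in> borel_measurable (lebesgue_on \<Omega>)" using u by simp
  show ?thesis
  proof (rule Bochner_Integration.integrable_bound)
    show "integrable (lebesgue_on \<Omega>) (\<lambda>x. B *\<^sub>R u x)" using u by simp
    have "norm (D x) \<le> \<bar>B\<bar>" for x using B[of x] by linarith
    then show "AE x in lebesgue_on \<Omega>. norm (u x *\<^sub>R D x) \<le> norm (B *\<^sub>R u x)"
      by (intro AE_I2) (auto simp: abs_mult mult.commute[of "\<bar>B\<bar>"] intro!: mult_left_mono)
  qed measurable
qed

lemma H1_with_gradient_diff:
  fixes u w :: "'a::euclidean_space \<Rightarrow> real"
  assumes \<Omega>: "open \<Omega>" "bounded \<Omega>" and u: "H1_with_gradient \<Omega> u g" and w: "H1_with_gradient \<Omega> w h"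
  shows "H1_with_gradient \<Omega> (\<lambda>x. u x - w x) (\<lambda>x. g x - h x)"
proof -
  interpret finite_measure "lebesgue_on \<Omega>" by (rule finite_measure_lebesgue_bounded_open[OF \<Omega>])
  show ?thesis
    unfolding H1_with_gradient_def
  proof (intro conjI allI impI)
    show "square_integrable (lebesgue_on \<Omega>) (\<lambda>x. u x - w x)" "square_integrable (lebesgue_on \<Omega>) (\<lambda>x. g x - h x)"
      using u w by (auto simp: H1_with_gradient_def intro: square_integrable_diff)
    fix \<phi> D assume \<phi>: "C1_test_function \<Omega> \<phi> D"
    note b = test_function_bounded[OF \<phi>]
    have int: "integrable (lebesgue_on \<Omega>) u" "integrable (lebesgue_on \<Omega>) w"
      "integrable (lebesgue_on \<Omega>) g" "integrable (lebesgue_on \<Omega>) h"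
      using u w by (auto simp: H1_with_gradient_def intro: square_integrable_integrable)
    show "(\<integral>x. (u x - w x) *\<^sub>R D x \<partial>lebesgue_on \<Omega>) = - (\<integral>x. \<phi> x *\<^sub>R (g x - h x) \<partial>lebesgue_on \<Omega>)"
      using u w \<phi> integrable_test_gradient[OF int(1) b(4,2) \<Omega>(1)] integrable_test_gradient[OF int(2) b(4,2) \<Omega>(1)]
        integrable_test_mult[OF int(3) b(3,1) \<Omega>(1)] integrable_test_mult[OF int(4) b(3,1) \<Omega>(1)]
      by (simp add: H1_with_gradient_def scaleR_diff_left scaleR_diff_right)
  qed
qed

text \<open>Such a function has derivative zero everywhere.\<close>

lemma quadratic_variation_imp_constant:
  fixes W :: "'a::euclidean_space \<Rightarrow> real"
  assumes S: "convex S" and W: "\<And>x y. x \<in> S \<Longrightarrow> y \<in> S \<Longrightarrow> \<bar>W y - W x\<bar> \<le> C * (norm (y - x))\<^sup>2"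
    and xy: "x \<in> S" "y \<in> S"
  shows "W x = W y"
proof -
  have "(W has_derivative (\<lambda>h. 0)) (at x within S)" if x: "x \<in> S" for x
  proof (rule has_derivativeI_sandwich[where e=1 and H="\<lambda>y. C * norm (y - x)"])
    fix y assume y: "y \<in> S" "y \<noteq> x"
    have "norm (W y - W x - 0) / norm (y - x) \<le> C * (norm (y - x))\<^sup>2 / norm (y - x)"
      using W[OF x y(1)] by (intro divide_right_mono) auto
    also have "\<dots> = C * norm (y - x)" using y by (simp add: power2_eq_square)
    finally show "norm (W y - W x - 0) / norm (y - x) \<le> C * norm (y - x)" .
  next
    have "((\<lambda>y. C * norm (y - x)) \<longlongrightarrow> C * norm (x - x)) (at x within S)" by (intro tendsto_intros)
    then show "((\<lambda>y. C * norm (y - x)) \<longlongrightarrow> 0) (at x within S)" by simp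
  qed auto
  from has_derivative_zero_constant[OF S this] show ?thesis using xy by auto
qed

definition bump :: "real \<Rightarrow> 'a::euclidean_space \<Rightarrow> 'a \<Rightarrow> real" where
  "bump \<epsilon> z x = sq_pos (\<epsilon>\<^sup>2 - (x - z) \<bullet> (x - z))"

lemma GDERIV_bump: "GDERIV (bump \<epsilon> z) x :> (- 4 * max 0 (\<epsilon>\<^sup>2 - (x - z) \<bullet> (x - z))) *\<^sub>R (x - z)"
proof -
  have "GDERIV (\<lambda>x. \<epsilon>\<^sup>2 - (x - z) \<bullet> (x - z)) x :> (- 2) *\<^sub>R (x - z)"
    unfolding gderiv_def by (auto intro!: derivative_eq_intros simp: fun_eq_iff inner_commute)
  from GDERIV_DERIV_compose[OF this DERIV_sq_pos] show ?thesis
    unfolding bump_def by (simp add: algebra_simps)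
qed

lemma continuous_bump: "continuous_on A (\<lambda>x. bump \<epsilon> z x)"
  using GDERIV_continuous_on[OF GDERIV_bump] .

lemma bump_nonneg: "0 \<le> bump \<epsilon> z x" by (simp add: bump_def sq_pos_def)

lemma bump_outside:
  assumes "0 < \<epsilon>" "\<epsilon> \<le> norm (x - z)" shows "bump \<epsilon> z x = 0"
proof -
  have "\<epsilon>\<^sup>2 \<le> (norm (x - z))\<^sup>2" using assms by (intro power_mono) auto
  then show ?thesis by (simp add: bump_def sq_pos_def power2_norm_eq_inner)
qed

lemma bump_test_function:
  assumes "0 < \<epsilon>" "cball z \<epsilon> \<subseteq> \<Omega>"
  shows "C1_test_function \<Omega> (bump \<epsilon> z) (\<lambda>x. (- 4 * max 0 (\<epsilon>\<^sup>2 - (x - z) \<bullet> (x - z))) *\<^sub>R (x - z))"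
proof -
  have "{x. bump \<epsilon> z x \<noteq> 0} \<subseteq> cball z \<epsilon>"
    using bump_outside[OF assms(1), of _ z] by (force simp: dist_norm norm_minus_commute)
  then have sub: "closure {x. bump \<epsilon> z x \<noteq> 0} \<subseteq> cball z \<epsilon>" by (simp add: closure_minimal)
  then have "compact (closure {x. bump \<epsilon> z x \<noteq> 0})"
    by (meson closed_closure compact_cball compact_if_closed_subset)
  then show ?thesis
    using sub assms(2) GDERIV_bump unfolding C1_test_function_def
    by (auto intro!: continuous_intros)
qed

text \<open>The derivative of the average with respect to the centre of the bump is, up to sign,
  \<open>v\<close> tested with the gradient of the bump, hence zero. In place of differentiating
  under the integral, the quadratic remainder of the bump bounds the change of the average by
  the square of the displacement.\<close>

lemma bump_average_constant:
  fixes v :: "'a::euclidean_space \<Rightarrow> real"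
  assumes \<Omega>: "open \<Omega>" "bounded \<Omega>" and v: "continuous_on (closure \<Omega>) v"
    and weak: "\<And>\<phi> D. C1_test_function \<Omega> \<phi> D \<Longrightarrow> (\<integral>x. v x *\<^sub>R D x \<partial>lebesgue_on \<Omega>) = 0"
    and S: "convex S" "bounded S" "\<And>z. z \<in> S \<Longrightarrow> cball z \<epsilon> \<subseteq> \<Omega>" and \<epsilon>: "0 < \<epsilon>" and xy: "x \<in> S" "y \<in> S"
  shows "(\<integral>p. v p * bump \<epsilon> x p \<partial>lebesgue_on \<Omega>) = (\<integral>p. v p * bump \<epsilon> y p \<partial>lebesgue_on \<Omega>)"
proof -
  obtain \<rho>1 where "\<And>x. x \<in> \<Omega> \<Longrightarrow> norm x \<le> \<rho>1" using \<Omega>(2) unfolding bounded_iff by blast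
  moreover obtain \<rho>2 where "\<And>x. x \<in> S \<Longrightarrow> norm x \<le> \<rho>2" using S(2) unfolding bounded_iff by blast
  ultimately have "\<And>x. x \<in> \<Omega> \<Longrightarrow> norm x \<le> max \<rho>1 \<rho>2" "\<And>x. x \<in> S \<Longrightarrow> norm x \<le> max \<rho>1 \<rho>2"
    by (simp_all add: max.coboundedI1 max.coboundedI2)
  then obtain \<rho> where \<rho>: "\<And>x. x \<in> \<Omega> \<Longrightarrow> norm x \<le> \<rho>" "\<And>x. x \<in> S \<Longrightarrow> norm x \<le> \<rho>" by blast
  define C where "C = (6 * \<rho>)\<^sup>2 + 2 * \<epsilon>\<^sup>2"
  define I where "I = (\<integral>p. \<bar>v p\<bar> \<partial>lebesgue_on \<Omega>)"
  define W where "W z = (\<integral>p. v p * bump \<epsilon> z p \<partial>lebesgue_on \<Omega>)" for z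
  have quad: "\<bar>W z' - W z\<bar> \<le> (C * I) * (norm (z' - z))\<^sup>2" if z: "z \<in> S" and z': "z' \<in> S" for z z'
  proof -
    define h where "h = z' - z"
    define l where "l p = 4 * max 0 (\<epsilon>\<^sup>2 - (p - z) \<bullet> (p - z)) * ((p - z) \<bullet> h)" for p
    define R where "R p = bump \<epsilon> z' p - bump \<epsilon> z p - l p" for p
    let ?D = "\<lambda>x. (- 4 * max 0 (\<epsilon>\<^sup>2 - (x - z) \<bullet> (x - z))) *\<^sub>R (x - z)"
    have cl: "continuous_on A l" for A unfolding l_def by (intro continuous_intros)
    have cR: "continuous_on A R" for A unfolding R_def by (intro continuous_intros continuous_bump cl)
    have int: "integrable (lebesgue_on \<Omega>) (\<lambda>p. v p * bump \<epsilon> z' p)" "integrable (lebesgue_on \<Omega>) (\<lambda>p. v p * bump \<epsilon> z p)"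
      "integrable (lebesgue_on \<Omega>) (\<lambda>p. v p * l p)" "integrable (lebesgue_on \<Omega>) (\<lambda>p. v p * R p)"
      "integrable (lebesgue_on \<Omega>) (\<lambda>p. C * (norm h)\<^sup>2 * \<bar>v p\<bar>)" "integrable (lebesgue_on \<Omega>) (\<lambda>p. v p *\<^sub>R ?D p)"
      by (intro integrable_continuous_closure \<Omega> continuous_intros v continuous_bump cl cR)+
    have "(\<integral>p. v p * l p \<partial>lebesgue_on \<Omega>) = - ((\<integral>p. v p *\<^sub>R ?D p \<partial>lebesgue_on \<Omega>) \<bullet> h)"
      using int(6) by (subst integral_inner_left[symmetric]) (auto simp: l_def simp flip: Bochner_Integration.integral_minus intro!: Bochner_Integration.integral_cong)
    also have "\<dots> = 0" using weak[OF bump_test_function[OF \<epsilon> S(3)[OF z]]] by simp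
    finally have l0: "(\<integral>p. v p * l p \<partial>lebesgue_on \<Omega>) = 0" .
    have "(\<integral>p. v p * R p \<partial>lebesgue_on \<Omega>) = W z' - W z"
      unfolding R_def W_def right_diff_distrib using int l0 by simp
    moreover have "\<bar>\<integral>p. v p * R p \<partial>lebesgue_on \<Omega>\<bar> \<le> (\<integral>p. \<bar>v p * R p\<bar> \<partial>lebesgue_on \<Omega>)"
      by (rule integral_abs_bound)
    moreover have "\<dots> \<le> (\<integral>p. C * (norm h)\<^sup>2 * \<bar>v p\<bar> \<partial>lebesgue_on \<Omega>)"
    proof (rule integral_mono)
      show "integrable (lebesgue_on \<Omega>) (\<lambda>p. \<bar>v p * R p\<bar>)" using int(4) by simp
      fix p assume "p \<in> space (lebesgue_on \<Omega>)"
      then have p: "p \<in> \<Omega>" by simp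
      let ?a = "\<epsilon>\<^sup>2 - (p - z) \<bullet> (p - z)" and ?b = "\<epsilon>\<^sup>2 - (p - z') \<bullet> (p - z')"
      have ba: "?b - ?a = 2 * ((p - z) \<bullet> h) - (norm h)\<^sup>2"
        unfolding h_def power2_norm_eq_inner by (simp add: inner_diff_left inner_diff_right inner_commute algebra_simps)
      have nz: "norm (p - z) \<le> 2 * \<rho>" "norm h \<le> 2 * \<rho>"
        using norm_triangle_ineq4[of p z] norm_triangle_ineq4[of z' z] \<rho>(1)[OF p] \<rho>(2)[OF z] \<rho>(2)[OF z'] by (auto simp: h_def)
      have "\<bar>?b - ?a\<bar> \<le> 2 * (norm (p - z) * norm h) + norm h * norm h"
      proof -
        have "0 \<le> (norm h)\<^sup>2" by simp
        then show ?thesis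
          unfolding ba using Cauchy_Schwarz_ineq2[of "p - z" h] by (simp only: power2_eq_square abs_le_iff) linarith
      qed
      also have "\<dots> = (2 * norm (p - z) + norm h) * norm h" by (simp add: algebra_simps)
      also have "\<dots> \<le> (6 * \<rho>) * norm h" using nz by (intro mult_right_mono) auto
      finally have "(?b - ?a)\<^sup>2 \<le> ((6 * \<rho>) * norm h)\<^sup>2" by (metis abs_ge_zero power2_abs power_mono)
      then have b2: "(?b - ?a)\<^sup>2 \<le> (6 * \<rho>)\<^sup>2 * (norm h)\<^sup>2" by (simp add: power_mult_distrib)
      have ma: "0 \<le> max 0 ?a" "max 0 ?a \<le> \<epsilon>\<^sup>2" by (auto simp: max_def)
      have "R p = (sq_pos ?b - sq_pos ?a - 2 * max 0 ?a * (?b - ?a)) - 2 * max 0 ?a * (norm h)\<^sup>2"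
        unfolding R_def bump_def l_def ba by (simp add: algebra_simps)
      then have "\<bar>R p\<bar> \<le> (?b - ?a)\<^sup>2 + 2 * max 0 ?a * (norm h)\<^sup>2"
        using sq_pos_remainder[of ?b ?a] ma(1) abs_triangle_ineq4[of "sq_pos ?b - sq_pos ?a - 2 * max 0 ?a * (?b - ?a)" "2 * max 0 ?a * (norm h)\<^sup>2"]
        by (simp add: abs_mult)
      also have "\<dots> \<le> (6 * \<rho>)\<^sup>2 * (norm h)\<^sup>2 + 2 * \<epsilon>\<^sup>2 * (norm h)\<^sup>2"
        using b2 ma(2) by (intro add_mono mult_right_mono) auto
      finally have "\<bar>R p\<bar> \<le> C * (norm h)\<^sup>2" by (simp add: C_def distrib_right)
      then show "\<bar>v p * R p\<bar> \<le> C * (norm h)\<^sup>2 * \<bar>v p\<bar>"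
        using mult_right_mono[of "\<bar>R p\<bar>" "C * (norm h)\<^sup>2" "\<bar>v p\<bar>"] by (simp add: abs_mult mult.commute[of "\<bar>v p\<bar>"])
    qed (rule int)
    ultimately show ?thesis by (simp add: I_def h_def mult.commute mult.left_commute)
  qed
  have "W x = W y" by (rule quadratic_variation_imp_constant[OF S(1) quad xy])
  then show ?thesis by (simp add: W_def)
qed

lemma bump_integral_pos:
  fixes z :: "'a::euclidean_space"
  assumes \<Omega>: "open \<Omega>" "bounded \<Omega>" and \<epsilon>: "0 < \<epsilon>" and z: "cball z \<epsilon> \<subseteq> \<Omega>"
  shows "0 < (\<integral>p. bump \<epsilon> z p \<partial>lebesgue_on \<Omega>)"
proof -
  let ?c = "((3 * \<epsilon>\<^sup>2 / 4)\<^sup>2) :: real"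
  interpret finite_measure "lebesgue_on \<Omega>" by (rule finite_measure_lebesgue_bounded_open[OF \<Omega>])
  have ball: "ball z (\<epsilon>/2) \<subseteq> \<Omega>" using z \<epsilon> by (auto simp: subset_iff)
  have bs: "ball z (\<epsilon>/2) \<in> sets (lebesgue_on \<Omega>)"
    using \<Omega>(1) ball by (subst sets_restrict_space_iff) auto
  have m: "measure (lebesgue_on \<Omega>) (ball z (\<epsilon>/2)) = measure lebesgue (ball z (\<epsilon>/2))"
    using \<Omega>(1) ball by (intro measure_restrict_space) auto
  have "0 < ?c * measure (lebesgue_on \<Omega>) (ball z (\<epsilon>/2))"
    unfolding m using \<epsilon> content_ball_pos[of "\<epsilon>/2" z] by simp
  also have "\<dots> = (\<integral>p. ?c * indicator (ball z (\<epsilon>/2)) p \<partial>lebesgue_on \<Omega>)"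
    using bs ball by (simp add: Int_absorb2)
  also have "\<dots> \<le> (\<integral>p. bump \<epsilon> z p \<partial>lebesgue_on \<Omega>)"
  proof (rule integral_mono)
    show "integrable (lebesgue_on \<Omega>) (\<lambda>p. ?c * indicator (ball z (\<epsilon>/2)) p)"
      using bs by (intro integrable_mult_right integrable_real_indicator) (auto simp: less_top[symmetric])
    show "integrable (lebesgue_on \<Omega>) (\<lambda>p. bump \<epsilon> z p)"
      by (intro integrable_continuous_closure \<Omega> continuous_bump)
    fix p
    have "?c \<le> bump \<epsilon> z p" if "p \<in> ball z (\<epsilon>/2)"
    proof -
      have "norm (p - z) \<le> \<epsilon> / 2" using that by (simp add: dist_norm norm_minus_commute)
      then have "(norm (p - z))\<^sup>2 \<le> (\<epsilon>/2)\<^sup>2" by (intro power_mono) auto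
      then have "3 * \<epsilon>\<^sup>2 / 4 \<le> max 0 (\<epsilon>\<^sup>2 - (p - z) \<bullet> (p - z))"
        unfolding power2_norm_eq_inner power_divide by (intro max.coboundedI2) simp
      then show ?thesis unfolding bump_def sq_pos_def by (intro power_mono) auto
    qed
    then show "?c * indicator (ball z (\<epsilon>/2)) p \<le> bump \<epsilon> z p"
      using bump_nonneg[of \<epsilon> z p] by (auto split: split_indicator)
  qed
  finally show ?thesis .
qed

text \<open>Near a point all averages of \<open>v\<close> over bumps of a fixed small radius
  coincide. Each is close to the value of \<open>v\<close> at the centre of the bump, so
  \<open>v\<close> is locally constant.\<close>

theorem zero_weak_gradient_imp_constant:
  fixes v :: "'a::euclidean_space \<Rightarrow> real"
  assumes \<Omega>: "open \<Omega>" "bounded \<Omega>" "connected \<Omega>" and v: "continuous_on (closure \<Omega>) v"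
    and weak: "\<And>\<phi> D. C1_test_function \<Omega> \<phi> D \<Longrightarrow> (\<integral>x. v x *\<^sub>R D x \<partial>lebesgue_on \<Omega>) = 0"
  shows "v constant_on \<Omega>"
proof (rule locally_constant_imp_constant[OF \<Omega>(3)])
  fix a assume a: "a \<in> \<Omega>"
  obtain r0 where "0 < r0" "cball a r0 \<subseteq> \<Omega>" using \<Omega>(1) a open_contains_cball by blast
  define r where "r = r0 / 2"
  have r: "0 < r" "cball a (2 * r) \<subseteq> \<Omega>" using \<open>0 < r0\<close> \<open>cball a r0 \<subseteq> \<Omega>\<close> by (auto simp: r_def)
  have one: "(\<integral>x. (1::real) *\<^sub>R D x \<partial>lebesgue_on \<Omega>) = 0" if "C1_test_function \<Omega> \<phi> D" for \<phi> D
  proof -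
    have "H1_with_gradient \<Omega> (\<lambda>_. 1) (\<lambda>_. 0)" by (rule H1_with_gradient_C1[OF \<Omega>(1,2)]) (auto simp: GDERIV_const)
    then show ?thesis using that by (auto simp: H1_with_gradient_def)
  qed
  have "v y = v a" if y: "y \<in> ball a r" for y
  proof (rule ccontr)
    assume "v y \<noteq> v a"
    \<comment> \<open>Two averages that agree and differ from \<open>v y\<close> and \<open>v
      a\<close> by at most \<open>\<delta>\<close> each force \<open>3 \<delta> \<le> 2
      \<delta>\<close>.\<close>
    define \<delta> where "\<delta> = \<bar>v y - v a\<bar> / 3"
    have \<delta>: "0 < \<delta>" using \<open>v y \<noteq> v a\<close> by (simp add: \<delta>_def)
    have "y \<in> cball a (2 * r)" "a \<in> cball a (2 * r)" using y r by auto
    then have "y \<in> \<Omega>" using r by blast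
    have cv: "isCont v p" if "p \<in> \<Omega>" for p
      using continuous_on_subset[OF v closure_subset] \<Omega>(1) that by (simp add: continuous_on_eq_continuous_at)
    obtain d1 where d1: "0 < d1" "\<And>p. dist p y < d1 \<Longrightarrow> \<bar>v p - v y\<bar> < \<delta>"
      using cv[OF \<open>y \<in> \<Omega>\<close>] \<delta> unfolding continuous_at_eps_delta dist_real_def by blast
    obtain d2 where d2: "0 < d2" "\<And>p. dist p a < d2 \<Longrightarrow> \<bar>v p - v a\<bar> < \<delta>"
      using cv[OF a] \<delta> unfolding continuous_at_eps_delta dist_real_def by blast
    define \<epsilon> where "\<epsilon> = min r (min d1 d2)"
    have \<epsilon>: "0 < \<epsilon>" "\<epsilon> \<le> r" "\<epsilon> \<le> d1" "\<epsilon> \<le> d2" using r d1 d2 by (auto simp: \<epsilon>_def)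
    have sub: "cball z \<epsilon> \<subseteq> \<Omega>" if "z \<in> ball a r" for z
    proof -
      have "cball z \<epsilon> \<subseteq> cball a (2 * r)" using that \<epsilon> by (auto simp: cball_subset_cball_iff dist_commute)
      then show ?thesis using r by blast
    qed
    have ay: "a \<in> ball a r" using r by simp
    define V where "V = (\<integral>p. bump \<epsilon> y p \<partial>lebesgue_on \<Omega>)"
    have V: "0 < V" unfolding V_def by (rule bump_integral_pos[OF \<Omega>(1,2) \<epsilon>(1) sub[OF y]])
    have V2: "V = (\<integral>p. bump \<epsilon> a p \<partial>lebesgue_on \<Omega>)"
      using bump_average_constant[OF \<Omega>(1,2) _ one convex_ball bounded_ball sub \<epsilon>(1) y ay]
      by (simp add: V_def)
    define W where "W = (\<integral>p. v p * bump \<epsilon> y p \<partial>lebesgue_on \<Omega>)"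
    have W2: "W = (\<integral>p. v p * bump \<epsilon> a p \<partial>lebesgue_on \<Omega>)"
      unfolding W_def by (rule bump_average_constant[OF \<Omega>(1,2) v weak convex_ball bounded_ball sub \<epsilon>(1) y ay])
    have close: "\<bar>(\<integral>p. v p * bump \<epsilon> z p \<partial>lebesgue_on \<Omega>) - v z * (\<integral>p. bump \<epsilon> z p \<partial>lebesgue_on \<Omega>)\<bar> \<le> \<delta> * (\<integral>p. bump \<epsilon> z p \<partial>lebesgue_on \<Omega>)"
      if z: "\<And>p. dist p z < \<epsilon> \<Longrightarrow> \<bar>v p - v z\<bar> \<le> \<delta>" for z
    proof -
      have int: "integrable (lebesgue_on \<Omega>) (\<lambda>p. v p * bump \<epsilon> z p)" "integrable (lebesgue_on \<Omega>) (\<lambda>p. v z * bump \<epsilon> z p)"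
        "integrable (lebesgue_on \<Omega>) (\<lambda>p. \<delta> * bump \<epsilon> z p)"
        by (intro integrable_continuous_closure \<Omega> continuous_intros v continuous_bump)+
      have "(\<integral>p. v p * bump \<epsilon> z p \<partial>lebesgue_on \<Omega>) - v z * (\<integral>p. bump \<epsilon> z p \<partial>lebesgue_on \<Omega>)
          = (\<integral>p. v p * bump \<epsilon> z p - v z * bump \<epsilon> z p \<partial>lebesgue_on \<Omega>)" using int by simp
      also have "\<bar>\<dots>\<bar> \<le> (\<integral>p. \<bar>v p * bump \<epsilon> z p - v z * bump \<epsilon> z p\<bar> \<partial>lebesgue_on \<Omega>)" by (rule integral_abs_bound)
      also have "\<dots> \<le> (\<integral>p. \<delta> * bump \<epsilon> z p \<partial>lebesgue_on \<Omega>)"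
      proof (rule integral_mono)
        show "integrable (lebesgue_on \<Omega>) (\<lambda>p. \<bar>v p * bump \<epsilon> z p - v z * bump \<epsilon> z p\<bar>)" using int by simp
        fix p
        show "\<bar>v p * bump \<epsilon> z p - v z * bump \<epsilon> z p\<bar> \<le> \<delta> * bump \<epsilon> z p"
        proof (cases "dist p z < \<epsilon>")
          case True
          then show ?thesis using z[OF True] bump_nonneg[of \<epsilon> z p]
            by (metis abs_mult abs_of_nonneg left_diff_distrib mult_right_mono)
        next
          case False
          then show ?thesis using bump_outside[OF \<epsilon>(1), of p z] by (simp add: dist_norm)
        qed
      qed (rule int)
      finally show ?thesis by simp
    qed
    have "\<bar>W - v y * V\<bar> \<le> \<delta> * V" unfolding W_def V_def by (rule close) (use d1 \<epsilon> in \<open>force intro: less_imp_le\<close>)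
    moreover have "\<bar>W - v a * V\<bar> \<le> \<delta> * V" unfolding W2 V2 by (rule close) (use d2 \<epsilon> in \<open>force intro: less_imp_le\<close>)
    ultimately have "\<bar>v y * V - v a * V\<bar> \<le> 2 * \<delta> * V" by linarith
    then have "\<bar>v y - v a\<bar> * V \<le> (2 * \<delta>) * V" using V by (simp add: left_diff_distrib[symmetric] abs_mult)
    then have "\<bar>v y - v a\<bar> \<le> 2 * \<delta>" using V by simp
    then show False using \<delta> by (simp add: \<delta>_def)
  qed
  moreover have br: "ball a r \<subseteq> \<Omega>"
  proof -
    have "ball a r \<subseteq> cball a (2 * r)" using r by (auto simp: subset_iff)
    then show ?thesis using r by blast
  qed
  ultimately show "\<exists>T. openin (top_of_set \<Omega>) T \<and> a \<in> T \<and> (\<forall>x\<in>T. v x = v a)"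
  proof (intro exI[of _ "ball a r"] conjI)
    show "openin (top_of_set \<Omega>) (ball a r)"
      using \<Omega>(1) br by (simp add: openin_open_eq)
    show "a \<in> ball a r" using r by simp
  qed simp
qed

section \<open>Oscillation from an explicit solution\<close>

lemma hoelder_on_continuous: "hoelder_on S u \<Longrightarrow> continuous_on S u"
proof -
  assume "hoelder_on S u"
  then obtain \<alpha> C where \<alpha>: "0 < \<alpha>" and C: "\<And>x y. x \<in> S \<Longrightarrow> y \<in> S \<Longrightarrow> \<bar>u x - u y\<bar> \<le> C * dist x y powr \<alpha>"
    unfolding hoelder_on_def by blast
  show ?thesis unfolding continuous_on_iff
  proof (intro ballI allI impI)
    fix x and e :: real assume x: "x \<in> S" and e: "0 < e"
    define d where "d = (e / (\<bar>C\<bar> + 1)) powr (1 / \<alpha>)"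
    have d: "0 < d" using e by (simp add: d_def)
    have "dist (u y) (u x) < e" if y: "y \<in> S" "dist y x < d" for y
    proof -
      have "dist y x powr \<alpha> < d powr \<alpha>" using y \<alpha> by (intro powr_less_mono2) auto
      also have "d powr \<alpha> = e / (\<bar>C\<bar> + 1)" using \<alpha> e by (simp add: d_def powr_powr)
      finally have p: "dist y x powr \<alpha> < e / (\<bar>C\<bar> + 1)" .
      have "\<bar>u y - u x\<bar> \<le> C * dist y x powr \<alpha>" using C x y by blast
      also have "\<dots> \<le> (\<bar>C\<bar> + 1) * dist y x powr \<alpha>" by (intro mult_right_mono) auto
      also have "\<dots> < (\<bar>C\<bar> + 1) * (e / (\<bar>C\<bar> + 1))" using p by (intro mult_strict_left_mono) auto
      also have "\<dots> = e" by (simp add: nonzero_eq_divide_eq[symmetric] add_nonneg_eq_0_iff)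
      finally show ?thesis by (simp add: dist_real_def)
    qed
    then show "\<exists>d>0. \<forall>x'\<in>S. dist x' x < d \<longrightarrow> dist (u x') (u x) < e" using d by blast
  qed
qed

lemma sets_surface_measure: "sets (surface_measure (\<Omega>::'a::euclidean_space set)) = sets (restrict_space borel (frontier \<Omega>))"
  unfolding surface_measure_def by (rule sets_restrict_space_cong) simp

lemma space_surface_measure [simp]: "space (surface_measure \<Omega>) = frontier \<Omega>"
  by (simp add: surface_measure_def space_restrict_space)

lemma surface_measurable_continuous:
  assumes "continuous_on (frontier \<Omega>) f"
  shows "f \<in> borel_measurable (surface_measure (\<Omega>::'a::euclidean_space set))"
  using borel_measurable_continuous_on_restrict[OF assms]
  by (subst measurable_cong_sets[OF sets_surface_measure refl])

lemma surface_square_integrable_continuous: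
  fixes f :: "'a::euclidean_space \<Rightarrow> real"
  assumes fin: "finite_measure (surface_measure \<Omega>)" and \<Omega>: "bounded \<Omega>" and f: "continuous_on (closure \<Omega>) f"
  shows "square_integrable (surface_measure \<Omega>) f" "integrable (surface_measure \<Omega>) f"
proof -
  interpret finite_measure "surface_measure \<Omega>" by (rule fin)
  have cf: "continuous_on (frontier \<Omega>) f" using f by (rule continuous_on_subset) (simp add: frontier_def)
  have "compact (frontier \<Omega>)" using \<Omega> by (rule compact_frontier_bounded)
  then have "bounded (f ` frontier \<Omega>)" using compact_continuous_image[OF cf] compact_imp_bounded by blast
  then obtain B where B: "\<And>x. x \<in> frontier \<Omega> \<Longrightarrow> \<bar>f x\<bar> \<le> B" unfolding bounded_iff by fastforce
  have [measurable]: "f \<in> borel_measurable (surface_measure \<Omega>)" by (rule surface_measurable_continuous[OF cf])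
  have "integrable (surface_measure \<Omega>) (\<lambda>x. (norm (f x))\<^sup>2)"
  proof (rule integrable_const_bound[where B="B\<^sup>2"])
    show "AE x in surface_measure \<Omega>. norm ((norm (f x))\<^sup>2) \<le> B\<^sup>2"
      using B by (intro AE_I2) (auto simp: abs_le_square_iff[symmetric] intro: order_trans[OF _ abs_ge_self])
  qed measurable
  then show sq: "square_integrable (surface_measure \<Omega>) f" by (simp add: square_integrable_def)
  then show "integrable (surface_measure \<Omega>) f" by (rule square_integrable_integrable)
qed

text \<open>An explicit candidate \<open>u\<close> with gradient \<open>g\<close> controls the
  oscillation as soon as the Gauss-Green identity holds for functions continuous up to the
  boundary, with any constant \<open>\<kappa>\<close>: the test function \<open>1\<close> shows
  that \<open>\<kappa>\<close> is the quotient of volume and perimeter. In particular rescaling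
  the surface measure changes nothing. The identity extends to all traces by the density built
  into their definition, so a shift of \<open>u\<close> solves the Neumann problem. The chosen
  solution differs from it by a constant, because the difference of two solutions is an
  admissible test function, and testing the difference of the equations with it shows that its
  gradient vanishes.\<close>

theorem boundary_oscillation_le:
  fixes \<Omega> :: "'a::euclidean_space set"
  assumes \<Omega>: "open \<Omega>" "bounded \<Omega>" "connected \<Omega>" "\<Omega> \<noteq> {}"
    and fin: "finite_measure (surface_measure \<Omega>)"
    and u: "hoelder_on (closure \<Omega>) u" "H1_with_gradient \<Omega> u g"
    and div: "\<And>f D. H1_with_gradient \<Omega> f D \<Longrightarrow> continuous_on (closure \<Omega>) f \<Longrightarrow>
      (\<integral>x. g x \<bullet> D x \<partial>lebesgue_on \<Omega>) = (\<integral>x. f x \<partial>lebesgue_on \<Omega>) - \<kappa> * (\<integral>x. f x \<partial>surface_measure \<Omega>)"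
    and osc: "\<And>x y. x \<in> frontier \<Omega> \<Longrightarrow> y \<in> frontier \<Omega> \<Longrightarrow> \<bar>u x - u y\<bar> \<le> B"
  shows "0 \<le> boundary_oscillation \<Omega>" "boundary_oscillation \<Omega> \<le> B"
proof -
  let ?L = "lebesgue_on \<Omega>" and ?S = "surface_measure \<Omega>"
  interpret S: finite_measure ?S by (rule fin)
  interpret L: finite_measure ?L by (rule finite_measure_lebesgue_bounded_open[OF \<Omega>(1,2)])
  have H1_const: "H1_with_gradient \<Omega> (\<lambda>_. c) (\<lambda>_. 0)" for c
    by (rule H1_with_gradient_C1[OF \<Omega>(1,2)]) (auto simp: GDERIV_const)
  have vol: "measure ?L \<Omega> = measure lebesgue \<Omega>" using \<Omega>(1) by (intro measure_restrict_space) auto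
  have lm: "\<Omega> \<in> lmeasurable" using \<Omega> by (simp add: lmeasurable_open)
  have vol_pos: "0 < measure lebesgue \<Omega>"
    using lm \<Omega> by (metis negligible_iff_measure open_not_negligible zero_less_measure_iff)
  have "0 = measure lebesgue \<Omega> - \<kappa> * perimeter \<Omega>"
    using div[OF H1_const[of 1]] vol unfolding perimeter_def by simp
  then have \<kappa>P: "\<kappa> * perimeter \<Omega> = measure lebesgue \<Omega>" by simp
  then have P: "perimeter \<Omega> \<noteq> 0" using vol_pos by auto
  have \<kappa>: "\<kappa> = measure lebesgue \<Omega> / perimeter \<Omega>" using \<kappa>P P by (simp add: field_simps)
  have cu: "continuous_on (closure \<Omega>) u" using u(1) by (rule hoelder_on_continuous)
  have sqL1: "square_integrable ?L (\<lambda>_. 1::real)" and sqS1: "square_integrable ?S (\<lambda>_. 1::real)"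
    by (rule L.square_integrable_const S.square_integrable_const)+
  have weak: "(\<integral>x. g x \<bullet> h x \<partial>?L) = (\<integral>x. \<phi> x \<partial>?L) - \<kappa> * (\<integral>x. \<tau> x \<partial>?S)"
    if tr: "H1_with_trace \<Omega> \<phi> h \<tau>" for \<phi> h \<tau>
  proof -
    obtain f D where fD: "\<And>j. H1_with_gradient \<Omega> (f j) (D j)" "\<And>j. continuous_on (closure \<Omega>) (f j)"
      and conv: "L2_converges ?L f \<phi>" "L2_converges ?L D h" "L2_converges ?S f \<tau>"
      using tr unfolding H1_with_trace_def by blast
    have sq: "square_integrable ?L \<phi>" "square_integrable ?L h" "square_integrable ?S \<tau>" "square_integrable ?L g"
      "\<And>j. square_integrable ?L (f j)" "\<And>j. square_integrable ?L (D j)" "\<And>j. square_integrable ?S (f j)"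
      using tr u(2) fD surface_square_integrable_continuous[OF fin \<Omega>(2)]
      unfolding H1_with_trace_def H1_with_gradient_def by blast+
    have 1: "(\<lambda>j. \<integral>x. g x \<bullet> D j x \<partial>?L) \<longlonglongrightarrow> (\<integral>x. g x \<bullet> h x \<partial>?L)"
      by (rule L2_limit_inner) (use sq conv in auto)
    have 2: "(\<lambda>j. \<integral>x. f j x \<partial>?L) \<longlonglongrightarrow> (\<integral>x. \<phi> x \<partial>?L)"
      using L2_limit_inner[OF sqL1 sq(5) sq(1) conv(1)] by simp
    have 3: "(\<lambda>j. \<integral>x. f j x \<partial>?S) \<longlonglongrightarrow> (\<integral>x. \<tau> x \<partial>?S)"
      using L2_limit_inner[OF sqS1 sq(7) sq(3) conv(3)] by simp
    have "(\<lambda>j. \<integral>x. g x \<bullet> D j x \<partial>?L) \<longlonglongrightarrow> (\<integral>x. \<phi> x \<partial>?L) - \<kappa> * (\<integral>x. \<tau> x \<partial>?S)"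
      unfolding div[OF fD] by (intro tendsto_intros 2 3)
    from LIMSEQ_unique[OF 1 this] show ?thesis .
  qed
  \<comment> \<open>The shift that realises the normalisation of the boundary integral.\<close>
  define m where "m = (\<integral>x. u x \<partial>?S) / perimeter \<Omega>"
  have "neumann_solution \<Omega> (\<lambda>x. u x - m)"
    unfolding neumann_solution_def
  proof (intro conjI exI[of _ g] allI impI)
    show "hoelder_on (closure \<Omega>) (\<lambda>x. u x - m)" using u(1) by (simp add: hoelder_on_def)
    show "(\<integral>x. u x - m \<partial>?S) = 0"
      using surface_square_integrable_continuous(2)[OF fin \<Omega>(2) cu] P
      by (simp add: m_def perimeter_def)
    show "H1_with_gradient \<Omega> (\<lambda>x. u x - m) g"
      using H1_with_gradient_diff[OF \<Omega>(1,2) u(2) H1_const[of m]] by simp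
  qed (use weak \<kappa> in simp)
  then have sol: "neumann_solution \<Omega> (u_sol \<Omega>)" unfolding u_sol_def by (rule someI[where P="neumann_solution \<Omega>"])
  define U where "U = u_sol \<Omega>"
  obtain gU where gU: "H1_with_gradient \<Omega> U gU"
    "\<And>\<phi> h \<tau>. H1_with_trace \<Omega> \<phi> h \<tau> \<Longrightarrow> (\<integral>x. gU x \<bullet> h x \<partial>?L) = (\<integral>x. \<phi> x \<partial>?L) - \<kappa> * (\<integral>x. \<tau> x \<partial>?S)"
    using sol \<kappa> unfolding neumann_solution_def U_def by auto
  have cU: "continuous_on (closure \<Omega>) U" using sol unfolding neumann_solution_def U_def by (auto intro: hoelder_on_continuous)
  define v where "v x = U x - u x" for x
  define e where "e x = gU x - g x" for x
  have v: "H1_with_gradient \<Omega> v e" unfolding v_def e_def by (rule H1_with_gradient_diff[OF \<Omega>(1,2) gU(1) u(2)])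
  have cv: "continuous_on (closure \<Omega>) v" unfolding v_def by (intro continuous_intros cU cu)
  have "H1_with_trace \<Omega> v e v"
    unfolding H1_with_trace_def
  proof (intro conjI exI[of _ "\<lambda>_. v"] exI[of _ "\<lambda>_. e"] allI)
    show "square_integrable ?S v" by (rule surface_square_integrable_continuous[OF fin \<Omega>(2) cv])
  qed (use v cv in \<open>auto simp: L2_converges_def\<close>)
  from gU(2)[OF this] weak[OF this] have eq: "(\<integral>x. gU x \<bullet> e x \<partial>?L) = (\<integral>x. g x \<bullet> e x \<partial>?L)" by simp
  have sq: "square_integrable ?L e" "square_integrable ?L gU" "square_integrable ?L g"
    using v gU(1) u(2) by (auto simp: H1_with_gradient_def)
  have "(\<integral>x. (norm (e x))\<^sup>2 \<partial>?L) = (\<integral>x. gU x \<bullet> e x - g x \<bullet> e x \<partial>?L)"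
    by (simp add: e_def power2_norm_eq_inner inner_diff_left)
  also have "\<dots> = 0" using eq square_integrable_inner[OF sq(2,1)] square_integrable_inner[OF sq(3,1)] by simp
  finally have "AE x in ?L. (norm (e x))\<^sup>2 = 0"
    using sq(1) by (subst (asm) integral_nonneg_eq_0_iff_AE) (auto simp: square_integrable_def)
  then have e0: "AE x in ?L. e x = 0" by eventually_elim simp
  have "v constant_on \<Omega>"
  proof (rule zero_weak_gradient_imp_constant[OF \<Omega>(1-3) cv])
    fix \<phi> D assume \<phi>: "C1_test_function \<Omega> \<phi> D"
    have "(\<integral>x. \<phi> x *\<^sub>R e x \<partial>?L) = 0" by (rule integral_eq_zero_AE) (use e0 in eventually_elim, simp)
    then show "(\<integral>x. v x *\<^sub>R D x \<partial>?L) = 0" using v \<phi> by (simp add: H1_with_gradient_def)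
  qed
  then obtain c where c: "\<And>x. x \<in> \<Omega> \<Longrightarrow> v x = c" unfolding constant_on_def by blast
  have vc: "v x = c" if "x \<in> closure \<Omega>" for x
    by (rule continuous_constant_on_closure[OF cv c that])
  have fr: "frontier \<Omega> \<subseteq> closure \<Omega>" by (simp add: frontier_def)
  have oscU: "U x \<le> U y + B" if "x \<in> frontier \<Omega>" "y \<in> frontier \<Omega>" for x y
  proof -
    have "U x - u x = c" "U y - u y = c" using vc that fr unfolding v_def by blast+
    then show ?thesis using osc[OF that] by linarith
  qed
  have ne: "frontier \<Omega> \<noteq> {}" using P by (auto simp: perimeter_def)
  then obtain p where p: "p \<in> frontier \<Omega>" by blast
  have bdd: "bdd_above (U ` frontier \<Omega>)" "bdd_below (U ` frontier \<Omega>)"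
    using oscU p by (auto intro!: bdd_aboveI2[of _ _ "U p + B"] bdd_belowI2[of _ "U p - B"]) (smt (verit) oscU p)
  have "U p \<le> (SUP x\<in>frontier \<Omega>. U x)" "(INF x\<in>frontier \<Omega>. U x) \<le> U p"
    using p bdd by (auto intro: cSUP_upper cINF_lower)
  then show "0 \<le> boundary_oscillation \<Omega>" by (simp add: boundary_oscillation_def U_def)
  have "(SUP x\<in>frontier \<Omega>. U x) \<le> (INF y\<in>frontier \<Omega>. U y) + B"
  proof (rule cSUP_least[OF ne])
    fix x assume x: "x \<in> frontier \<Omega>"
    have "U x - B \<le> (INF y\<in>frontier \<Omega>. U y)" using oscU[OF x] by (intro cINF_greatest[OF ne]) (simp add: algebra_simps)
    then show "U x \<le> (INF y\<in>frontier \<Omega>. U y) + B" by simp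
  qed
  then show "boundary_oscillation \<Omega> \<le> B" by (simp add: boundary_oscillation_def U_def)
qed

section \<open>Boxes\<close>

lemma continuous_on_set_integral_param:
  fixes h :: "real \<Rightarrow> 'a::euclidean_space \<Rightarrow> real" and M :: "'a measure"
  assumes sets [measurable_cong]: "sets M = sets borel" and T: "compact T" and Q: "compact Q" and fin: "emeasure M Q < top"
    and h: "continuous_on (T \<times> Q) (\<lambda>(t, y). h t y)"
  shows "continuous_on T (\<lambda>t. \<integral>y. indicator Q y *\<^sub>R h t y \<partial>M)"
    and "\<And>t. t \<in> T \<Longrightarrow> integrable M (\<lambda>y. indicator Q y *\<^sub>R h t y)"
proof -
  have [measurable]: "Q \<in> sets borel" using Q by (simp add: borel_compact)
  have QM: "Q \<in> sets M" by (simp add: sets)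
  have ch: "continuous_on Q (h t)" if "t \<in> T" for t
    using continuous_on_compose2[OF h, of Q "\<lambda>y. (t, y)"] that continuous_on_Pair[OF continuous_on_const continuous_on_id, of Q t]
    by (auto simp: image_subset_iff)
  have meas: "(\<lambda>y. indicator Q y *\<^sub>R h t y) \<in> borel_measurable M" if "t \<in> T" for t
    using borel_measurable_continuous_on_indicator[OF \<open>Q \<in> sets borel\<close> ch[OF that]]
    by (simp add: measurable_cong_sets[OF sets refl])
  have "bounded ((\<lambda>(t, y). h t y) ` (T \<times> Q))"
    using compact_continuous_image[OF h compact_Times[OF T Q]] compact_imp_bounded by blast
  then obtain B where B: "\<And>t y. t \<in> T \<Longrightarrow> y \<in> Q \<Longrightarrow> \<bar>h t y\<bar> \<le> B" unfolding bounded_iff by fastforce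
  have intB: "integrable M (\<lambda>y. B * indicator Q y)"
    using fin QM by (intro integrable_mult_right integrable_real_indicator) auto
  have bound: "AE y in M. norm (indicator Q y *\<^sub>R h t y) \<le> B * indicator Q y" if "t \<in> T" for t
    using B[OF that] by (intro AE_I2) (auto split: split_indicator)
  show "integrable M (\<lambda>y. indicator Q y *\<^sub>R h t y)" if "t \<in> T" for t
    using intB meas[OF that]
  proof (rule Bochner_Integration.integrable_bound)
    show "AE y in M. norm (indicator Q y *\<^sub>R h t y) \<le> norm (B * indicator Q y)"
      using bound[OF that] by eventually_elim (metis abs_ge_self order_trans real_norm_def)
  qed
  show "continuous_on T (\<lambda>t. \<integral>y. indicator Q y *\<^sub>R h t y \<partial>M)"
    unfolding continuous_on_sequentially
  proof (intro allI ballI impI)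
    fix x a assume xa: "a \<in> T" "(\<forall>n. x n \<in> T) \<and> x \<longlonglongrightarrow> a"
    show "((\<lambda>t. \<integral>y. indicator Q y *\<^sub>R h t y \<partial>M) \<circ> x) \<longlonglongrightarrow> (\<integral>y. indicator Q y *\<^sub>R h a y \<partial>M)"
      unfolding o_def
    proof (rule integral_dominated_convergence)
      show "AE y in M. (\<lambda>n. indicator Q y *\<^sub>R h (x n) y) \<longlonglongrightarrow> indicator Q y *\<^sub>R h a y"
      proof (rule AE_I2)
        fix y
        show "(\<lambda>n. indicator Q y *\<^sub>R h (x n) y) \<longlonglongrightarrow> indicator Q y *\<^sub>R h a y"
        proof (cases "y \<in> Q")
          case True
          have "(\<lambda>n. (x n, y)) \<longlonglongrightarrow> (a, y)" using xa by (intro tendsto_intros) auto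
          then have "(\<lambda>n. case (x n, y) of (t, y) \<Rightarrow> h t y) \<longlonglongrightarrow> (case (a, y) of (t, y) \<Rightarrow> h t y)"
            using h[unfolded continuous_on_sequentially, rule_format, of "(a, y)" "\<lambda>n. (x n, y)"] xa True
            by (simp add: o_def)
          then show ?thesis using True by simp
        qed simp
      qed
      show "AE y in M. norm (indicator Q y *\<^sub>R h (x n) y) \<le> B * indicator Q y" for n
        by (rule bound) (use xa in blast)
    qed (use xa meas intB in auto)
  qed
qed

text \<open>By slicing in the direction \<open>i\<close>, the Lebesgue measure of the hyperplane
  \<open>x \<bullet> j = t\<close>, which is zero, is the product of the area of its trace on
  \<open>x \<bullet> i = 0\<close> with the infinite length of a line.\<close>

lemma codim_two_null:
  fixes i j :: "'a::euclidean_space"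
  assumes i: "i \<in> Basis" and j: "j \<in> Basis" and ij: "i \<noteq> j"
  shows "hausdorff_outer (DIM('a) - 1) {x. x \<bullet> i = s \<and> x \<bullet> j = t} = 0"
proof -
  obtain c :: real where c: "0 < c"
    "\<And>i::'a. i \<in> Basis \<Longrightarrow> distr (plane_measure i \<Otimes>\<^sub>M lborel) borel (\<lambda>(y, t). y + t *\<^sub>R i) = density lborel (\<lambda>_. ennreal c)"
    using hausdorff_slicing by blast
  interpret P: sigma_finite_measure "plane_measure i" by (rule sigma_finite_plane_measure[OF i])
  interpret pair_sigma_finite "plane_measure i" lborel ..
  let ?H = "{x::'a. x \<bullet> j = t}"
  have [measurable]: "?H \<in> sets borel" by (rule hyperplane_borel)
  have "negligible ?H" using negligible_hyperplane[of j t] j by (auto simp: inner_commute)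
  then have "emeasure lborel ?H = 0"
    by (simp add: negligible_iff_emeasure0)
  then have "emeasure (density lborel (\<lambda>_. ennreal c)) ?H = 0"
    by (simp add: emeasure_density nn_integral_cmult_indicator)
  then have "0 = emeasure (distr (plane_measure i \<Otimes>\<^sub>M lborel) borel (\<lambda>(y, t). y + t *\<^sub>R i)) ?H"
    using c(2)[OF i] by simp
  also have "\<dots> = emeasure (plane_measure i \<Otimes>\<^sub>M lborel) ((\<lambda>(y, t). y + t *\<^sub>R i) -` ?H \<inter> space (plane_measure i \<Otimes>\<^sub>M lborel))"
    by (rule emeasure_distr) measurable
  also have "(\<lambda>(y, t). y + t *\<^sub>R i) -` ?H \<inter> space (plane_measure i \<Otimes>\<^sub>M lborel) = ?H \<times> UNIV"
    using i j ij by (auto simp: space_pair_measure inner_add_left inner_Basis)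
  also have "emeasure (plane_measure i \<Otimes>\<^sub>M lborel) (?H \<times> (UNIV :: real set)) = emeasure (plane_measure i) ?H * emeasure lborel (UNIV :: real set)"
    by (rule sigma_finite_measure.emeasure_pair_measure_Times[OF sigma_finite_lborel]) auto
  finally have "emeasure (plane_measure i) ?H = 0"
    by (simp add: ennreal_mult_eq_top_iff emeasure_lborel_UNIV)
  then have 0: "hausdorff_outer (DIM('a) - 1) ({x. x \<bullet> i = 0} \<inter> ?H) = 0"
    by (simp add: emeasure_plane_measure)
  have "(+) (s *\<^sub>R i) ` ({x. x \<bullet> i = 0} \<inter> ?H) = {x. x \<bullet> i = s \<and> x \<bullet> j = t}"
  proof (intro equalityI subsetI)
    fix x assume x: "x \<in> {x. x \<bullet> i = s \<and> x \<bullet> j = t}"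
    then show "x \<in> (+) (s *\<^sub>R i) ` ({x. x \<bullet> i = 0} \<inter> ?H)"
      using i j ij by (intro image_eqI[of _ _ "x - s *\<^sub>R i"]) (auto simp: inner_diff_left inner_Basis)
  qed (use i j ij in \<open>auto simp: inner_add_left inner_Basis\<close>)
  then show ?thesis
    using outer_similarity_image[of 1 "(+) (s *\<^sub>R i)" "DIM('a) - 1" "{x. x \<bullet> i = 0} \<inter> ?H"] 0 by simp
qed

lemma GDERIV_prod_coords:
  fixes \<xi> \<xi>' :: "'a::euclidean_space \<Rightarrow> real \<Rightarrow> real"
  assumes "\<And>j t. j \<in> Basis \<Longrightarrow> DERIV (\<xi> j) t :> \<xi>' j t"
  shows "GDERIV (\<lambda>x. \<Prod>j\<in>Basis. \<xi> j (x \<bullet> j)) x :> (\<Sum>j\<in>Basis. (\<xi>' j (x \<bullet> j) * (\<Prod>k\<in>Basis - {j}. \<xi> k (x \<bullet> k))) *\<^sub>R j)"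
proof -
  have "((\<lambda>x. \<Prod>j\<in>Basis. \<xi> j (x \<bullet> j)) has_derivative (\<lambda>y. \<Sum>j\<in>Basis. (\<xi>' j (x \<bullet> j) * (y \<bullet> j)) * (\<Prod>k\<in>Basis - {j}. \<xi> k (x \<bullet> k)))) (at x)"
  proof (rule has_derivative_prod)
    fix j :: 'a assume j: "j \<in> Basis"
    have "((\<lambda>x. x \<bullet> j) has_derivative (\<lambda>y. y \<bullet> j)) (at x)" by (auto intro!: derivative_eq_intros)
    from has_derivative_compose[OF this assms[OF j, unfolded has_field_derivative_def, of "x \<bullet> j"]]
    show "((\<lambda>x. \<xi> j (x \<bullet> j)) has_derivative (\<lambda>y. \<xi>' j (x \<bullet> j) * (y \<bullet> j))) (at x)" by simp
  qed
  then show ?thesis unfolding gderiv_def by (simp add: inner_sum_right mult.commute mult.left_commute mult.assoc)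
qed

lemma box_test_function:
  fixes l :: "'a::euclidean_space"
  assumes \<xi>: "\<And>j. j \<in> Basis \<Longrightarrow> interval_test (- (l \<bullet> j)) (l \<bullet> j) (\<xi> j) (\<xi>' j)"
  shows "C1_test_function (box (- l) l) (\<lambda>x. \<Prod>j\<in>Basis. \<xi> j (x \<bullet> j))
    (\<lambda>x. \<Sum>j\<in>Basis. (\<xi>' j (x \<bullet> j) * (\<Prod>k\<in>Basis - {j}. \<xi> k (x \<bullet> k))) *\<^sub>R j)"
proof -
  have "\<exists>\<alpha> \<beta>. \<forall>j\<in>Basis. - (l \<bullet> j) < \<alpha> j \<and> \<beta> j < l \<bullet> j \<and> (\<forall>t. t \<notin> {\<alpha> j..\<beta> j} \<longrightarrow> \<xi> j t = 0)"
    using \<xi> unfolding interval_test_def by metis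
  then obtain \<alpha> \<beta> where ab: "\<And>j. j \<in> Basis \<Longrightarrow> - (l \<bullet> j) < \<alpha> j" "\<And>j. j \<in> Basis \<Longrightarrow> \<beta> j < l \<bullet> j"
    "\<And>j t. j \<in> Basis \<Longrightarrow> t \<notin> {\<alpha> j..\<beta> j} \<Longrightarrow> \<xi> j t = 0" by blast
  define p where "p = (\<Sum>j\<in>Basis. \<alpha> j *\<^sub>R j)"
  define q where "q = (\<Sum>j\<in>Basis. \<beta> j *\<^sub>R j)"
  have pq: "p \<bullet> j = \<alpha> j" "q \<bullet> j = \<beta> j" if "j \<in> Basis" for j using that by (simp_all add: p_def q_def)
  have "{x. (\<Prod>j\<in>Basis. \<xi> j (x \<bullet> j)) \<noteq> 0} \<subseteq> cbox p q"
  proof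
    fix x :: 'a assume "x \<in> {x. (\<Prod>j\<in>Basis. \<xi> j (x \<bullet> j)) \<noteq> 0}"
    then have "\<xi> j (x \<bullet> j) \<noteq> 0" if "j \<in> Basis" for j using that by (simp add: prod_zero_iff)
    then have "x \<bullet> j \<in> {\<alpha> j..\<beta> j}" if "j \<in> Basis" for j using ab(3) that by blast
    then show "x \<in> cbox p q" by (simp add: mem_box pq)
  qed
  then have sub: "closure {x. (\<Prod>j\<in>Basis. \<xi> j (x \<bullet> j)) \<noteq> 0} \<subseteq> cbox p q" by (rule closure_minimal) (rule closed_cbox)
  have inb: "cbox p q \<subseteq> box (- l) l"
    using ab(1,2) by (fastforce simp: mem_box pq)
  show ?thesis
    unfolding C1_test_function_def
  proof (intro conjI allI)
    show "compact (closure {x. (\<Prod>j\<in>Basis. \<xi> j (x \<bullet> j)) \<noteq> 0})"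
      by (rule compact_if_closed_subset[OF _ sub]) auto
    show "closure {x. (\<Prod>j\<in>Basis. \<xi> j (x \<bullet> j)) \<noteq> 0} \<subseteq> box (- l) l" using sub inb by blast
    show "GDERIV (\<lambda>x. \<Prod>j\<in>Basis. \<xi> j (x \<bullet> j)) x :> (\<Sum>j\<in>Basis. (\<xi>' j (x \<bullet> j) * (\<Prod>k\<in>Basis - {j}. \<xi> k (x \<bullet> k))) *\<^sub>R j)" for x
      by (rule GDERIV_prod_coords) (use \<xi> in \<open>auto simp: interval_test_def\<close>)
    have c: "continuous_on UNIV (\<lambda>x. \<xi> j (x \<bullet> j))" "continuous_on UNIV (\<lambda>x. \<xi>' j (x \<bullet> j))" if "j \<in> Basis" for j
      using interval_test_continuous[OF \<xi>[OF that], of UNIV] \<xi>[OF that]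
      by (auto simp: interval_test_def intro!: continuous_on_compose2[of UNIV _ UNIV "\<lambda>x. x \<bullet> j"] continuous_intros)
    show "continuous_on UNIV (\<lambda>x. \<Sum>j\<in>Basis. (\<xi>' j (x \<bullet> j) * (\<Prod>k\<in>Basis - {j}. \<xi> k (x \<bullet> k))) *\<^sub>R j)"
      by (intro continuous_intros c) auto
  qed
qed

text \<open>The weak derivative in direction \<open>i\<close> is tested with \<open>\<theta> (x
  \<bullet> i)\<close> times cutoffs in the other coordinates. The partial derivative in
  direction \<open>i\<close> leaves these cutoffs alone, so they may tend to \<open>1\<close> by
  dominated convergence.\<close>

lemma box_weak_direction:
  fixes l :: "'a::euclidean_space"
  assumes l: "\<And>j. j \<in> Basis \<Longrightarrow> 0 < l \<bullet> j" and i: "i \<in> Basis"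
    and f: "H1_with_gradient (box (- l) l) f D" and \<theta>: "interval_test (- (l \<bullet> i)) (l \<bullet> i) \<theta> \<theta>'"
  shows "(\<integral>x. f x * \<theta>' (x \<bullet> i) \<partial>lebesgue_on (box (- l) l)) = - (\<integral>x. \<theta> (x \<bullet> i) * (D x \<bullet> i) \<partial>lebesgue_on (box (- l) l))"
proof -
  let ?\<Omega> = "box (- l) l"
  let ?L = "lebesgue_on ?\<Omega>"
  interpret finite_measure ?L by (rule finite_measure_lebesgue_bounded_open) auto
  have "\<exists>\<eta> \<eta>'. (\<forall>n. interval_test (- (l \<bullet> j)) (l \<bullet> j) (\<eta> n) (\<eta>' n)) \<and> (\<forall>n t. 0 \<le> \<eta> n t \<and> \<eta> n t \<le> 1) \<and>
      (\<forall>t. - (l \<bullet> j) < t \<longrightarrow> t < l \<bullet> j \<longrightarrow> (\<lambda>n::nat. \<eta> n t) \<longlonglongrightarrow> 1)" if "j \<in> Basis" for j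
    by (rule interval_cutoffs[of "- (l \<bullet> j)" "l \<bullet> j"]) (use l[OF that] in auto)
  then obtain \<eta> \<eta>' where \<eta>: "\<And>j n. j \<in> Basis \<Longrightarrow> interval_test (- (l \<bullet> j)) (l \<bullet> j) (\<eta> j n) (\<eta>' j n)"
    "\<And>j n t. j \<in> Basis \<Longrightarrow> 0 \<le> \<eta> j n t \<and> \<eta> j n t \<le> 1"
    "\<And>j t. j \<in> Basis \<Longrightarrow> - (l \<bullet> j) < t \<Longrightarrow> t < l \<bullet> j \<Longrightarrow> (\<lambda>n::nat. \<eta> j n t) \<longlonglongrightarrow> 1"
    by metis
  define \<xi> where "\<xi> n j = (if j = i then \<theta> else \<eta> j n)" for n j
  define \<xi>' where "\<xi>' n j = (if j = i then \<theta>' else \<eta>' j n)" for n j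
  define X where "X n x = (\<Prod>k\<in>Basis - {i}. \<eta> k n (x \<bullet> k))" for n and x :: 'a
  have X_range: "\<bar>X n x\<bar> \<le> 1" for n x
    unfolding X_def abs_prod using \<eta>(2) by (intro prod_le_1) auto
  have X_lim: "(\<lambda>n. X n x) \<longlonglongrightarrow> 1" if "x \<in> ?\<Omega>" for x
  proof -
    have "(\<lambda>n. X n x) \<longlonglongrightarrow> (\<Prod>k\<in>Basis - {i}. 1)" unfolding X_def
      by (intro tendsto_prod \<eta>(3)) (use that in \<open>auto simp: mem_box\<close>)
    then show ?thesis by simp
  qed
  have cX: "continuous_on UNIV (X n)" for n
    unfolding X_def by (intro continuous_intros continuous_on_compose2[OF interval_test_continuous[OF \<eta>(1)]]) auto
  have mL: "h \<in> borel_measurable ?L" if "continuous_on UNIV h" for h :: "'a \<Rightarrow> real"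
    by (intro measurable_restrict_space1 measurable_completion) (use that in \<open>simp add: borel_measurable_continuous_onI\<close>)
  have [measurable]: "X n \<in> borel_measurable ?L" for n by (rule mL[OF cX])
  have c\<theta>: "continuous_on UNIV (\<lambda>x. \<theta> (x \<bullet> i))" "continuous_on UNIV (\<lambda>x. \<theta>' (x \<bullet> i))"
    using interval_test_continuous[OF \<theta>, of UNIV] \<theta>
    by (auto simp: interval_test_def intro!: continuous_on_compose2[of UNIV _ UNIV "\<lambda>x. x \<bullet> i"] continuous_intros)
  have [measurable]: "(\<lambda>x. \<theta> (x \<bullet> i)) \<in> borel_measurable ?L" "(\<lambda>x. \<theta>' (x \<bullet> i)) \<in> borel_measurable ?L"
    by (rule mL, rule c\<theta>)+
  have prod_i: "(\<Prod>j\<in>Basis. \<xi> n j (x \<bullet> j)) = X n x * \<theta> (x \<bullet> i)" for n x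
    using i unfolding X_def by (subst prod.remove[OF _ i]) (auto simp: \<xi>_def intro!: prod.cong)
  have grad_i: "(\<Sum>j\<in>Basis. (\<xi>' n j (x \<bullet> j) * (\<Prod>k\<in>Basis - {j}. \<xi> n k (x \<bullet> k))) *\<^sub>R j) \<bullet> i = X n x * \<theta>' (x \<bullet> i)" for n x
  proof -
    have "(\<Sum>j\<in>Basis. (\<xi>' n j (x \<bullet> j) * (\<Prod>k\<in>Basis - {j}. \<xi> n k (x \<bullet> k))) *\<^sub>R j) \<bullet> i = \<xi>' n i (x \<bullet> i) * (\<Prod>k\<in>Basis - {i}. \<xi> n k (x \<bullet> k))"
      using i by simp
    also have "(\<Prod>k\<in>Basis - {i}. \<xi> n k (x \<bullet> k)) = X n x" unfolding X_def by (rule prod.cong) (auto simp: \<xi>_def)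
    finally show ?thesis by (simp add: \<xi>'_def)
  qed
  have int: "integrable ?L f" "integrable ?L D"
    using f by (auto simp: H1_with_gradient_def intro: square_integrable_integrable)
  have intD: "integrable ?L (\<lambda>x. D x \<bullet> i)" using int(2) by simp
  have bounded_on: "\<exists>B. \<forall>x\<in>?\<Omega>. \<bar>h x\<bar> \<le> B" if "continuous_on UNIV h" for h :: "'a \<Rightarrow> real"
  proof -
    have "bounded (h ` cbox (- l) l)"
      using compact_continuous_image[OF continuous_on_subset[OF that subset_UNIV] compact_cbox] compact_imp_bounded by blast
    then show ?thesis using box_subset_cbox[of "- l" l] unfolding bounded_iff by fastforce
  qed
  have lim: "(\<lambda>n. \<integral>x. X n x * (w x * h x) \<partial>?L) \<longlonglongrightarrow> (\<integral>x. w x * h x \<partial>?L)"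
    if w: "continuous_on UNIV w" and h: "integrable ?L h" for w h :: "'a \<Rightarrow> real"
  proof -
    obtain B where B: "\<And>x. x \<in> ?\<Omega> \<Longrightarrow> \<bar>w x\<bar> \<le> B" using bounded_on[OF w] by blast
    have [measurable]: "w \<in> borel_measurable ?L" "h \<in> borel_measurable ?L" using mL[OF w] h by auto
    show ?thesis
    proof (rule integral_dominated_convergence)
      show "integrable ?L (\<lambda>x. B * \<bar>h x\<bar>)" using h by simp
      show "AE x in ?L. norm (X n x * (w x * h x)) \<le> B * \<bar>h x\<bar>" for n
      proof (rule AE_I2)
        fix x assume "x \<in> space ?L"
        then have "\<bar>w x\<bar> \<le> B" using B by simp
        then have "\<bar>X n x\<bar> * \<bar>w x\<bar> \<le> 1 * B" using X_range by (intro mult_mono) auto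
        then show "norm (X n x * (w x * h x)) \<le> B * \<bar>h x\<bar>"
          using mult_right_mono[of "\<bar>X n x\<bar> * \<bar>w x\<bar>" B "\<bar>h x\<bar>"] by (simp add: abs_mult mult.assoc)
      qed
      show "AE x in ?L. (\<lambda>n. X n x * (w x * h x)) \<longlonglongrightarrow> w x * h x"
        using tendsto_mult_right[OF X_lim, of _ "w x * h x" for x] by (intro AE_I2) simp
    qed measurable
  qed
  have "(\<integral>x. X n x * (\<theta>' (x \<bullet> i) * f x) \<partial>?L) = - (\<integral>x. X n x * (\<theta> (x \<bullet> i) * (D x \<bullet> i)) \<partial>?L)" for n
  proof -
    let ?E = "\<lambda>x. \<Sum>j\<in>Basis. (\<xi>' n j (x \<bullet> j) * (\<Prod>k\<in>Basis - {j}. \<xi> n k (x \<bullet> k))) *\<^sub>R j"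
    have tf: "C1_test_function ?\<Omega> (\<lambda>x. X n x * \<theta> (x \<bullet> i)) ?E"
      using box_test_function[of l "\<xi> n" "\<xi>' n"] \<eta>(1) \<theta> unfolding prod_i by (auto simp: \<xi>_def \<xi>'_def)
    note b = test_function_bounded[OF tf]
    have eq: "(\<integral>x. f x *\<^sub>R ?E x \<partial>?L) = - (\<integral>x. (X n x * \<theta> (x \<bullet> i)) *\<^sub>R D x \<partial>?L)"
      using f tf by (simp add: H1_with_gradient_def)
    have "(\<integral>x. f x *\<^sub>R ?E x \<partial>?L) \<bullet> i = (\<integral>x. (f x *\<^sub>R ?E x) \<bullet> i \<partial>?L)"
      by (intro integral_inner_left[symmetric] integrable_test_gradient int b open_box)
    also have "\<dots> = (\<integral>x. X n x * (\<theta>' (x \<bullet> i) * f x) \<partial>?L)"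
      unfolding inner_scaleR_left grad_i by (simp add: mult.commute mult.left_commute)
    finally have 1: "(\<integral>x. f x *\<^sub>R ?E x \<partial>?L) \<bullet> i = (\<integral>x. X n x * (\<theta>' (x \<bullet> i) * f x) \<partial>?L)" .
    have "(\<integral>x. (X n x * \<theta> (x \<bullet> i)) *\<^sub>R D x \<partial>?L) \<bullet> i = (\<integral>x. ((X n x * \<theta> (x \<bullet> i)) *\<^sub>R D x) \<bullet> i \<partial>?L)"
      by (intro integral_inner_left[symmetric] integrable_test_mult int b open_box)
    also have "\<dots> = (\<integral>x. X n x * (\<theta> (x \<bullet> i) * (D x \<bullet> i)) \<partial>?L)"
      by (simp add: mult.assoc)
    finally show ?thesis using 1 eq by simp
  qed
  then have "(\<lambda>n. - (\<integral>x. X n x * (\<theta> (x \<bullet> i) * (D x \<bullet> i)) \<partial>?L)) \<longlonglongrightarrow> (\<integral>x. \<theta>' (x \<bullet> i) * f x \<partial>?L)"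
    using lim[OF c\<theta>(2) int(1)] by simp
  from LIMSEQ_unique[OF this tendsto_minus[OF lim[OF c\<theta>(1) intD]]]
  show ?thesis by (simp add: mult.commute)
qed

definition box_face :: "'a::euclidean_space \<Rightarrow> 'a \<Rightarrow> real \<Rightarrow> 'a set" where
  "box_face l i s = {x. x \<bullet> i = s \<and> (\<forall>j\<in>Basis - {i}. \<bar>x \<bullet> j\<bar> \<le> l \<bullet> j)}"

lemma box_face_compact:
  fixes l :: "'a::euclidean_space"
  assumes i: "i \<in> Basis"
  shows "compact (box_face l i s)"
proof -
  define L where "L = (\<Sum>j\<in>Basis. (max \<bar>s\<bar> \<bar>l \<bullet> j\<bar>) *\<^sub>R j)"
  have L: "L \<bullet> j = max \<bar>s\<bar> \<bar>l \<bullet> j\<bar>" if "j \<in> Basis" for j using that by (simp add: L_def)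
  have "box_face l i s = {x. x \<bullet> i = s} \<inter> (\<Inter>j\<in>Basis - {i}. {x. \<bar>x \<bullet> j\<bar> \<le> l \<bullet> j})"
    by (auto simp: box_face_def)
  then have cl: "closed (box_face l i s)"
    by (simp only:) (intro closed_Int closed_INT ballI closed_Collect_eq closed_Collect_le continuous_intros)
  have "\<bar>x \<bullet> j\<bar> \<le> L \<bullet> j" if "x \<in> box_face l i s" "j \<in> Basis" for x j
    using that by (cases "j = i") (auto simp: L box_face_def intro!: max.coboundedI2 order_trans[OF _ abs_ge_self])
  then have "box_face l i s \<subseteq> cbox (- L) L" unfolding mem_box subset_iff abs_le_iff by fastforce
  then show ?thesis using cl by (meson compact_cbox compact_if_closed_subset)
qed

lemma box_face_translate:
  fixes l :: "'a::euclidean_space"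
  assumes i: "i \<in> Basis"
  shows "s *\<^sub>R i + y \<in> box_face l i s \<longleftrightarrow> y \<in> box_face l i 0"
  using i by (auto simp: box_face_def inner_add_left inner_Basis)

context
  fixes l :: "'a::euclidean_space"
  assumes l: "\<And>j. j \<in> Basis \<Longrightarrow> 0 < l \<bullet> j"
begin

abbreviation (input) "area_measure \<equiv> hausdorff_measure (DIM('a) - 1) :: 'a measure"

lemma box_face_finite:
  assumes i: "i \<in> Basis"
  shows "emeasure area_measure (box_face l i s) < top"
proof -
  have [measurable]: "box_face l i s \<in> sets borel" for s
    using box_face_compact[OF i] by (simp add: borel_compact)
  have "emeasure area_measure (box_face l i s) = emeasure (distr area_measure borel ((+) (s *\<^sub>R i))) (box_face l i s)"
    by (subst hausdorff_measure_distr_isometry) (auto simp: surj_plus)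
  also have "\<dots> = emeasure area_measure (box_face l i 0)"
    by (subst emeasure_distr) (auto simp: box_face_translate[OF i] vimage_def)
  also have "\<dots> = emeasure (plane_measure i) (box_face l i 0)"
    unfolding emeasure_plane_measure[OF \<open>box_face l i 0 \<in> sets borel\<close>]
    by (auto simp: emeasure_hausdorff_measure box_face_def intro!: arg_cong[of _ _ "hausdorff_outer _"])
  also have "\<dots> < top" by (intro plane_measure_bounded_finite i) (simp_all add: box_face_compact[OF i] compact_imp_bounded)
  finally show ?thesis .
qed

definition face_integral :: "('a \<Rightarrow> real) \<Rightarrow> 'a \<Rightarrow> real \<Rightarrow> real" where
  "face_integral f i t = (\<integral>y. indicator (box_face l i 0) y *\<^sub>R f (y + t *\<^sub>R i) \<partial>area_measure)"

lemma face_translate_in_box: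
  assumes i: "i \<in> Basis" and y: "y \<bullet> i = 0"
  shows "y + t *\<^sub>R i \<in> cbox (- l) l \<longleftrightarrow> y \<in> box_face l i 0 \<and> \<bar>t\<bar> \<le> l \<bullet> i"
proof -
  have "(y + t *\<^sub>R i) \<bullet> j = (if j = i then t else y \<bullet> j)" if "j \<in> Basis" for j
    using that i y by (auto simp: inner_add_left inner_Basis)
  then have "y + t *\<^sub>R i \<in> cbox (- l) l \<longleftrightarrow> (\<forall>j\<in>Basis. \<bar>if j = i then t else y \<bullet> j\<bar> \<le> l \<bullet> j)"
    unfolding mem_box abs_le_iff by (auto simp: minus_le_iff)
  then show ?thesis using i y by (auto simp: box_face_def split: if_splits)
qed

lemma face_integral_continuous:
  assumes i: "i \<in> Basis" and f: "continuous_on (cbox (- l) l) f"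
  shows "continuous_on {- (l \<bullet> i)..l \<bullet> i} (face_integral f i)"
proof -
  have "continuous_on ({- (l \<bullet> i)..l \<bullet> i} \<times> box_face l i 0) (\<lambda>(t, y). f (y + t *\<^sub>R i))"
    unfolding case_prod_beta
  proof (rule continuous_on_compose2[OF f])
    show "(\<lambda>p. snd p + fst p *\<^sub>R i) ` ({- (l \<bullet> i)..l \<bullet> i} \<times> box_face l i 0) \<subseteq> cbox (- l) l"
      using face_translate_in_box[OF i] by (auto simp: box_face_def abs_le_iff)
  qed (intro continuous_intros)
  then show ?thesis
    unfolding face_integral_def
    using box_face_finite[OF i, of 0]
    by (intro continuous_on_set_integral_param(1)) (auto simp: box_face_compact[OF i])
qed

lemma box_slicing:
  assumes c: "0 < c" "distr (plane_measure i \<Otimes>\<^sub>M lborel) borel (\<lambda>(y, t). y + t *\<^sub>R i) = density lborel (\<lambda>_. ennreal c)"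
    and i: "i \<in> Basis" and f: "continuous_on (cbox (- l) l) f" and \<theta>: "continuous_on UNIV \<theta>"
  shows "c * (\<integral>x. f x * \<theta> (x \<bullet> i) \<partial>lebesgue_on (box (- l) l)) = (LINT t:{- (l \<bullet> i)..l \<bullet> i}|lborel. face_integral f i t * \<theta> t)"
proof -
  interpret P: sigma_finite_measure "plane_measure i" by (rule sigma_finite_plane_measure[OF i])
  interpret pair_sigma_finite "plane_measure i" lborel ..
  let ?C = "cbox (- l) l"
  define h where "h x = indicator ?C x *\<^sub>R (f x * \<theta> (x \<bullet> i))" for x
  have ch: "continuous_on ?C (\<lambda>x. f x * \<theta> (x \<bullet> i))"
    by (intro continuous_intros f continuous_on_compose2[OF \<theta>]) auto
  have ih: "integrable lborel h" unfolding h_def by (rule borel_integrable_compact[OF compact_cbox ch])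
  then have [measurable]: "h \<in> borel_measurable borel" by simp
  have "(\<integral>x. f x * \<theta> (x \<bullet> i) \<partial>lebesgue_on (box (- l) l)) = (\<integral>x. indicator (box (- l) l) x *\<^sub>R (f x * \<theta> (x \<bullet> i)) \<partial>lborel)"
    by (intro integral_lebesgue_on_borel(1) open_indicator_measurable continuous_on_subset[OF ch] box_subset_cbox) auto
  also have "\<dots> = (\<integral>x. h x \<partial>lborel)"
  proof (rule integral_cong_AE)
    show "(\<lambda>x. indicator (box (- l) l) x *\<^sub>R (f x * \<theta> (x \<bullet> i))) \<in> borel_measurable lborel"
      using open_indicator_measurable[OF open_box continuous_on_subset[OF ch box_subset_cbox]] by simp
    have "emeasure lborel (cbox (- l) l) = emeasure lborel (box (- l) l)"
      by (simp add: emeasure_lborel_cbox_eq emeasure_lborel_box_eq)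
    then have "emeasure lborel (cbox (- l) l - box (- l) l) = 0"
      using emeasure_lborel_cbox_finite[of "- l" l] by (subst emeasure_Diff) (auto simp: box_subset_cbox)
    then have "AE x in lborel. x \<notin> cbox (- l) l - box (- l) l" by (intro AE_not_in) (auto simp: null_sets_def)
    then show "AE x in lborel. indicator (box (- l) l) x *\<^sub>R (f x * \<theta> (x \<bullet> i)) = h x"
      by eventually_elim (use box_subset_cbox[of "- l" l] in \<open>auto simp: h_def split: split_indicator\<close>)
  qed simp
  finally have "c * (\<integral>x. f x * \<theta> (x \<bullet> i) \<partial>lebesgue_on (box (- l) l)) = (\<integral>x. h x \<partial>density lborel (\<lambda>_. ennreal c))"
    using c(1) by (simp add: integral_density)
  also have "\<dots> = (\<integral>x. h x \<partial>distr (plane_measure i \<Otimes>\<^sub>M lborel) borel (\<lambda>(y, t). y + t *\<^sub>R i))" by (simp add: c(2))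
  also have "\<dots> = (\<integral>z. h (fst z + snd z *\<^sub>R i) \<partial>(plane_measure i \<Otimes>\<^sub>M lborel))"
    by (subst integral_distr) (auto simp: case_prod_beta)
  also have "\<dots> = (\<integral>t. (\<integral>y. h (y + t *\<^sub>R i) \<partial>plane_measure i) \<partial>lborel)"
  proof -
    have "integrable (density lborel (\<lambda>_. ennreal c)) h" using ih c(1) by (subst integrable_density) auto
    then have "integrable (distr (plane_measure i \<Otimes>\<^sub>M lborel) borel (\<lambda>(y, t). y + t *\<^sub>R i)) h" by (simp add: c(2))
    then have "integrable (plane_measure i \<Otimes>\<^sub>M lborel) (\<lambda>z. h (case z of (y, t) \<Rightarrow> y + t *\<^sub>R i))"
      by (subst (asm) integrable_distr_eq) auto
    then have "integrable (plane_measure i \<Otimes>\<^sub>M lborel) (\<lambda>(y, t). h (y + t *\<^sub>R i))" by (simp add: case_prod_unfold)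
    from integral_snd[OF this] show ?thesis by (simp add: case_prod_unfold)
  qed
  also have "\<dots> = (LINT t:{- (l \<bullet> i)..l \<bullet> i}|lborel. face_integral f i t * \<theta> t)"
    unfolding set_lebesgue_integral_def
  proof (rule Bochner_Integration.integral_cong[OF refl])
    fix t :: real
    have "(\<integral>y. h (y + t *\<^sub>R i) \<partial>plane_measure i) = (\<integral>y. indicator {x. x \<bullet> i = 0} y *\<^sub>R h (y + t *\<^sub>R i) \<partial>area_measure)"
    proof -
      have "plane_measure i = density area_measure (\<lambda>x. ennreal (indicator {x. x \<bullet> i = 0} x))"
        by (simp add: plane_measure_def ennreal_indicator)
      then show ?thesis by (simp add: integral_density)
    qed
    also have "\<dots> = (\<integral>y. indicator {- (l \<bullet> i)..l \<bullet> i} t * \<theta> t * (indicator (box_face l i 0) y *\<^sub>R f (y + t *\<^sub>R i)) \<partial>area_measure)"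
    proof (rule Bochner_Integration.integral_cong[OF refl])
      fix y :: 'a
      show "indicator {x. x \<bullet> i = 0} y *\<^sub>R h (y + t *\<^sub>R i) = indicator {- (l \<bullet> i)..l \<bullet> i} t * \<theta> t * (indicator (box_face l i 0) y *\<^sub>R f (y + t *\<^sub>R i))"
      proof (cases "y \<bullet> i = 0")
        case True
        have "(y + t *\<^sub>R i) \<bullet> i = t" using True i by (simp add: inner_add_left)
        then show ?thesis
          using face_translate_in_box[OF i True, of t] True
          by (auto simp: h_def abs_le_iff split: split_indicator)
      next
        case False
        then have "y \<notin> box_face l i 0" by (simp add: box_face_def)
        then show ?thesis using False by simp
      qed
    qed
    also have "\<dots> = indicator {- (l \<bullet> i)..l \<bullet> i} t *\<^sub>R (face_integral f i t * \<theta> t)"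
      unfolding face_integral_def by simp
    finally show "(\<integral>y. h (y + t *\<^sub>R i) \<partial>plane_measure i) = indicator {- (l \<bullet> i)..l \<bullet> i} t *\<^sub>R (face_integral f i t * \<theta> t)" .
  qed
  finally show ?thesis .
qed

lemma frontier_box_faces: "frontier (box (- l) l) = (\<Union>i\<in>Basis. box_face l i (l \<bullet> i) \<union> box_face l i (- (l \<bullet> i)))"
proof -
  have ne: "box (- l) l \<noteq> {}" using l by (auto simp: box_ne_empty)
  have "frontier (box (- l) l) = cbox (- l) l - box (- l) l"
    using ne by (simp add: frontier_def interior_open[OF open_box] closure_box)
  also have "\<dots> = (\<Union>i\<in>Basis. box_face l i (l \<bullet> i) \<union> box_face l i (- (l \<bullet> i)))"
  proof (intro equalityI subsetI)
    fix x assume x: "x \<in> cbox (- l) l - box (- l) l"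
    then obtain i where i: "i \<in> Basis" "\<not> (- (l \<bullet> i) < x \<bullet> i \<and> x \<bullet> i < l \<bullet> i)" by (auto simp: mem_box)
    have le: "\<And>j. j \<in> Basis \<Longrightarrow> \<bar>x \<bullet> j\<bar> \<le> l \<bullet> j" using x by (auto simp: mem_box abs_le_iff)
    then have "x \<bullet> i = l \<bullet> i \<or> x \<bullet> i = - (l \<bullet> i)" using i le[OF i(1)] by linarith
    then show "x \<in> (\<Union>i\<in>Basis. box_face l i (l \<bullet> i) \<union> box_face l i (- (l \<bullet> i)))"
      using i le by (auto simp: box_face_def)
  next
    fix x assume "x \<in> (\<Union>i\<in>Basis. box_face l i (l \<bullet> i) \<union> box_face l i (- (l \<bullet> i)))"
    then obtain i where i: "i \<in> Basis" "\<bar>x \<bullet> i\<bar> = l \<bullet> i" "\<And>j. j \<in> Basis - {i} \<Longrightarrow> \<bar>x \<bullet> j\<bar> \<le> l \<bullet> j"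
      using l by (auto simp: box_face_def less_imp_le)
    then have "\<bar>x \<bullet> j\<bar> \<le> l \<bullet> j" if "j \<in> Basis" for j using that by (cases "j = i") auto
    then show "x \<in> cbox (- l) l - box (- l) l" using i by (force simp: mem_box abs_le_iff)
  qed
  finally show ?thesis .
qed

lemma box_surface_finite: "finite_measure (surface_measure (box (- l) l))"
proof
  have [measurable]: "box_face l i s \<in> sets borel" if "i \<in> Basis" for i s
    using box_face_compact[OF that] by (simp add: borel_compact)
  have fr: "frontier (box (- l) l) \<in> sets borel" by simp
  have "emeasure (surface_measure (box (- l) l)) (space (surface_measure (box (- l) l))) = emeasure area_measure (frontier (box (- l) l))"
    using fr by (simp add: surface_measure_def emeasure_restrict_space space_restrict_space)
  also have "\<dots> \<le> (\<Sum>i\<in>Basis. emeasure area_measure (box_face l i (l \<bullet> i) \<union> box_face l i (- (l \<bullet> i))))"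
    unfolding frontier_box_faces by (intro emeasure_subadditive_finite) auto
  also have "\<dots> \<le> (\<Sum>i\<in>Basis. emeasure area_measure (box_face l i (l \<bullet> i)) + emeasure area_measure (box_face l i (- (l \<bullet> i))))"
    by (intro sum_mono emeasure_subadditive) auto
  also have "\<dots> < top"
    using box_face_finite by (simp add: ennreal_sum_less_top ennreal_add_eq_top less_top[symmetric])
  finally show "emeasure (surface_measure (box (- l) l)) (space (surface_measure (box (- l) l))) \<noteq> \<infinity>" by simp
qed

text \<open>The faces overlap only in sets of codimension two.\<close>

lemma box_surface_integral:
  assumes f: "continuous_on (cbox (- l) l) f"
  shows "(\<integral>x. f x \<partial>surface_measure (box (- l) l)) = (\<Sum>i\<in>Basis. face_integral f i (l \<bullet> i) + face_integral f i (- (l \<bullet> i)))"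
proof -
  let ?F = "frontier (box (- l) l)"
  have face_sets [measurable]: "box_face l i s \<in> sets borel" if "i \<in> Basis" for i s
    using box_face_compact[OF that] by (simp add: borel_compact)
  have ne: "box (- l) l \<noteq> {}" using l by (auto simp: box_ne_empty)
  have Fsub: "?F \<subseteq> cbox (- l) l" using ne by (auto simp: frontier_def closure_box)
  have sub: "box_face l i s \<subseteq> cbox (- l) l" if "i \<in> Basis" "s = l \<bullet> i \<or> s = - (l \<bullet> i)" for i s
    using that frontier_box_faces Fsub by blast
  have mF: "(\<lambda>x. indicator (box_face l i s) x *\<^sub>R f x) \<in> borel_measurable borel"
    if "i \<in> Basis" "s = l \<bullet> i \<or> s = - (l \<bullet> i)" for i s
    using that by (intro borel_measurable_continuous_on_indicator continuous_on_subset[OF f sub]) auto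
  have face: "(\<integral>x. indicator (box_face l i s) x *\<^sub>R f x \<partial>area_measure) = face_integral f i s"
    if i: "i \<in> Basis" "s = l \<bullet> i \<or> s = - (l \<bullet> i)" for i s
  proof -
    have "(\<integral>x. indicator (box_face l i s) x *\<^sub>R f x \<partial>area_measure)
        = (\<integral>x. indicator (box_face l i s) x *\<^sub>R f x \<partial>distr area_measure borel ((+) (s *\<^sub>R i)))"
      by (subst hausdorff_measure_distr_isometry) (auto simp: surj_plus)
    also have "\<dots> = (\<integral>y. indicator (box_face l i s) (s *\<^sub>R i + y) *\<^sub>R f (s *\<^sub>R i + y) \<partial>area_measure)"
      by (rule integral_distr) (use mF[OF i] in auto)
    also have "\<dots> = face_integral f i s"
      unfolding face_integral_def
      by (rule Bochner_Integration.integral_cong) (simp_all add: indicator_def box_face_translate[OF i(1)] add.commute[of _ "s *\<^sub>R i"])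
    finally show ?thesis .
  qed
  have int: "integrable area_measure (\<lambda>x. indicator (box_face l i s) x *\<^sub>R f x)"
    if i: "i \<in> Basis" "s = l \<bullet> i \<or> s = - (l \<bullet> i)" for i s
  proof (rule continuous_on_set_integral_param(2)[where h="\<lambda>_. f" and T="{0}" and t=0])
    show "continuous_on ({0} \<times> box_face l i s) (\<lambda>(t, y). f y)"
      unfolding case_prod_beta using sub[OF i]
      by (intro continuous_on_compose2[OF f]) (auto intro!: continuous_intros)
  qed (use i box_face_finite[OF i(1), of s] in \<open>auto simp: box_face_compact\<close>)
  have null: "AE x in area_measure. \<forall>i\<in>Basis. \<forall>j\<in>Basis. i \<noteq> j \<longrightarrow> \<not> (\<bar>x \<bullet> i\<bar> = l \<bullet> i \<and> \<bar>x \<bullet> j\<bar> = l \<bullet> j)"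
  proof (intro AE_finite_allI finite_Basis)
    fix i j :: 'a assume ij: "i \<in> Basis" "j \<in> Basis"
    show "AE x in area_measure. i \<noteq> j \<longrightarrow> \<not> (\<bar>x \<bullet> i\<bar> = l \<bullet> i \<and> \<bar>x \<bullet> j\<bar> = l \<bullet> j)"
    proof (cases "i = j")
      case False
      have "AE x in area_measure. x \<notin> {x. x \<bullet> i = s \<and> x \<bullet> j = t}" for s t
      proof (rule AE_not_in)
        have "{x. x \<bullet> i = s \<and> x \<bullet> j = t} = {x. x \<bullet> i = s} \<inter> {x. x \<bullet> j = t}" by auto
        then have "{x. x \<bullet> i = s \<and> x \<bullet> j = t} \<in> sets borel" by simp
        then show "{x. x \<bullet> i = s \<and> x \<bullet> j = t} \<in> null_sets area_measure"
          using codim_two_null[OF ij False, of s t] by (auto simp: null_sets_def emeasure_hausdorff_measure)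
      qed
      from this[of "l \<bullet> i" "l \<bullet> j"] this[of "- (l \<bullet> i)" "l \<bullet> j"] this[of "l \<bullet> i" "- (l \<bullet> j)"] this[of "- (l \<bullet> i)" "- (l \<bullet> j)"]
      show ?thesis by eventually_elim (auto simp: abs_if split: if_splits)
    qed simp
  qed
  have "(\<integral>x. f x \<partial>surface_measure (box (- l) l)) = (\<integral>x. indicator ?F x *\<^sub>R f x \<partial>area_measure)"
    unfolding surface_measure_def by (rule integral_restrict_space) simp
  also have "\<dots> = (\<integral>x. (\<Sum>i\<in>Basis. indicator (box_face l i (l \<bullet> i)) x *\<^sub>R f x + indicator (box_face l i (- (l \<bullet> i))) x *\<^sub>R f x) \<partial>area_measure)"
  proof (rule integral_cong_AE)
    have "(\<lambda>x. indicator ?F x *\<^sub>R f x) \<in> borel_measurable borel"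
      by (intro borel_measurable_continuous_on_indicator continuous_on_subset[OF f Fsub]) simp
    then show "(\<lambda>x. indicator ?F x *\<^sub>R f x) \<in> borel_measurable area_measure" by simp
    show "(\<lambda>x. \<Sum>i\<in>Basis. indicator (box_face l i (l \<bullet> i)) x *\<^sub>R f x + indicator (box_face l i (- (l \<bullet> i))) x *\<^sub>R f x) \<in> borel_measurable area_measure"
      using mF by (intro borel_measurable_sum borel_measurable_add) auto
    show "AE x in area_measure. indicator ?F x *\<^sub>R f x = (\<Sum>i\<in>Basis. indicator (box_face l i (l \<bullet> i)) x *\<^sub>R f x + indicator (box_face l i (- (l \<bullet> i))) x *\<^sub>R f x)"
      using null
    proof eventually_elim
      case (elim x)
      show ?case
      proof (cases "x \<in> ?F")
        case False
        then have "x \<notin> box_face l i (l \<bullet> i)" "x \<notin> box_face l i (- (l \<bullet> i))" if "i \<in> Basis" for i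
          using that unfolding frontier_box_faces by auto
        then show ?thesis using False by (simp add: sum.neutral)
      next
        case True
        then obtain i where i: "i \<in> Basis" "x \<in> box_face l i (l \<bullet> i) \<or> x \<in> box_face l i (- (l \<bullet> i))"
          unfolding frontier_box_faces by auto
        have xi: "\<bar>x \<bullet> i\<bar> = l \<bullet> i" using i l[OF i(1)] by (auto simp: box_face_def)
        have other: "x \<notin> box_face l j (l \<bullet> j)" "x \<notin> box_face l j (- (l \<bullet> j))" if "j \<in> Basis" "j \<noteq> i" for j
          using elim i(1) that xi l[OF that(1)] by (force simp: box_face_def)+
        have "(\<Sum>i\<in>Basis. indicator (box_face l i (l \<bullet> i)) x *\<^sub>R f x + indicator (box_face l i (- (l \<bullet> i))) x *\<^sub>R f x)
            = indicator (box_face l i (l \<bullet> i)) x *\<^sub>R f x + indicator (box_face l i (- (l \<bullet> i))) x *\<^sub>R f x"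
          using i(1) other by (subst sum.remove[OF finite_Basis i(1)]) (simp add: sum.neutral)
        also have "\<dots> = f x"
          using i l[OF i(1)] by (auto simp: box_face_def split: split_indicator)
        finally show ?thesis using True by simp
      qed
    qed
  qed
  also have "\<dots> = (\<Sum>i\<in>Basis. face_integral f i (l \<bullet> i) + face_integral f i (- (l \<bullet> i)))"
    using int face by (subst Bochner_Integration.integral_sum) auto
  finally show ?thesis .
qed

definition box_flux :: real where "box_flux = 1 / (\<Sum>i\<in>Basis. 1 / (l \<bullet> i))"

definition box_solution :: "'a \<Rightarrow> real" where
  "box_solution x = - (\<Sum>i\<in>Basis. box_flux / (2 * (l \<bullet> i)) * (x \<bullet> i)\<^sup>2)"

definition box_gradient :: "'a \<Rightarrow> 'a" where
  "box_gradient x = - (\<Sum>i\<in>Basis. (box_flux / (l \<bullet> i) * (x \<bullet> i)) *\<^sub>R i)"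

lemma box_flux_pos: "0 < box_flux"
  unfolding box_flux_def using l by (auto intro!: divide_pos_pos sum_pos)

lemma box_flux_sum: "(\<Sum>i\<in>Basis. box_flux / (l \<bullet> i)) = 1"
proof -
  have "(\<Sum>i\<in>Basis. box_flux / (l \<bullet> i)) = box_flux * (\<Sum>i\<in>Basis. 1 / (l \<bullet> i))"
    by (simp add: sum_distrib_left)
  moreover have "(\<Sum>i\<in>Basis. 1 / (l \<bullet> i)) \<noteq> 0" using box_flux_pos by (auto simp: box_flux_def)
  ultimately show ?thesis by (simp add: box_flux_def)
qed

text \<open>In each direction the function of one variable \<open>t \<mapsto> face_integral f i
  t\<close> has weak derivative given by \<open>D x \<bullet> i\<close>; integrating by parts
  against the linear function \<open>- (box_flux / l\<^sub>i) t\<close> yields the two faces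
  orthogonal to \<open>i\<close>, both with weight \<open>box_flux\<close>. The sum over
  \<open>i\<close> is the identity, as the slopes \<open>box_flux / l\<^sub>i\<close> add up to
  \<open>1\<close>. The factor \<open>c\<close> enters because slices carry the unnormalised
  area.\<close>

lemma box_divergence:
  assumes c: "0 < c"
    "\<And>i::'a. i \<in> Basis \<Longrightarrow> distr (plane_measure i \<Otimes>\<^sub>M lborel) borel (\<lambda>(y, t). y + t *\<^sub>R i) = density lborel (\<lambda>_. ennreal c)"
    and f: "H1_with_gradient (box (- l) l) f D" "continuous_on (cbox (- l) l) f"
  shows "(\<integral>x. box_gradient x \<bullet> D x \<partial>lebesgue_on (box (- l) l))
    = (\<integral>x. f x \<partial>lebesgue_on (box (- l) l)) - box_flux / c * (\<integral>x. f x \<partial>surface_measure (box (- l) l))"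
proof -
  let ?L = "lebesgue_on (box (- l) l)"
  interpret finite_measure ?L by (rule finite_measure_lebesgue_bounded_open) auto
  have intD: "integrable ?L D" using f(1) by (auto simp: H1_with_gradient_def intro: square_integrable_integrable)
  have dir: "box_flux * (face_integral f i (l \<bullet> i) + face_integral f i (- (l \<bullet> i)))
      = c * (box_flux / (l \<bullet> i) * (\<integral>x. f x \<partial>?L)) - c * (\<integral>x. - (box_flux / (l \<bullet> i)) * (x \<bullet> i) * (D x \<bullet> i) \<partial>?L)"
    if i: "i \<in> Basis" for i
  proof -
    let ?F = "face_integral f i" and ?k = "- (box_flux / (l \<bullet> i))"
    have li: "0 < l \<bullet> i" by (rule l[OF i])
    have "?F (l \<bullet> i) * (?k * (l \<bullet> i)) - ?F (- (l \<bullet> i)) * (?k * (- (l \<bullet> i)))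
      = (LINT t:{- (l \<bullet> i)..l \<bullet> i}|lborel. ?F t * ?k) + (\<integral>x. (?k * (x \<bullet> i)) * (c * (D x \<bullet> i)) \<partial>?L)"
    proof (rule boundary_values_from_test_functions)
      show "- (l \<bullet> i) < l \<bullet> i" using li by simp
      show "continuous_on {- (l \<bullet> i)..l \<bullet> i} ?F" by (rule face_integral_continuous[OF i f(2)])
      show "(\<lambda>x. x \<bullet> i) \<in> borel_measurable ?L"
        by (intro measurable_restrict_space1 measurable_completion) simp
      show "- (l \<bullet> i) < x \<bullet> i \<and> x \<bullet> i < l \<bullet> i" if "x \<in> space ?L" for x using that i by (auto simp: mem_box)
      show "integrable ?L (\<lambda>x. c * (D x \<bullet> i))" using intD by simp
      show "(LINT t:{- (l \<bullet> i)..l \<bullet> i}|lborel. ?F t * \<theta>' t) = - (\<integral>x. \<theta> (x \<bullet> i) * (c * (D x \<bullet> i)) \<partial>?L)"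
        if \<theta>: "interval_test (- (l \<bullet> i)) (l \<bullet> i) \<theta> \<theta>'" for \<theta> \<theta>'
      proof -
        have "(LINT t:{- (l \<bullet> i)..l \<bullet> i}|lborel. ?F t * \<theta>' t) = c * (\<integral>x. f x * \<theta>' (x \<bullet> i) \<partial>?L)"
          by (rule box_slicing[OF c(1) c(2)[OF i] i f(2), symmetric]) (use \<theta> in \<open>simp add: interval_test_def\<close>)
        also have "\<dots> = - (c * (\<integral>x. \<theta> (x \<bullet> i) * (D x \<bullet> i) \<partial>?L))"
          by (simp add: box_weak_direction[OF l i f(1) \<theta>])
        also have "\<dots> = - (\<integral>x. \<theta> (x \<bullet> i) * (c * (D x \<bullet> i)) \<partial>?L)"
          by (simp add: mult.left_commute[of _ c])
        finally show ?thesis .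
      qed
      show "DERIV (\<lambda>t. ?k * t) t :> ?k" for t by (rule DERIV_cmult_Id)
    qed simp
    moreover have "(LINT t:{- (l \<bullet> i)..l \<bullet> i}|lborel. ?F t * ?k) = c * (\<integral>x. f x * ?k \<partial>?L)"
      by (rule box_slicing[OF c(1) c(2)[OF i] i f(2), where \<theta>="\<lambda>_. ?k", symmetric]) simp
    moreover have "(\<integral>x. (?k * (x \<bullet> i)) * (c * (D x \<bullet> i)) \<partial>?L) = c * (\<integral>x. ?k * (x \<bullet> i) * (D x \<bullet> i) \<partial>?L)"
      by (subst integral_mult_right_zero[symmetric]) (simp only: mult.left_commute mult.assoc)
    moreover have "(\<integral>x. f x * ?k \<partial>?L) = (\<integral>x. f x \<partial>?L) * ?k" by (rule integral_mult_left_zero)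
    ultimately have eq: "?F (l \<bullet> i) * (?k * (l \<bullet> i)) - ?F (- (l \<bullet> i)) * (?k * (- (l \<bullet> i)))
      = c * ((\<integral>x. f x \<partial>?L) * ?k) + c * (\<integral>x. ?k * (x \<bullet> i) * (D x \<bullet> i) \<partial>?L)" by presburger
    \<comment> \<open>A rearrangement of the previous equation, stated for arbitrary numbers so
      that simplification does not reach into the integrands.\<close>
    have alg: "b * (F1 + F2) = d * (k * I) - d * J" if "F1 * (- k * m) - F2 * (- k * (- m)) = d * (I * (- k)) + d * J" "k * m = b"
      for F1 F2 k m I J d b :: real
      using that by (auto simp: algebra_simps)
    show ?thesis by (rule alg[OF eq]) (use li in simp)
  qed
  have fluxD: "integrable ?L (\<lambda>x. - (box_flux / (l \<bullet> i)) * (x \<bullet> i) * (D x \<bullet> i))" if i: "i \<in> Basis" for i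
  proof -
    have "integrable ?L (\<lambda>x. (- (box_flux / (l \<bullet> i)) *\<^sub>R (x \<bullet> i) *\<^sub>R i) \<bullet> D x)"
    proof (rule square_integrable_inner)
      show "square_integrable ?L (\<lambda>x. - (box_flux / (l \<bullet> i)) *\<^sub>R (x \<bullet> i) *\<^sub>R i)"
        by (intro square_integrable_continuous_closure continuous_intros) auto
      show "square_integrable ?L D" using f(1) by (simp add: H1_with_gradient_def)
    qed
    then show ?thesis by (simp add: inner_commute mult.assoc)
  qed
  have grad: "box_gradient x \<bullet> D x = (\<Sum>i\<in>Basis. - (box_flux / (l \<bullet> i)) * (x \<bullet> i) * (D x \<bullet> i))" for x
    unfolding box_gradient_def inner_minus_left inner_sum_left inner_scaleR_left sum_negf[symmetric]
    by (rule sum.cong) (simp_all add: inner_commute)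
  have "box_flux * (\<integral>x. f x \<partial>surface_measure (box (- l) l))
    = (\<Sum>i\<in>Basis. c * (box_flux / (l \<bullet> i) * (\<integral>x. f x \<partial>?L)) - c * (\<integral>x. - (box_flux / (l \<bullet> i)) * (x \<bullet> i) * (D x \<bullet> i) \<partial>?L))"
    unfolding box_surface_integral[OF f(2)] sum_distrib_left by (rule sum.cong) (use dir in auto)
  also have "\<dots> = c * ((\<Sum>i\<in>Basis. box_flux / (l \<bullet> i)) * (\<integral>x. f x \<partial>?L)) - c * (\<Sum>i\<in>Basis. (\<integral>x. - (box_flux / (l \<bullet> i)) * (x \<bullet> i) * (D x \<bullet> i) \<partial>?L))"
    unfolding sum_subtractf sum_distrib_left sum_distrib_right by simp
  also have "(\<Sum>i\<in>Basis. (\<integral>x. - (box_flux / (l \<bullet> i)) * (x \<bullet> i) * (D x \<bullet> i) \<partial>?L)) = (\<integral>x. box_gradient x \<bullet> D x \<partial>?L)"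
    unfolding grad using fluxD by (subst Bochner_Integration.integral_sum) auto
  finally have "box_flux * (\<integral>x. f x \<partial>surface_measure (box (- l) l)) = c * (\<integral>x. f x \<partial>?L) - c * (\<integral>x. box_gradient x \<bullet> D x \<partial>?L)"
    by (simp add: box_flux_sum)
  then show ?thesis using c(1) by (simp add: field_simps)
qed

text \<open>The solution is a concave quadratic polynomial, so its oscillation on the whole box
  is its largest drop from the centre, attained at the corners.\<close>

theorem box_oscillation:
  "0 \<le> boundary_oscillation (box (- l) l)"
  "boundary_oscillation (box (- l) l) \<le> box_flux / 2 * (\<Sum>i\<in>Basis. l \<bullet> i)"
proof -
  obtain c :: real where c: "0 < c"
    "\<And>i::'a. i \<in> Basis \<Longrightarrow> distr (plane_measure i \<Otimes>\<^sub>M lborel) borel (\<lambda>(y, t). y + t *\<^sub>R i) = density lborel (\<lambda>_. ennreal c)"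
    using hausdorff_slicing by blast
  have ne: "box (- l) l \<noteq> {}" using l by (auto simp: box_ne_empty)
  have cl: "closure (box (- l) l) = cbox (- l) l" by (rule closure_box[OF ne])
  have fp: "0 < box_flux / (2 * (l \<bullet> i))" if "i \<in> Basis" for i using box_flux_pos l[OF that] by simp
  have absl: "\<bar>x \<bullet> i\<bar> \<le> l \<bullet> i" if "x \<in> cbox (- l) l" "i \<in> Basis" for x i
    using that by (auto simp: mem_box abs_le_iff)
  have hoe: "hoelder_on (closure (box (- l) l)) box_solution"
    unfolding hoelder_on_def cl
  proof (intro exI conjI ballI)
    fix x y assume xy: "x \<in> cbox (- l) l" "y \<in> cbox (- l) l"
    have "\<bar>box_solution x - box_solution y\<bar> = \<bar>\<Sum>i\<in>Basis. box_flux / (2 * (l \<bullet> i)) * ((y \<bullet> i)\<^sup>2 - (x \<bullet> i)\<^sup>2)\<bar>"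
      unfolding box_solution_def by (simp add: sum_subtractf right_diff_distrib)
    also have "\<dots> \<le> (\<Sum>i\<in>Basis. \<bar>box_flux / (2 * (l \<bullet> i)) * ((y \<bullet> i)\<^sup>2 - (x \<bullet> i)\<^sup>2)\<bar>)" by (rule sum_abs)
    also have "\<dots> \<le> (\<Sum>i\<in>(Basis::'a set). box_flux * dist x y)"
    proof (rule sum_mono)
      fix i :: 'a assume i: "i \<in> Basis"
      have "(y \<bullet> i)\<^sup>2 - (x \<bullet> i)\<^sup>2 = ((y - x) \<bullet> i) * (y \<bullet> i + x \<bullet> i)"
        by (simp add: power2_eq_square inner_diff_left algebra_simps)
      moreover have "\<bar>(y - x) \<bullet> i\<bar> \<le> dist x y" using Basis_le_norm[OF i, of "y - x"] by (simp add: dist_norm norm_minus_commute)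
      moreover have "\<bar>y \<bullet> i + x \<bullet> i\<bar> \<le> 2 * (l \<bullet> i)" using absl[OF xy(1) i] absl[OF xy(2) i] by linarith
      ultimately have "\<bar>(y \<bullet> i)\<^sup>2 - (x \<bullet> i)\<^sup>2\<bar> \<le> dist x y * (2 * (l \<bullet> i))"
        by (simp add: abs_mult mult_mono)
      then have "box_flux / (2 * (l \<bullet> i)) * \<bar>(y \<bullet> i)\<^sup>2 - (x \<bullet> i)\<^sup>2\<bar> \<le> box_flux / (2 * (l \<bullet> i)) * (dist x y * (2 * (l \<bullet> i)))"
        using fp[OF i] by (intro mult_left_mono) auto
      also have "\<dots> = box_flux * dist x y" using l[OF i] by simp
      finally show "\<bar>box_flux / (2 * (l \<bullet> i)) * ((y \<bullet> i)\<^sup>2 - (x \<bullet> i)\<^sup>2)\<bar> \<le> box_flux * dist x y"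
        using fp[OF i] by (simp only: abs_mult abs_of_pos)
    qed
    also have "\<dots> = real DIM('a) * box_flux * dist x y powr 1" by simp
    finally show "\<bar>box_solution x - box_solution y\<bar> \<le> real DIM('a) * box_flux * dist x y powr 1" .
  qed simp_all
  have "GDERIV box_solution x :> box_gradient x" for x
    unfolding gderiv_def box_solution_def box_gradient_def
    by (auto intro!: derivative_eq_intros sum.cong simp: inner_sum_right fun_eq_iff dest: l)
  then have H1: "H1_with_gradient (box (- l) l) box_solution box_gradient"
    by (intro H1_with_gradient_C1) (auto simp: box_gradient_def box_solution_def intro!: continuous_intros dest: l)
  have range: "- (box_flux / 2 * (\<Sum>i\<in>Basis. l \<bullet> i)) \<le> box_solution x \<and> box_solution x \<le> 0" if x: "x \<in> cbox (- l) l" for x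
  proof
    have "(\<Sum>i\<in>Basis. box_flux / (2 * (l \<bullet> i)) * (x \<bullet> i)\<^sup>2) \<le> (\<Sum>i\<in>Basis. box_flux / 2 * (l \<bullet> i))"
    proof (rule sum_mono)
      fix i :: 'a assume i: "i \<in> Basis"
      have "(x \<bullet> i)\<^sup>2 \<le> (l \<bullet> i)\<^sup>2" using absl[OF x i] by (metis abs_ge_zero power2_abs power_mono)
      then have "box_flux / (2 * (l \<bullet> i)) * (x \<bullet> i)\<^sup>2 \<le> box_flux / (2 * (l \<bullet> i)) * (l \<bullet> i)\<^sup>2"
        using fp[OF i] by (intro mult_left_mono) auto
      also have "\<dots> = box_flux / 2 * (l \<bullet> i)" using l[OF i] by (simp add: power2_eq_square)
      finally show "box_flux / (2 * (l \<bullet> i)) * (x \<bullet> i)\<^sup>2 \<le> box_flux / 2 * (l \<bullet> i)" .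
    qed
    then show "- (box_flux / 2 * (\<Sum>i\<in>Basis. l \<bullet> i)) \<le> box_solution x" by (simp add: box_solution_def sum_distrib_left)
    show "box_solution x \<le> 0" unfolding box_solution_def neg_le_0_iff_le
      by (intro sum_nonneg mult_nonneg_nonneg) (simp_all add: fp less_imp_le del: divide_nonneg_pos)
  qed
  have fr: "frontier (box (- l) l) \<subseteq> cbox (- l) l" by (simp add: frontier_def cl)
  have osc: "\<bar>box_solution x - box_solution y\<bar> \<le> box_flux / 2 * (\<Sum>i\<in>Basis. l \<bullet> i)"
    if "x \<in> frontier (box (- l) l)" "y \<in> frontier (box (- l) l)" for x y
  proof -
    have "x \<in> cbox (- l) l" "y \<in> cbox (- l) l" using that fr by auto
    from range[OF this(1)] range[OF this(2)] show ?thesis by linarith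
  qed
  note main = boundary_oscillation_le[OF open_box bounded_box convex_connected[OF convex_box(2)] ne box_surface_finite hoe H1 _ osc]
  have div: "(\<integral>x. box_gradient x \<bullet> D x \<partial>lebesgue_on (box (- l) l))
      = (\<integral>x. f x \<partial>lebesgue_on (box (- l) l)) - box_flux / c * (\<integral>x. f x \<partial>surface_measure (box (- l) l))"
    if "H1_with_gradient (box (- l) l) f D" "continuous_on (closure (box (- l) l)) f" for f D
    by (rule box_divergence[OF c that(1)]) (use that(2) cl in \<open>simp_all\<close>)
  show "0 \<le> boundary_oscillation (box (- l) l)" by (rule main(1)[OF div])
  show "boundary_oscillation (box (- l) l) \<le> box_flux / 2 * (\<Sum>i\<in>Basis. l \<bullet> i)" by (rule main(2)[OF div])
qed

end

section \<open>Polar coordinates in the plane\<close>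

text \<open>The length measure of the plane is stated below with its dimension in the form \<open>1\<close>.\<close>

declare One_nat_def [simp del]

abbreviation (input) "e1 \<equiv> axis 1 1 :: real ^ 2"
abbreviation (input) "e2 \<equiv> axis 2 1 :: real ^ 2"

text \<open>Multiplication of complex numbers, written in coordinates: for \<open>norm w =
  1\<close> this is a rotation, and it is symmetric in its two arguments.\<close>

definition rot :: "real ^ 2 \<Rightarrow> real ^ 2 \<Rightarrow> real ^ 2" where
  "rot w x = (w \<bullet> e1) *\<^sub>R x + (w \<bullet> e2) *\<^sub>R ((x \<bullet> e1) *\<^sub>R e2 - (x \<bullet> e2) *\<^sub>R e1)"

lemma rot_nth: "rot w x $ 1 = w $ 1 * x $ 1 - w $ 2 * x $ 2" "rot w x $ 2 = w $ 1 * x $ 2 + w $ 2 * x $ 1"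
  unfolding rot_def inner_axis by (simp_all add: axis_def)

lemma axes: "e1 \<in> Basis" "e2 \<in> Basis" "e1 \<noteq> e2"
  by (auto simp: Basis_vec_def axis_eq_axis)

lemma sphere_borel [measurable]: "sphere (c :: 'a::euclidean_space) s \<in> sets borel"
  by (rule borel_closed) (rule closed_sphere)

lemma dist_scale: "0 < s \<Longrightarrow> dist (s *\<^sub>R x) (s *\<^sub>R y :: 'a::real_normed_vector) = s * dist x y"
  by (simp add: dist_norm scaleR_diff_right[symmetric])

lemma rot_commute: "rot w x = rot x w"
  by (simp add: vec_eq_iff forall_2 rot_nth)

lemma rot_scaleR: "rot (s *\<^sub>R w) x = s *\<^sub>R rot w x"
  by (simp add: vec_eq_iff forall_2 rot_nth algebra_simps)

lemma rot_diff: "rot w x - rot w y = rot w (x - y)"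
  by (simp add: vec_eq_iff forall_2 rot_nth algebra_simps)

lemma rot_add: "rot w (x + y) = rot w x + rot w y"
  by (simp add: vec_eq_iff forall_2 rot_nth algebra_simps)

lemma norm_rot: "norm (rot w x) = norm w * norm x"
proof -
  have "(norm (rot w x))\<^sup>2 = (norm w * norm x)\<^sup>2"
    unfolding power_mult_distrib power2_norm_eq_inner inner_vec_def sum_2 rot_nth
    by (simp add: algebra_simps)
  then show ?thesis by (simp add: power2_eq_iff_nonneg)
qed

lemma rot_inverse:
  assumes "norm w = 1"
  shows "\<exists>v. norm v = 1 \<and> (\<forall>x. rot w (rot v x) = x)"
proof -
  define v :: "real ^ 2" where "v = (w \<bullet> e1) *\<^sub>R e1 - (w \<bullet> e2) *\<^sub>R e2"
  have v: "v $ 1 = w $ 1" "v $ 2 = - w $ 2" unfolding v_def inner_axis by (simp_all add: axis_def)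
  have w: "w $ 1 * w $ 1 + w $ 2 * w $ 2 = 1"
    using assms power2_norm_eq_inner[of w] by (simp add: inner_vec_def sum_2)
  have "norm v = 1" using w by (simp add: norm_eq_1 inner_vec_def sum_2 v)
  moreover have "rot w (rot v x) = x" for x
  proof -
    have "rot w (rot v x) $ 1 = (w $ 1 * w $ 1 + w $ 2 * w $ 2) * x $ 1" "rot w (rot v x) $ 2 = (w $ 1 * w $ 1 + w $ 2 * w $ 2) * x $ 2"
      by (simp_all only: rot_nth v) (simp_all add: algebra_simps)
    then show ?thesis using w by (simp add: vec_eq_iff forall_2)
  qed
  ultimately show ?thesis by blast
qed

lemma surj_rot: "norm w = 1 \<Longrightarrow> surj (rot w)"
  using rot_inverse[of w] by (metis surjI)

lemma dist_rot: "norm w = 1 \<Longrightarrow> dist (rot w x) (rot w y) = dist x y"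
  by (simp add: dist_norm rot_diff norm_rot)

lemma continuous_rot [continuous_intros]:
  "continuous_on A f \<Longrightarrow> continuous_on A g \<Longrightarrow> continuous_on A (\<lambda>x. rot (f x) (g x))"
  unfolding rot_def by (intro continuous_intros)

lemma measurable_rot [measurable]:
  "(\<lambda>p. rot (fst p) (snd p)) \<in> borel_measurable (borel \<Otimes>\<^sub>M borel)"
proof -
  have "(\<lambda>p. rot (fst p) (snd p)) \<in> borel_measurable borel"
    by (intro borel_measurable_continuous_onI continuous_intros)
  then show ?thesis by (simp add: borel_prod)
qed

text \<open>The image of Lebesgue measure under a rotation is translation invariant, hence a
  multiple of Lebesgue measure, and the unit disc shows that the factor is
  \<open>1\<close>.\<close>

lemma lborel_distr_rot:
  assumes w: "norm w = 1"
  shows "distr lborel borel (rot w) = lborel"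
proof -
  have [measurable]: "rot w \<in> borel_measurable borel"
    by (intro borel_measurable_continuous_onI continuous_intros)
  let ?M = "distr lborel borel (rot w)"
  have pre_ball: "rot w -` ball 0 R = ball 0 R" for R
    using w by (auto simp: norm_rot)
  have "?M = density lborel (\<lambda>_. emeasure ?M (cbox 0 One))"
  proof (rule translation_invariant_eq_lborel)
    show "sigma_finite_measure ?M"
    proof (rule sigma_finite_bounded_sets)
      fix A :: "(real ^ 2) set" assume A: "A \<in> sets borel" "bounded A"
      obtain R where "A \<subseteq> ball 0 R" using A(2) bounded_subset_ballD[of A 0] by blast
      then have "emeasure ?M A \<le> emeasure ?M (ball 0 R)" by (intro emeasure_mono) auto
      also have "\<dots> = emeasure lborel (ball (0 :: real ^ 2) R)" by (simp add: emeasure_distr pre_ball)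
      also have "\<dots> < top" using emeasure_lborel_ball_finite[of 0 R] by simp
      finally show "emeasure ?M A < top" .
    qed simp
    fix z
    obtain v where v: "\<And>x. rot w (rot v x) = x" using rot_inverse[OF w] by blast
    have "distr ?M borel ((+) z) = distr lborel borel (\<lambda>x. z + rot w x)"
      by (subst distr_distr) (auto simp: o_def)
    also have "\<dots> = distr (distr lborel borel ((+) (rot v z))) borel (rot w)"
      by (subst distr_distr) (auto simp: o_def rot_add v)
    finally show "distr ?M borel ((+) z) = ?M" by (simp add: lborel_distr_plus)
  qed simp
  then have eq: "emeasure ?M A = emeasure ?M (cbox 0 One) * emeasure lborel A" if "A \<in> sets borel" for A
    using that by (metis emeasure_density_const sets_lborel)
  have b: "emeasure lborel (ball (0 :: real ^ 2) 1) = ennreal pi"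
    by (simp add: emeasure_ball unit_ball_vol_2)
  have "emeasure ?M (ball 0 1) = emeasure lborel (ball (0 :: real ^ 2) 1)" by (simp add: emeasure_distr pre_ball)
  then have "emeasure ?M (cbox 0 One) * ennreal pi = 1 * ennreal pi" using eq[of "ball 0 1"] b by simp
  then have "emeasure ?M (cbox 0 One) = 1"
    by (cases "emeasure ?M (cbox 0 One)") (auto simp: ennreal_mult'[symmetric] ennreal_top_mult)
  then have "emeasure ?M A = emeasure lborel A" if "A \<in> sets ?M" for A using eq[of A] that by simp
  then show ?thesis by (intro measure_eqI) simp_all
qed

lemma DIM_plane: "DIM(real ^ 2) - 1 = 1" by simp

text \<open>The length on the unit circle, kept as a measure on the plane so that rotations act
  on it.\<close>

definition circle_measure :: "(real ^ 2) measure" where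
  "circle_measure = density (hausdorff_measure 1) (indicator (sphere 0 1))"

lemma sets_circle_measure [simp, measurable_cong]: "sets circle_measure = sets borel"
  and space_circle_measure [simp]: "space circle_measure = UNIV"
  by (simp_all add: circle_measure_def)

lemma nn_integral_circle:
  assumes [measurable]: "F \<in> borel_measurable borel"
  shows "(\<integral>\<^sup>+\<omega>. F \<omega> \<partial>circle_measure) = (\<integral>\<^sup>+\<omega>. indicator (sphere 0 1) \<omega> * F \<omega> \<partial>hausdorff_measure 1)"
  unfolding circle_measure_def by (subst nn_integral_density) simp_all

lemma sphere_image: "\<rho> > 0 \<Longrightarrow> (\<lambda>x. \<rho> *\<^sub>R x) ` sphere 0 1 = sphere (0 :: real ^ 2) \<rho>"
proof (intro equalityI subsetI)
  fix x :: "real ^ 2" assume "\<rho> > 0" "x \<in> sphere 0 \<rho>"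
  then show "x \<in> (\<lambda>x. \<rho> *\<^sub>R x) ` sphere 0 1" by (intro image_eqI[of _ _ "(1 / \<rho>) *\<^sub>R x"]) auto
qed auto

text \<open>The circle is covered by the image of a segment of a coordinate axis under the map
  with coordinates cosine and sine.\<close>

lemma circle_finite: "hausdorff_outer 1 (sphere (0 :: real ^ 2) 1) < top"
proof -
  \<comment> \<open>The bound \<open>8\<close> exceeds \<open>2 \<pi>\<close>.\<close>
  define S where "S = {x :: real ^ 2. x \<bullet> e2 = 0 \<and> (\<forall>j\<in>Basis. \<bar>x \<bullet> j\<bar> < 8)}"
  define f :: "real ^ 2 \<Rightarrow> real ^ 2" where "f x = cos (x $ 1) *\<^sub>R e1 + sin (x $ 1) *\<^sub>R e2" for x
  have fn: "f x $ 1 = cos (x $ 1)" "f x $ 2 = sin (x $ 1)" for x by (simp_all add: f_def axis_def)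
  have "sphere 0 1 \<subseteq> f ` S"
  proof
    fix y :: "real ^ 2" assume "y \<in> sphere 0 1"
    then have "(y $ 1)\<^sup>2 + (y $ 2)\<^sup>2 = 1"
      using power2_norm_eq_inner[of y] by (simp add: inner_vec_def sum_2 power2_eq_square)
    then obtain t where t: "0 \<le> t" "t < 2 * pi" "y $ 1 = cos t" "y $ 2 = sin t" by (rule sincos_total_2pi)
    have "t < 8" using t pi_less_4 by linarith
    have "t *\<^sub>R e1 \<in> S"
      unfolding S_def
    proof (intro CollectI conjI ballI)
      show "(t *\<^sub>R e1) \<bullet> e2 = 0" by (simp add: inner_axis_axis)
      fix j :: "real ^ 2" assume "j \<in> Basis"
      then have "\<bar>(t *\<^sub>R e1) \<bullet> j\<bar> \<le> norm (t *\<^sub>R e1)" by (rule Basis_le_norm)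
      then show "\<bar>(t *\<^sub>R e1) \<bullet> j\<bar> < 8" using t \<open>t < 8\<close> by simp
    qed
    moreover have "f (t *\<^sub>R e1) = y" using t by (simp add: vec_eq_iff forall_2 fn)
    ultimately show "y \<in> f ` S" by blast
  qed
  then have "hausdorff_outer 1 (sphere (0 :: real ^ 2) 1) \<le> hausdorff_outer 1 (f ` S)" by (rule outer_mono)
  also have "\<dots> \<le> ennreal (2 ^ 1) * hausdorff_outer 1 S"
  proof (rule outer_Lipschitz_image)
    fix x y :: "real ^ 2"
    have c: "\<bar>cos a - cos b\<bar> \<le> \<bar>a - b\<bar>" and s: "\<bar>sin a - sin b\<bar> \<le> \<bar>a - b\<bar>" for a b :: real
      using field_differentiable_bound[of UNIV cos "\<lambda>x. - sin x" 1 a b]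
        field_differentiable_bound[of UNIV sin "\<lambda>x. cos x" 1 a b]
      by (auto intro: DERIV_cos DERIV_sin)
    have "dist (f x) (f y) \<le> \<bar>cos (x $ 1) - cos (y $ 1)\<bar> + \<bar>sin (x $ 1) - sin (y $ 1)\<bar>"
      using norm_le_l1_cart[of "f x - f y"] by (simp add: dist_norm sum_2 fn)
    also have "\<dots> \<le> \<bar>x $ 1 - y $ 1\<bar> + \<bar>x $ 1 - y $ 1\<bar>" by (intro add_mono c s)
    also have "\<dots> \<le> 2 * dist x y" using component_le_norm_cart[of "x - y" 1] by (simp add: dist_norm)
    finally show "dist (f x) (f y) \<le> 2 * dist x y" .
  qed simp
  also have "\<dots> < top"
    using hyperplane_cube_finite[of e2 8, unfolded DIM_plane] by (simp add: S_def ennreal_mult_less_top axes)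
  finally show ?thesis .
qed

text \<open>The projection to the first axis does not increase distances and maps the circle
  onto a set that contains the unit segment.\<close>

lemma circle_pos: "0 < hausdorff_outer 1 (sphere (0 :: real ^ 2) 1)"
proof -
  define f :: "real ^ 2 \<Rightarrow> real ^ 2" where "f x = (x $ 1) *\<^sub>R e1" for x
  have fn: "f x $ 1 = x $ 1" "f x $ 2 = 0" for x by (simp_all add: f_def axis_def)
  have "unit_face e2 \<subseteq> f ` sphere 0 1"
  proof
    fix y assume y: "y \<in> unit_face e2"
    have "e1 \<in> Basis - {e2}" by (auto simp: axes axis_eq_axis)
    then have "0 \<le> y \<bullet> e1" "y \<bullet> e1 \<le> 1" "y \<bullet> e2 = 0" using y unfolding unit_face_def by blast+
    then have y1: "0 \<le> y $ 1" "y $ 1 \<le> 1" and y2: "y $ 2 = 0" by (simp_all add: inner_axis)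
    define x where "x = y + sqrt (1 - (y $ 1)\<^sup>2) *\<^sub>R e2"
    have xn: "x $ 1 = y $ 1" "x $ 2 = sqrt (1 - (y $ 1)\<^sup>2)" by (simp_all add: x_def y2 axis_def)
    have "(y $ 1)\<^sup>2 \<le> 1" using y1 by (simp add: power_le_one)
    then have "x \<in> sphere 0 1" by (simp add: norm_eq_1 inner_vec_def sum_2 xn power2_eq_square[symmetric])
    moreover have "f x = y" by (simp add: vec_eq_iff forall_2 fn xn y2)
    ultimately show "y \<in> f ` sphere 0 1" by blast
  qed
  have "0 < hausdorff_outer (DIM(real ^ 2) - 1) (unit_face e2)" by (rule unit_face_pos) (rule axes)
  also have "\<dots> \<le> hausdorff_outer 1 (f ` sphere 0 1)"
    unfolding DIM_plane by (rule outer_mono) fact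
  also have "\<dots> \<le> ennreal (1 ^ 1) * hausdorff_outer 1 (sphere (0 :: real ^ 2) 1)"
  proof (rule outer_Lipschitz_image)
    fix x y :: "real ^ 2"
    show "dist (f x) (f y) \<le> 1 * dist x y"
      using norm_le_l1_cart[of "f x - f y"] component_le_norm_cart[of "x - y" 1] by (simp add: dist_norm sum_2 fn)
  qed simp
  finally show ?thesis by simp
qed

definition circle_length :: real where "circle_length = measure circle_measure UNIV"

lemma emeasure_circle_measure: "emeasure circle_measure UNIV = hausdorff_outer 1 (sphere (0 :: real ^ 2) 1)"
proof -
  have "emeasure circle_measure UNIV = (\<integral>\<^sup>+\<omega>. 1 \<partial>circle_measure)" by simp
  also have "\<dots> = (\<integral>\<^sup>+\<omega>. indicator (sphere (0 :: real ^ 2) 1) \<omega> \<partial>hausdorff_measure 1)" by (subst nn_integral_circle) simp_all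
  finally show ?thesis by (simp add: emeasure_hausdorff_measure)
qed

lemma finite_circle_measure: "finite_measure circle_measure"
  by standard (use circle_finite in \<open>simp add: emeasure_circle_measure\<close>)

lemma circle_length: "emeasure circle_measure UNIV = ennreal circle_length" "0 < circle_length"
proof -
  interpret finite_measure circle_measure by (rule finite_circle_measure)
  show 1: "emeasure circle_measure UNIV = ennreal circle_length" by (simp add: circle_length_def emeasure_eq_measure)
  have "0 < ennreal circle_length" unfolding 1[symmetric] emeasure_circle_measure by (rule circle_pos)
  then show "0 < circle_length" by (simp add: ennreal_less_zero_iff)
qed

lemma circle_measure_rot:
  assumes w: "norm w = 1" and [measurable]: "F \<in> borel_measurable borel"
  shows "(\<integral>\<^sup>+\<omega>. F (rot w \<omega>) \<partial>circle_measure) = (\<integral>\<^sup>+\<omega>. F \<omega> \<partial>circle_measure)"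
proof -
  have [measurable]: "rot w \<in> borel_measurable borel"
    by (intro borel_measurable_continuous_onI continuous_intros)
  have "(\<integral>\<^sup>+\<omega>. F \<omega> \<partial>circle_measure) = (\<integral>\<^sup>+\<omega>. indicator (sphere 0 1) \<omega> * F \<omega> \<partial>distr (hausdorff_measure 1) borel (rot w))"
    by (subst hausdorff_measure_distr_isometry) (auto simp: nn_integral_circle dist_rot w surj_rot)
  also have "\<dots> = (\<integral>\<^sup>+\<omega>. indicator (sphere 0 1) (rot w \<omega>) * F (rot w \<omega>) \<partial>hausdorff_measure 1)"
    by (subst nn_integral_distr) simp_all
  also have "\<dots> = (\<integral>\<^sup>+\<omega>. indicator (sphere 0 1) \<omega> * F (rot w \<omega>) \<partial>hausdorff_measure 1)"
    by (intro nn_integral_cong) (simp add: norm_rot w indicator_def)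
  finally show ?thesis by (simp add: nn_integral_circle)
qed

text \<open>Both sides give the area of a disc to every initial segment.\<close>

lemma lborel_distr_norm:
  "distr (lborel :: (real ^ 2) measure) borel norm = density lborel (\<lambda>t. ennreal (2 * pi * t) * indicator {0..} t)"
proof (rule measure_eqI_generator_eq[where E="range (\<lambda>a::real. {..a})" and \<Omega>=UNIV and A="\<lambda>i. {..real i}"])
  show "Int_stable (range (\<lambda>a::real. {..a}))" by (auto simp: Int_stable_def intro: image_eqI[where x="min _ _"])
  show "sets (distr (lborel :: (real ^ 2) measure) borel norm) = sigma_sets UNIV (range (\<lambda>a::real. {..a}))"
    "sets (density lborel (\<lambda>t. ennreal (2 * pi * t) * indicator {0..} t)) = sigma_sets UNIV (range (\<lambda>a::real. {..a}))"
    by (simp_all add: borel_eq_atMost)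
  have lhs: "emeasure (distr (lborel :: (real ^ 2) measure) borel norm) {..b} = ennreal (if 0 \<le> b then pi * b\<^sup>2 else 0)" for b
  proof -
    have "norm -` {..b} = cball (0 :: real ^ 2) b" by auto
    then have "emeasure (distr (lborel :: (real ^ 2) measure) borel norm) {..b} = emeasure lborel (cball (0 :: real ^ 2) b)"
      by (simp add: emeasure_distr)
    then show ?thesis by (auto simp: emeasure_cball unit_ball_vol_2)
  qed
  have rhs: "emeasure (density lborel (\<lambda>t. ennreal (2 * pi * t) * indicator {0..} t)) {..b} = ennreal (if 0 \<le> b then pi * b\<^sup>2 else 0)" for b
  proof -
    have "emeasure (density lborel (\<lambda>t. ennreal (2 * pi * t) * indicator {0..} t)) {..b}
        = (\<integral>\<^sup>+t. ennreal (2 * pi * t) * indicator {0..} t * indicator {..b} t \<partial>lborel)"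
      by (rule emeasure_density) simp_all
    also have "\<dots> = (\<integral>\<^sup>+t. ennreal (2 * pi * t) * indicator {0..b} t \<partial>lborel)"
      by (intro nn_integral_cong) (auto split: split_indicator)
    also have "\<dots> = ennreal (if 0 \<le> b then pi * b\<^sup>2 else 0)"
    proof (cases "0 \<le> b")
      case True
      have "(\<integral>\<^sup>+t. ennreal (2 * pi * t) * indicator {0..b} t \<partial>lborel) = ennreal (pi * b\<^sup>2 - pi * 0\<^sup>2)"
        by (rule nn_integral_FTC_Icc) (use True in \<open>auto intro!: derivative_eq_intros\<close>)
      then show ?thesis using True by simp
    qed simp
    finally show ?thesis .
  qed
  fix X assume "X \<in> range (\<lambda>a::real. {..a})"
  then show "emeasure (distr (lborel :: (real ^ 2) measure) borel norm) X = emeasure (density lborel (\<lambda>t. ennreal (2 * pi * t) * indicator {0..} t)) X"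
    using lhs rhs by auto
next
  show "(\<Union>i. {..real i}) = UNIV" using real_arch_simple by auto
  fix i
  have "emeasure (distr (lborel :: (real ^ 2) measure) borel norm) {..real i} = emeasure lborel (norm -` {..real i} :: (real ^ 2) set)"
    by (simp add: emeasure_distr)
  also have "norm -` {..real i} = cball (0 :: real ^ 2) (real i)" by auto
  finally show "emeasure (distr (lborel :: (real ^ 2) measure) borel norm) {..real i} \<noteq> \<infinity>"
    using emeasure_lborel_cball_finite[of "0 :: real ^ 2" "real i"] by (metis infinity_ennreal_def less_irrefl)
qed auto

definition radial_measure :: "real measure" where
  "radial_measure = density lborel (\<lambda>t. ennreal (2 * pi * t) * indicator {0..} t)"

lemma sets_radial_measure [simp, measurable_cong]: "sets radial_measure = sets borel"
  and space_radial_measure [simp]: "space radial_measure = UNIV"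
  by (simp_all add: radial_measure_def)

lemma sigma_finite_radial: "sigma_finite_measure radial_measure"
proof (rule sigma_finite_bounded_sets)
  fix A :: "real set" assume A: "A \<in> sets borel" "bounded A"
  obtain R where R: "A \<subseteq> ball 0 R" using A(2) bounded_subset_ballD[of A 0] by blast
  have "emeasure radial_measure A \<le> emeasure radial_measure (ball 0 R)" using R by (intro emeasure_mono) auto
  also have "\<dots> = emeasure lborel (norm -` ball 0 R :: (real ^ 2) set)"
    unfolding radial_measure_def lborel_distr_norm[symmetric] by (simp add: emeasure_distr)
  also have "norm -` ball 0 R = ball (0 :: real ^ 2) R" by auto
  also have "emeasure lborel (ball (0 :: real ^ 2) R) < top" using emeasure_lborel_ball_finite[of 0 R] by simp
  finally show "emeasure radial_measure A < top" .
qed simp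

text \<open>Both measures are rotation invariant: averaged over all rotations
  \<open>\<omega>\<close>, the indicator of \<open>A\<close> at \<open>rot \<omega> x\<close>
  depends on \<open>x\<close> only through its norm, because \<open>rot \<omega> x\<close> is
  \<open>norm x\<close> times a rotated copy of \<open>\<omega>\<close>. The average is weighted
  with the total length of the circle, which becomes the factor.\<close>

theorem polar_coordinates:
  "distr (circle_measure \<Otimes>\<^sub>M radial_measure) borel (\<lambda>(\<omega>, t). t *\<^sub>R \<omega>) = density lborel (\<lambda>_. ennreal circle_length)"
proof (rule measure_eqI)
  interpret C: finite_measure circle_measure by (rule finite_circle_measure)
  interpret R: sigma_finite_measure radial_measure by (rule sigma_finite_radial)
  interpret CR: pair_sigma_finite circle_measure radial_measure ..
  interpret CL: pair_sigma_finite circle_measure "lborel :: (real ^ 2) measure" ..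
  fix A assume "A \<in> sets (distr (circle_measure \<Otimes>\<^sub>M radial_measure) borel (\<lambda>(\<omega>, t). t *\<^sub>R \<omega>))"
  then have [measurable]: "A \<in> sets borel" by simp
  let ?F = "indicator A :: real ^ 2 \<Rightarrow> ennreal"
  have [measurable]: "rot w \<in> borel_measurable borel" for w
    by (intro borel_measurable_continuous_onI continuous_intros)
  have "emeasure (density lborel (\<lambda>_. ennreal circle_length)) A = emeasure lborel A * emeasure circle_measure UNIV"
    by (simp add: emeasure_density nn_integral_cmult_indicator circle_length mult.commute)
  also have "\<dots> = (\<integral>\<^sup>+\<omega>. emeasure lborel A \<partial>circle_measure)" by simp
  also have "\<dots> = (\<integral>\<^sup>+\<omega>. (\<integral>\<^sup>+x. ?F (rot \<omega> x) \<partial>lborel) \<partial>circle_measure)"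
  proof -
    have cong: "(\<integral>\<^sup>+\<omega>. G \<omega> \<partial>circle_measure) = (\<integral>\<^sup>+\<omega>. H \<omega> \<partial>circle_measure)"
      if "\<And>\<omega>. norm \<omega> = 1 \<Longrightarrow> G \<omega> = H \<omega>" "G \<in> borel_measurable borel" "H \<in> borel_measurable borel" for G H :: "real ^ 2 \<Rightarrow> ennreal"
      using that by (subst (1 2) nn_integral_circle) (auto intro!: nn_integral_cong split: split_indicator)
    moreover have "emeasure lborel A = (\<integral>\<^sup>+x. ?F (rot \<omega> x) \<partial>lborel)" if "norm \<omega> = 1" for \<omega>
    proof -
      have "emeasure lborel A = (\<integral>\<^sup>+x. ?F x \<partial>distr lborel borel (rot \<omega>))" by (simp add: lborel_distr_rot[OF that])
      also have "\<dots> = (\<integral>\<^sup>+x. ?F (rot \<omega> x) \<partial>lborel)" by (rule nn_integral_distr) simp_all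
      finally show ?thesis .
    qed
    moreover have "(\<lambda>\<omega>. \<integral>\<^sup>+x. ?F (rot \<omega> x) \<partial>lborel) \<in> borel_measurable borel" by measurable
    ultimately show ?thesis by (intro cong) simp_all
  qed
  also have "\<dots> = (\<integral>\<^sup>+x. (\<integral>\<^sup>+\<omega>. ?F (rot \<omega> x) \<partial>circle_measure) \<partial>lborel)"
    by (rule CL.Fubini'[symmetric]) measurable
  also have "\<dots> = (\<integral>\<^sup>+x. (\<integral>\<^sup>+\<omega>. ?F (norm (x :: real ^ 2) *\<^sub>R \<omega>) \<partial>circle_measure) \<partial>lborel)"
  proof (rule nn_integral_cong)
    fix x :: "real ^ 2"
    show "(\<integral>\<^sup>+\<omega>. ?F (rot \<omega> x) \<partial>circle_measure) = (\<integral>\<^sup>+\<omega>. ?F (norm x *\<^sub>R \<omega>) \<partial>circle_measure)"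
    proof (cases "x = 0")
      case True
      have "rot \<omega> 0 = 0" for \<omega> by (simp add: vec_eq_iff forall_2 rot_nth)
      then show ?thesis using True by simp
    next
      case False
      define w where "w = (1 / norm x) *\<^sub>R x"
      have w: "norm w = 1" "x = norm x *\<^sub>R w" using False by (simp_all add: w_def)
      have "rot \<omega> x = norm x *\<^sub>R rot w \<omega>" for \<omega>
        using w(2) rot_scaleR[of "norm x" w \<omega>] rot_commute[of \<omega> x] by simp
      then show ?thesis using circle_measure_rot[OF w(1), of "\<lambda>\<omega>. ?F (norm x *\<^sub>R \<omega>)"] by simp
    qed
  qed
  also have "\<dots> = (\<integral>\<^sup>+t. (\<integral>\<^sup>+\<omega>. ?F (t *\<^sub>R \<omega>) \<partial>circle_measure) \<partial>distr (lborel :: (real ^ 2) measure) borel norm)"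
    by (subst nn_integral_distr) simp_all
  also have "\<dots> = (\<integral>\<^sup>+t. (\<integral>\<^sup>+\<omega>. ?F (t *\<^sub>R \<omega>) \<partial>circle_measure) \<partial>radial_measure)"
    by (simp add: lborel_distr_norm radial_measure_def)
  also have "\<dots> = (\<integral>\<^sup>+z. ?F (snd z *\<^sub>R fst z) \<partial>(circle_measure \<Otimes>\<^sub>M radial_measure))"
    by (subst CR.nn_integral_snd[symmetric]) simp_all
  also have "\<dots> = (\<integral>\<^sup>+z. ?F z \<partial>distr (circle_measure \<Otimes>\<^sub>M radial_measure) borel (\<lambda>(\<omega>, t). t *\<^sub>R \<omega>))"
    by (subst nn_integral_distr) (simp_all add: case_prod_beta)
  also have "\<dots> = emeasure (distr (circle_measure \<Otimes>\<^sub>M radial_measure) borel (\<lambda>(\<omega>, t). t *\<^sub>R \<omega>)) A" by simp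
  finally show "emeasure (distr (circle_measure \<Otimes>\<^sub>M radial_measure) borel (\<lambda>(\<omega>, t). t *\<^sub>R \<omega>)) A
      = emeasure (density lborel (\<lambda>_. ennreal circle_length)) A" ..
qed simp

lemma hausdorff_measure_scaling:
  assumes \<rho>: "0 < \<rho>"
  shows "density (distr (hausdorff_measure 1 :: (real ^ 2) measure) borel (\<lambda>x. \<rho> *\<^sub>R x)) (\<lambda>_. ennreal \<rho>) = hausdorff_measure 1"
proof (rule measure_eqI)
  fix A assume "A \<in> sets (density (distr (hausdorff_measure 1 :: (real ^ 2) measure) borel (\<lambda>x. \<rho> *\<^sub>R x)) (\<lambda>_. ennreal \<rho>))"
  then have A [measurable]: "A \<in> sets borel" by simp
  have pre: "(\<lambda>x. \<rho> *\<^sub>R x) -` A \<in> sets borel"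
    using measurable_sets[of "\<lambda>x. \<rho> *\<^sub>R x" borel borel A] by simp
  have "(\<lambda>x. \<rho> *\<^sub>R x) ` ((\<lambda>x. \<rho> *\<^sub>R x) -` A) = A"
  proof (rule surj_image_vimage_eq)
    show "surj (\<lambda>x :: real ^ 2. \<rho> *\<^sub>R x)" by (rule surjI[of _ "\<lambda>x. (1 / \<rho>) *\<^sub>R x"]) (use \<rho> in simp)
  qed
  then have "hausdorff_outer 1 A = ennreal \<rho> * hausdorff_outer 1 ((\<lambda>x. \<rho> *\<^sub>R x) -` A)"
    using outer_similarity_image[of \<rho> "\<lambda>x. \<rho> *\<^sub>R x" 1 "(\<lambda>x. \<rho> *\<^sub>R x) -` A"] \<rho>
    by (simp add: dist_scale)
  then show "emeasure (density (distr (hausdorff_measure 1) borel (\<lambda>x. \<rho> *\<^sub>R x)) (\<lambda>_. ennreal \<rho>)) A = emeasure (hausdorff_measure 1) A"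
    by (simp add: emeasure_density_const emeasure_distr emeasure_hausdorff_measure pre)
qed simp

definition circle_integral :: "(real ^ 2 \<Rightarrow> real) \<Rightarrow> real \<Rightarrow> real" where
  "circle_integral f t = (\<integral>\<omega>. indicator (sphere 0 1) \<omega> *\<^sub>R f (t *\<^sub>R \<omega>) \<partial>hausdorff_measure 1)"

lemma sphere_integral:
  assumes \<rho>: "0 < \<rho>" and f: "(\<lambda>x. indicator (sphere 0 \<rho>) x *\<^sub>R f x) \<in> borel_measurable borel"
  shows "(\<integral>x. indicator (sphere 0 \<rho>) x *\<^sub>R f x \<partial>hausdorff_measure 1) = \<rho> * circle_integral f \<rho>"
proof -
  let ?H = "hausdorff_measure 1 :: (real ^ 2) measure"
  have "(\<integral>x. indicator (sphere 0 \<rho>) x *\<^sub>R f x \<partial>?H) = (\<integral>x. indicator (sphere 0 \<rho>) x *\<^sub>R f x \<partial>density (distr ?H borel (\<lambda>x. \<rho> *\<^sub>R x)) (\<lambda>_. ennreal \<rho>))"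
    by (simp add: hausdorff_measure_scaling[OF \<rho>])
  also have "\<dots> = (\<integral>x. \<rho> *\<^sub>R (indicator (sphere 0 \<rho>) x *\<^sub>R f x) \<partial>distr ?H borel (\<lambda>x. \<rho> *\<^sub>R x))"
    by (rule integral_density) (use f \<rho> in auto)
  also have "\<dots> = (\<integral>y. \<rho> *\<^sub>R (indicator (sphere 0 \<rho>) (\<rho> *\<^sub>R y) *\<^sub>R f (\<rho> *\<^sub>R y)) \<partial>?H)"
    by (rule integral_distr) (use f in auto)
  also have "\<dots> = (\<integral>y. \<rho> *\<^sub>R (indicator (sphere 0 1) y *\<^sub>R f (\<rho> *\<^sub>R y)) \<partial>?H)"
    by (rule Bochner_Integration.integral_cong) (use \<rho> in \<open>auto simp: indicator_def\<close>)
  finally show ?thesis by (simp add: circle_integral_def)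
qed

lemma sphere_finite:
  assumes "0 < \<rho>" shows "emeasure (hausdorff_measure 1) (sphere (0 :: real ^ 2) \<rho>) < top"
  using outer_similarity_image[of \<rho> "\<lambda>x. \<rho> *\<^sub>R x" 1 "sphere (0 :: real ^ 2) 1"] assms circle_finite
  by (simp add: emeasure_hausdorff_measure sphere_image dist_scale ennreal_mult_less_top)

section \<open>Annuli\<close>

lemma interval_test_deriv_outside:
  assumes \<theta>: "interval_test a b \<theta> \<theta>'"
  obtains \<alpha> \<beta> where "a < \<alpha>" "\<beta> < b" "\<And>t. t \<notin> {\<alpha>..\<beta>} \<Longrightarrow> \<theta> t = 0 \<and> \<theta>' t = 0"
proof -
  obtain \<alpha> \<beta> where ab: "a < \<alpha>" "\<beta> < b" "\<And>t. t \<notin> {\<alpha>..\<beta>} \<Longrightarrow> \<theta> t = 0"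
    and D: "\<And>t. DERIV \<theta> t :> \<theta>' t" using \<theta> unfolding interval_test_def by blast
  have "\<theta>' t = 0" if t: "t \<notin> {\<alpha>..\<beta>}" for t
  proof -
    have "DERIV (\<lambda>_. 0) t :> (0::real)" by simp
    then have "DERIV \<theta> t :> 0"
      by (rule has_field_derivative_transform_within_open[where S="- {\<alpha>..\<beta>}"]) (use t ab(3) in auto)
    then show ?thesis using D DERIV_unique by blast
  qed
  then show thesis using that ab by blast
qed

context
  fixes r R :: real
  assumes r: "0 < r" and rR: "r < R"
begin

definition annulus :: "(real ^ 2) set" where "annulus = {x. r < norm x \<and> norm x < R}"

definition closed_annulus :: "(real ^ 2) set" where "closed_annulus = {x. r \<le> norm x \<and> norm x \<le> R}"

lemma annulus_open: "open annulus"
  unfolding annulus_def by (intro open_Collect_conj open_Collect_less continuous_intros)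

lemma closed_annulus_compact: "compact closed_annulus"
proof -
  have "closed closed_annulus" unfolding closed_annulus_def
    by (intro closed_Collect_conj closed_Collect_le continuous_intros)
  then show ?thesis by (rule compact_if_closed_subset[of _ "cball 0 R"]) (auto simp: closed_annulus_def)
qed

lemma annulus_bounded: "bounded annulus"
  by (rule bounded_subset[of "ball 0 R"]) (auto simp: annulus_def)

lemma closure_annulus: "closure annulus = closed_annulus"
proof
  show "closure annulus \<subseteq> closed_annulus"
    by (rule closure_minimal) (auto simp: annulus_def closed_annulus_def closed_annulus_compact[unfolded closed_annulus_def] intro!: compact_imp_closed)
  show "closed_annulus \<subseteq> closure annulus"
  proof
    fix x assume x: "x \<in> closed_annulus"
    show "x \<in> closure annulus" unfolding closure_approachable
    proof (intro allI impI)
      fix e :: real assume e: "0 < e"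
      have "max r (norm x - e) < min R (norm x + e)" using x e rR by (auto simp: closed_annulus_def)
      then obtain s where s: "max r (norm x - e) < s" "s < min R (norm x + e)" using dense by blast
      have nx: "0 < norm x" using x r by (auto simp: closed_annulus_def)
      define y where "y = (s / norm x) *\<^sub>R x"
      have "norm y = s" using s r nx by (simp add: y_def)
      moreover have "dist y x = \<bar>s - norm x\<bar>"
      proof -
        have "y - x = ((s - norm x) / norm x) *\<^sub>R x" using nx by (simp add: y_def diff_divide_distrib scaleR_diff_left)
        then show ?thesis using nx by (simp add: dist_norm)
      qed
      ultimately show "\<exists>y\<in>annulus. dist y x < e" using s by (intro bexI[of _ y]) (auto simp: annulus_def)
    qed
  qed
qed

lemma frontier_annulus: "frontier annulus = sphere 0 r \<union> sphere 0 R"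
  unfolding frontier_def closure_annulus interior_open[OF annulus_open]
  using rR by (auto simp: annulus_def closed_annulus_def)

lemma circle_integral_continuous:
  assumes f: "continuous_on closed_annulus f"
  shows "continuous_on {r..R} (circle_integral f)"
proof -
  have "continuous_on ({r..R} \<times> sphere 0 1) (\<lambda>(t, y). f (t *\<^sub>R y))"
    unfolding case_prod_beta
  proof (rule continuous_on_compose2[OF f])
    show "(\<lambda>p. fst p *\<^sub>R snd p) ` ({r..R} \<times> sphere 0 1) \<subseteq> closed_annulus"
      using r by (auto simp: closed_annulus_def)
  qed (intro continuous_intros)
  then show ?thesis
    unfolding circle_integral_def using circle_finite
    by (intro continuous_on_set_integral_param(1)) (auto simp: emeasure_hausdorff_measure)
qed

text \<open>Polar coordinates; the Jacobian \<open>2 \<pi> t\<close> cancels against the weight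
  \<open>1 / norm x\<close>.\<close>

lemma annulus_slicing:
  assumes f: "continuous_on closed_annulus f" and k: "continuous_on UNIV k"
  shows "circle_length / (2 * pi) * (\<integral>x. f x * (k (norm x) / norm x) \<partial>lebesgue_on annulus) = (LINT t:{r..R}|lborel. circle_integral f t * k t)"
proof -
  interpret C: finite_measure circle_measure by (rule finite_circle_measure)
  interpret R: sigma_finite_measure radial_measure by (rule sigma_finite_radial)
  interpret CR: pair_sigma_finite circle_measure radial_measure ..
  let ?C = closed_annulus
  define h where "h x = indicator ?C x *\<^sub>R (f x * (k (norm x) / norm x))" for x
  have sub: "annulus \<subseteq> ?C" by (auto simp: annulus_def closed_annulus_def)
  have ch: "continuous_on ?C (\<lambda>x. f x * (k (norm x) / norm x))"
    using r by (intro continuous_intros f continuous_on_compose2[OF k]) (auto simp: closed_annulus_def)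
  have ih: "integrable lborel h" unfolding h_def by (rule borel_integrable_compact[OF closed_annulus_compact ch])
  then have [measurable]: "h \<in> borel_measurable borel" by simp
  have "(\<integral>x. f x * (k (norm x) / norm x) \<partial>lebesgue_on annulus) = (\<integral>x. indicator annulus x *\<^sub>R (f x * (k (norm x) / norm x)) \<partial>lborel)"
    by (intro integral_lebesgue_on_borel(1) open_indicator_measurable annulus_open continuous_on_subset[OF ch sub] borel_open)
  also have "\<dots> = (\<integral>x. h x \<partial>lborel)"
  proof (rule integral_cong_AE)
    show "(\<lambda>x. indicator annulus x *\<^sub>R (f x * (k (norm x) / norm x))) \<in> borel_measurable lborel"
      using open_indicator_measurable[OF annulus_open continuous_on_subset[OF ch sub]] by simp
    have "AE x in lborel. x \<notin> sphere (0 :: real ^ 2) s" for s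
      using negligible_sphere[of 0 s] by (intro AE_not_in) (auto simp: negligible_iff_emeasure0 null_sets_def)
    from this[of r] this[of R] show "AE x in lborel. indicator annulus x *\<^sub>R (f x * (k (norm x) / norm x)) = h x"
      by eventually_elim (auto simp: h_def annulus_def closed_annulus_def split: split_indicator)
  qed simp
  finally have "circle_length * (\<integral>x. f x * (k (norm x) / norm x) \<partial>lebesgue_on annulus) = (\<integral>x. h x \<partial>density lborel (\<lambda>_. ennreal circle_length))"
    using circle_length(2) by (simp add: integral_density)
  also have "\<dots> = (\<integral>x. h x \<partial>distr (circle_measure \<Otimes>\<^sub>M radial_measure) borel (\<lambda>(\<omega>, t). t *\<^sub>R \<omega>))" by (simp add: polar_coordinates)
  also have "\<dots> = (\<integral>z. h (snd z *\<^sub>R fst z) \<partial>(circle_measure \<Otimes>\<^sub>M radial_measure))"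
    by (subst integral_distr) (auto simp: case_prod_beta)
  also have "\<dots> = (\<integral>t. (\<integral>\<omega>. h (t *\<^sub>R \<omega>) \<partial>circle_measure) \<partial>radial_measure)"
  proof -
    have "integrable (density lborel (\<lambda>_. ennreal circle_length)) h" using ih circle_length(2) by (subst integrable_density) auto
    then have "integrable (distr (circle_measure \<Otimes>\<^sub>M radial_measure) borel (\<lambda>(\<omega>, t). t *\<^sub>R \<omega>)) h" by (simp add: polar_coordinates)
    then have "integrable (circle_measure \<Otimes>\<^sub>M radial_measure) (\<lambda>z. h (case z of (\<omega>, t) \<Rightarrow> t *\<^sub>R \<omega>))"
      by (subst (asm) integrable_distr_eq) auto
    then have "integrable (circle_measure \<Otimes>\<^sub>M radial_measure) (\<lambda>(\<omega>, t). h (t *\<^sub>R \<omega>))" by (simp add: case_prod_unfold)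
    from CR.integral_snd[OF this] show ?thesis by (simp add: case_prod_unfold)
  qed
  also have "\<dots> = (\<integral>t. 2 * pi * max 0 t * (\<integral>\<omega>. h (t *\<^sub>R \<omega>) \<partial>circle_measure) \<partial>lborel)"
  proof -
    have "radial_measure = density lborel (\<lambda>t. ennreal (2 * pi * max 0 t))"
      unfolding radial_measure_def by (intro density_cong) (auto simp: max_def split: split_indicator)
    note radial_eq = this
    have "(\<lambda>t. \<integral>\<omega>. h (t *\<^sub>R \<omega>) \<partial>circle_measure) \<in> borel_measurable lborel" by measurable
    then show ?thesis unfolding radial_eq by (subst integral_density) simp_all
  qed
  also have "\<dots> = (\<integral>t. 2 * pi * (indicator {r..R} t *\<^sub>R (circle_integral f t * k t)) \<partial>lborel)"
  proof (rule Bochner_Integration.integral_cong[OF refl])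
    fix t :: real
    have "(\<integral>\<omega>. h (t *\<^sub>R \<omega>) \<partial>circle_measure) = (\<integral>\<omega>. indicator (sphere 0 1) \<omega> *\<^sub>R h (t *\<^sub>R \<omega>) \<partial>hausdorff_measure 1)"
    proof -
      have "circle_measure = density (hausdorff_measure 1) (\<lambda>x. ennreal (indicator (sphere 0 1) x))"
        by (simp add: circle_measure_def ennreal_indicator)
      then have "(\<integral>\<omega>. h (t *\<^sub>R \<omega>) \<partial>circle_measure) = (\<integral>\<omega>. h (t *\<^sub>R \<omega>) \<partial>density (hausdorff_measure 1) (\<lambda>x. ennreal (indicator (sphere 0 1) x)))"
        by (rule arg_cong)
      also have "\<dots> = (\<integral>\<omega>. indicator (sphere 0 1) \<omega> *\<^sub>R h (t *\<^sub>R \<omega>) \<partial>hausdorff_measure 1)"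
        by (rule integral_density) simp_all
      finally show ?thesis .
    qed
    \<comment> \<open>Also negative \<open>t\<close> parametrise points of the annulus; the
      Jacobian \<open>max 0 t\<close> removes them.\<close>
    also have "\<dots> = (\<integral>\<omega>. (if \<bar>t\<bar> \<in> {r..R} then k \<bar>t\<bar> / \<bar>t\<bar> else 0) * (indicator (sphere 0 1) \<omega> *\<^sub>R f (t *\<^sub>R \<omega>)) \<partial>hausdorff_measure 1)"
      by (rule Bochner_Integration.integral_cong) (auto simp: h_def closed_annulus_def split: split_indicator)
    also have "\<dots> = (if \<bar>t\<bar> \<in> {r..R} then k \<bar>t\<bar> / \<bar>t\<bar> else 0) * circle_integral f t"
      unfolding circle_integral_def by (rule integral_mult_right_zero)
    finally show "2 * pi * max 0 t * (\<integral>\<omega>. h (t *\<^sub>R \<omega>) \<partial>circle_measure) = 2 * pi * (indicator {r..R} t *\<^sub>R (circle_integral f t * k t))"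
      using r by (cases "t > 0") (auto simp: max_def split: split_indicator)
  qed
  also have "\<dots> = 2 * pi * (LINT t:{r..R}|lborel. circle_integral f t * k t)"
    unfolding set_lebesgue_integral_def by (rule integral_mult_right_zero)
  finally show ?thesis by (simp add: field_simps)
qed

lemma annulus_surface_finite: "finite_measure (surface_measure annulus)"
proof
  have "emeasure (surface_measure annulus) (space (surface_measure annulus)) = emeasure (hausdorff_measure 1) (frontier annulus)"
    unfolding surface_measure_def DIM_plane by (simp add: emeasure_restrict_space space_restrict_space)
  also have "\<dots> \<le> emeasure (hausdorff_measure 1) (sphere (0 :: real ^ 2) r) + emeasure (hausdorff_measure 1) (sphere (0 :: real ^ 2) R)"
    unfolding frontier_annulus by (intro emeasure_subadditive) auto
  also have "\<dots> < top" using sphere_finite r rR by simp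
  finally show "emeasure (surface_measure annulus) (space (surface_measure annulus)) \<noteq> \<infinity>" by simp
qed

lemma annulus_surface_integral:
  assumes f: "continuous_on closed_annulus f"
  shows "(\<integral>x. f x \<partial>surface_measure annulus) = r * circle_integral f r + R * circle_integral f R"
proof -
  let ?H = "hausdorff_measure 1 :: (real ^ 2) measure"
  have sub: "sphere 0 s \<subseteq> closed_annulus" if "s = r \<or> s = R" for s using that rR by (auto simp: closed_annulus_def)
  have int: "integrable ?H (\<lambda>x. indicator (sphere 0 s) x *\<^sub>R f x)" if s: "s = r \<or> s = R" for s
  proof (rule continuous_on_set_integral_param(2)[where h="\<lambda>_. f" and T="{0}" and t=0])
    show "continuous_on ({0} \<times> sphere 0 s) (\<lambda>(t, y). f y)"
      unfolding case_prod_beta using sub[OF s]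
      by (intro continuous_on_compose2[OF f]) (auto intro!: continuous_intros)
    show "emeasure ?H (sphere 0 s) < top" by (rule sphere_finite) (use s r rR in auto)
  qed auto
  have "(\<integral>x. f x \<partial>surface_measure annulus) = (\<integral>x. indicator (frontier annulus) x *\<^sub>R f x \<partial>?H)"
    unfolding surface_measure_def DIM_plane by (rule integral_restrict_space) simp
  also have "\<dots> = (\<integral>x. indicator (sphere 0 r) x *\<^sub>R f x + indicator (sphere 0 R) x *\<^sub>R f x \<partial>?H)"
    unfolding frontier_annulus
    by (rule Bochner_Integration.integral_cong) (use rR in \<open>auto split: split_indicator\<close>)
  also have "\<dots> = (\<integral>x. indicator (sphere 0 r) x *\<^sub>R f x \<partial>?H) + (\<integral>x. indicator (sphere 0 R) x *\<^sub>R f x \<partial>?H)"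
    by (intro Bochner_Integration.integral_add int) auto
  also have "\<dots> = r * circle_integral f r + R * circle_integral f R"
  proof -
    have "(\<integral>x. indicator (sphere 0 s) x *\<^sub>R f x \<partial>?H) = s * circle_integral f s" if s: "s = r \<or> s = R" for s
      using s r rR borel_measurable_integrable[OF int[OF s]] by (intro sphere_integral) (auto simp: measurable_cong_sets[OF sets_hausdorff_measure refl])
    then show ?thesis by simp
  qed
  finally show ?thesis .
qed

text \<open>The field \<open>x / |x|\<^sup>2\<close> is free of divergence in the plane, so the
  divergence of this one is \<open>\<theta>' (norm x) / norm x\<close>.\<close>

definition radial_field :: "(real \<Rightarrow> real) \<Rightarrow> real ^ 2 \<Rightarrow> real ^ 2" where
  "radial_field \<theta> x = (\<theta> (norm x) / (x \<bullet> x)) *\<^sub>R x"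

lemma radial_test_function:
  assumes \<theta>: "interval_test r R \<theta> \<theta>'"
  shows "C1_test_function annulus (\<lambda>x. radial_field \<theta> x \<bullet> j)
    (\<lambda>x. ((x \<bullet> j) * (\<theta>' (norm x) / norm x ^ 3 - 2 * \<theta> (norm x) / (x \<bullet> x)\<^sup>2)) *\<^sub>R x + (\<theta> (norm x) / (x \<bullet> x)) *\<^sub>R j)"
    (is "C1_test_function annulus ?\<phi> ?D")
proof -
  obtain \<alpha> \<beta> where ab: "r < \<alpha>" "\<beta> < R" and out: "\<And>t. t \<notin> {\<alpha>..\<beta>} \<Longrightarrow> \<theta> t = 0 \<and> \<theta>' t = 0"
    using interval_test_deriv_outside[OF \<theta>] by blast
  have D: "\<And>t. DERIV \<theta> t :> \<theta>' t" and c': "continuous_on UNIV \<theta>'" using \<theta> by (auto simp: interval_test_def)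
  define K where "K = {x :: real ^ 2. \<alpha> \<le> norm x \<and> norm x \<le> \<beta>}"
  have Kcl: "closed K" unfolding K_def by (intro closed_Collect_conj closed_Collect_le continuous_intros)
  have Kc: "compact K" by (rule compact_if_closed_subset[OF Kcl, of "cball 0 \<beta>"]) (auto simp: K_def)
  have K0: "K \<subseteq> - {0}" using ab r by (auto simp: K_def)
  have Kan: "K \<subseteq> annulus" using ab by (auto simp: K_def annulus_def)
  have supp: "closure {x. ?\<phi> x \<noteq> 0} \<subseteq> K"
  proof (rule closure_minimal[OF _ Kcl])
    show "{x. ?\<phi> x \<noteq> 0} \<subseteq> K" using out by (force simp: K_def radial_field_def)
  qed
  have outK: "\<theta> (norm x) = 0 \<and> \<theta>' (norm x) = 0" if "x \<notin> K" for x using out[of "norm x"] that by (auto simp: K_def)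
  \<comment> \<open>At the origin the field vanishes in a neighbourhood, and the formula for the
    gradient gives \<open>0\<close> there because quotients by zero are zero.\<close>
  have GD: "GDERIV ?\<phi> x :> ?D x" for x
  proof (cases "x = 0")
    case True
    then have "x \<notin> K" using K0 by auto
    then have "x \<notin> closure {x. ?\<phi> x \<noteq> 0}" using supp by blast
    moreover have "?D x = 0" using outK[OF \<open>x \<notin> K\<close>] by simp
    ultimately show ?thesis using GDERIV_zero_outside by metis
  next
    case False
    have n: "0 < norm x" using False by simp
    have "(norm has_derivative (\<lambda>h. h \<bullet> sgn x)) (at x)"
      using GDERIV_norm[OF False] by (simp add: gderiv_def)
    then have 1: "GDERIV norm x :> sgn x" by (simp add: gderiv_def)
    have 2: "GDERIV (\<lambda>x. \<theta> (norm x)) x :> \<theta>' (norm x) *\<^sub>R sgn x" by (rule GDERIV_DERIV_compose[OF 1 D])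
    have 3: "GDERIV (\<lambda>x. inverse (x \<bullet> x)) x :> (- (inverse (x \<bullet> x))\<^sup>2) *\<^sub>R (2 *\<^sub>R x)"
    proof (rule GDERIV_inverse)
      show "GDERIV (\<lambda>x. x \<bullet> x) x :> 2 *\<^sub>R x" unfolding gderiv_def
        by (auto intro!: derivative_eq_intros simp: fun_eq_iff inner_commute)
    qed (use False in simp)
    have 4: "GDERIV (\<lambda>x. x \<bullet> j) x :> j" unfolding gderiv_def by (auto intro!: derivative_eq_intros)
    have "GDERIV (\<lambda>x. \<theta> (norm x) * inverse (x \<bullet> x) * (x \<bullet> j)) x :>
      (\<theta> (norm x) * inverse (x \<bullet> x)) *\<^sub>R j + (x \<bullet> j) *\<^sub>R (\<theta> (norm x) *\<^sub>R ((- (inverse (x \<bullet> x))\<^sup>2) *\<^sub>R (2 *\<^sub>R x)) + inverse (x \<bullet> x) *\<^sub>R (\<theta>' (norm x) *\<^sub>R sgn x))"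
      by (rule GDERIV_mult[OF GDERIV_mult[OF 2 3] 4])
    moreover have "(\<lambda>x. \<theta> (norm x) * inverse (x \<bullet> x) * (x \<bullet> j)) = ?\<phi>"
      by (simp add: radial_field_def fun_eq_iff divide_inverse)
    moreover have "(\<theta> (norm x) * inverse (x \<bullet> x)) *\<^sub>R j + (x \<bullet> j) *\<^sub>R (\<theta> (norm x) *\<^sub>R ((- (inverse (x \<bullet> x))\<^sup>2) *\<^sub>R (2 *\<^sub>R x)) + inverse (x \<bullet> x) *\<^sub>R (\<theta>' (norm x) *\<^sub>R sgn x)) = ?D x"
    proof -
      have xx: "x \<bullet> x = norm x * norm x" by (simp add: power2_norm_eq_inner[symmetric] power2_eq_square)
      show ?thesis using n unfolding sgn_div_norm xx
        by (simp add: divide_inverse power3_eq_cube power2_eq_square algebra_simps)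
    qed
    ultimately show ?thesis by simp
  qed
  have "continuous_on UNIV (\<lambda>x. if x \<in> - {0} then ?D x else 0)"
  proof (rule continuous_extend_zero[OF _ Kcl K0])
    show "continuous_on (- {0}) ?D"
      by (intro continuous_intros continuous_on_compose2[OF c'] continuous_on_compose2[OF interval_test_continuous[OF \<theta>, of UNIV]]) auto
    show "?D x = 0" if "x \<in> - {0} - K" for x using outK[of x] that by simp
  qed auto
  moreover have "(\<lambda>x. if x \<in> - {0} then ?D x else 0) = ?D"
    using outK[of 0] K0 by (auto simp: fun_eq_iff)
  ultimately have cD: "continuous_on UNIV ?D" by (simp only:)
  show ?thesis
    unfolding C1_test_function_def
    using GD cD supp Kan compact_if_closed_subset[OF closed_closure supp Kc] by blast
qed

text \<open>The weak gradient is tested with both components of the radial field, and the two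
  identities are added.\<close>

lemma annulus_weak:
  assumes f: "H1_with_gradient annulus f D" and \<theta>: "interval_test r R \<theta> \<theta>'"
  shows "(\<integral>x. f x * (\<theta>' (norm x) / norm x) \<partial>lebesgue_on annulus) = - (\<integral>x. \<theta> (norm x) * (D x \<bullet> x / (x \<bullet> x)) \<partial>lebesgue_on annulus)"
proof -
  let ?L = "lebesgue_on annulus"
  interpret finite_measure ?L by (rule finite_measure_lebesgue_bounded_open[OF annulus_open annulus_bounded])
  let ?E = "\<lambda>j x. ((x \<bullet> j) * (\<theta>' (norm x) / norm x ^ 3 - 2 * \<theta> (norm x) / (x \<bullet> x)\<^sup>2)) *\<^sub>R x + (\<theta> (norm x) / (x \<bullet> x)) *\<^sub>R j"
  have int: "integrable ?L f" "integrable ?L D"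
    using f by (auto simp: H1_with_gradient_def intro: square_integrable_integrable)
  have dir: "(\<integral>x. f x * (?E j x \<bullet> j) \<partial>?L) = - (\<integral>x. (radial_field \<theta> x \<bullet> j) * (D x \<bullet> j) \<partial>?L)"
    "integrable ?L (\<lambda>x. f x * (?E j x \<bullet> j))" "integrable ?L (\<lambda>x. (radial_field \<theta> x \<bullet> j) * (D x \<bullet> j))" for j
  proof -
    note tf = radial_test_function[OF \<theta>, of j]
    note b = test_function_bounded[OF tf]
    have eq: "(\<integral>x. f x *\<^sub>R ?E j x \<partial>?L) = - (\<integral>x. (radial_field \<theta> x \<bullet> j) *\<^sub>R D x \<partial>?L)"
      using f tf unfolding H1_with_gradient_def by blast
    have i1: "integrable ?L (\<lambda>x. f x *\<^sub>R ?E j x)" by (rule integrable_test_gradient[OF int(1) b(4,2) annulus_open])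
    have i2: "integrable ?L (\<lambda>x. (radial_field \<theta> x \<bullet> j) *\<^sub>R D x)" by (rule integrable_test_mult[OF int(2) b(3,1) annulus_open])
    have "(\<integral>x. (f x *\<^sub>R ?E j x) \<bullet> j \<partial>?L) = - (\<integral>x. ((radial_field \<theta> x \<bullet> j) *\<^sub>R D x) \<bullet> j \<partial>?L)"
      using eq i1 i2 by (simp only: integral_inner_left inner_minus_left)
    then show "(\<integral>x. f x * (?E j x \<bullet> j) \<partial>?L) = - (\<integral>x. (radial_field \<theta> x \<bullet> j) * (D x \<bullet> j) \<partial>?L)"
      by (simp only: inner_scaleR_left)
    show "integrable ?L (\<lambda>x. f x * (?E j x \<bullet> j))" using integrable_inner_left[of j ?L "\<lambda>x. f x *\<^sub>R ?E j x"] i1 by (simp only: inner_scaleR_left)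
    show "integrable ?L (\<lambda>x. (radial_field \<theta> x \<bullet> j) * (D x \<bullet> j))"
      using integrable_inner_left[of j ?L "\<lambda>x. (radial_field \<theta> x \<bullet> j) *\<^sub>R D x"] i2 by (simp only: inner_scaleR_left)
  qed
  have div: "?E e1 x \<bullet> e1 + ?E e2 x \<bullet> e2 = \<theta>' (norm x) / norm x" if "x \<in> annulus" for x
  proof -
    have n: "0 < norm x" using that r by (auto simp: annulus_def)
    have xx: "x $ 1 * x $ 1 + x $ 2 * x $ 2 = norm x * norm x" "x \<bullet> x = norm x * norm x"
      using power2_norm_eq_inner[of x] by (simp_all add: inner_vec_def sum_2 power2_eq_square)
    have "?E e1 x \<bullet> e1 + ?E e2 x \<bullet> e2 = (x $ 1 * x $ 1 + x $ 2 * x $ 2) * (\<theta>' (norm x) / norm x ^ 3 - 2 * \<theta> (norm x) / (x \<bullet> x)\<^sup>2) + 2 * (\<theta> (norm x) / (x \<bullet> x))"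
      by (simp add: inner_add_left inner_axis algebra_simps)
    also have "\<dots> = \<theta>' (norm x) / norm x"
      unfolding xx using n by (simp add: field_simps power2_eq_square power3_eq_cube)
    finally show ?thesis .
  qed
  have rad: "(radial_field \<theta> x \<bullet> e1) * (D x \<bullet> e1) + (radial_field \<theta> x \<bullet> e2) * (D x \<bullet> e2) = \<theta> (norm x) * (D x \<bullet> x / (x \<bullet> x))" for x
  proof -
    have "(radial_field \<theta> x \<bullet> e1) * (D x \<bullet> e1) + (radial_field \<theta> x \<bullet> e2) * (D x \<bullet> e2) = radial_field \<theta> x \<bullet> D x"
      by (simp add: inner_axis) (simp add: inner_vec_def sum_2)
    then show ?thesis by (simp add: radial_field_def inner_commute)
  qed
  have "(\<integral>x. f x * (\<theta>' (norm x) / norm x) \<partial>?L) = (\<integral>x. f x * (?E e1 x \<bullet> e1) + f x * (?E e2 x \<bullet> e2) \<partial>?L)"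
    by (rule Bochner_Integration.integral_cong) (use div in \<open>auto simp: distrib_left[symmetric]\<close>)
  also have "\<dots> = (\<integral>x. f x * (?E e1 x \<bullet> e1) \<partial>?L) + (\<integral>x. f x * (?E e2 x \<bullet> e2) \<partial>?L)"
    by (rule Bochner_Integration.integral_add[OF dir(2) dir(2)])
  also have "\<dots> = - ((\<integral>x. (radial_field \<theta> x \<bullet> e1) * (D x \<bullet> e1) \<partial>?L) + (\<integral>x. (radial_field \<theta> x \<bullet> e2) * (D x \<bullet> e2) \<partial>?L))"
    unfolding dir(1) by simp
  also have "(\<integral>x. (radial_field \<theta> x \<bullet> e1) * (D x \<bullet> e1) \<partial>?L) + (\<integral>x. (radial_field \<theta> x \<bullet> e2) * (D x \<bullet> e2) \<partial>?L)
      = (\<integral>x. (radial_field \<theta> x \<bullet> e1) * (D x \<bullet> e1) + (radial_field \<theta> x \<bullet> e2) * (D x \<bullet> e2) \<partial>?L)"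
    by (rule Bochner_Integration.integral_add[OF dir(3) dir(3), symmetric])
  finally show ?thesis unfolding rad .
qed

definition annulus_solution :: "real ^ 2 \<Rightarrow> real" where
  "annulus_solution x = r * R / 4 * ln (x \<bullet> x) - x \<bullet> x / 4"

definition annulus_gradient :: "real ^ 2 \<Rightarrow> real ^ 2" where
  "annulus_gradient x = ((r * R / 2 - (norm x)\<^sup>2 / 2) / (x \<bullet> x)) *\<^sub>R x"

text \<open>As for boxes, with the integral of \<open>f (t \<omega>)\<close> over the unit
  circle as the function of one variable. The gradient is \<open>G (norm x)\<close> times
  \<open>x / |x|\<^sup>2\<close> with \<open>G t = r R / 2 - t\<^sup>2 / 2\<close>. This
  \<open>G\<close> is the one with derivative \<open>- t\<close> for which \<open>G r /
  r\<close> and \<open>- G R / R\<close> coincide, both being \<open>(R - r) / 2\<close>, the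
  quotient of area and perimeter of the annulus.\<close>

lemma annulus_divergence:
  assumes f: "H1_with_gradient annulus f D" "continuous_on closed_annulus f"
  shows "(\<integral>x. annulus_gradient x \<bullet> D x \<partial>lebesgue_on annulus)
    = (\<integral>x. f x \<partial>lebesgue_on annulus) - (R - r) * pi / circle_length * (\<integral>x. f x \<partial>surface_measure annulus)"
proof -
  let ?L = "lebesgue_on annulus" and ?F = "circle_integral f"
  define c where "c = circle_length / (2 * pi)"
  have c: "0 < c" using circle_length(2) by (simp add: c_def)
  have fl: "square_integrable ?L (\<lambda>x. (1 / (x \<bullet> x)) *\<^sub>R x)"
  proof (rule square_integrable_continuous_closure[OF annulus_open annulus_bounded])
    show "continuous_on (closure annulus) (\<lambda>x. (1 / (x \<bullet> x)) *\<^sub>R x)"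
      unfolding closure_annulus using r by (intro continuous_intros) (auto simp: closed_annulus_def)
  qed
  have "integrable ?L (\<lambda>x. ((1 / (x \<bullet> x)) *\<^sub>R x) \<bullet> D x)"
    by (rule square_integrable_inner[OF fl]) (use f(1) in \<open>simp add: H1_with_gradient_def\<close>)
  then have "integrable ?L (\<lambda>x. D x \<bullet> x / (x \<bullet> x))" by (simp add: inner_commute)
  then have intE: "integrable ?L (\<lambda>x. c * (D x \<bullet> x / (x \<bullet> x)))" by (rule integrable_mult_right)
  let ?G = "\<lambda>t::real. r * R / 2 - t\<^sup>2 / 2"
  have "?F R * ?G R - ?F r * ?G r = (LINT t:{r..R}|lborel. ?F t * (- t)) + (\<integral>x. ?G (norm x) * (c * (D x \<bullet> x / (x \<bullet> x))) \<partial>?L)"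
  proof (rule boundary_values_from_test_functions)
    show "continuous_on {r..R} ?F" by (rule circle_integral_continuous[OF f(2)])
    show "norm \<in> borel_measurable ?L"
      by (intro measurable_restrict_space1 measurable_completion) simp
    show "r < norm x \<and> norm x < R" if "x \<in> space ?L" for x using that by (auto simp: annulus_def)
    show "(LINT t:{r..R}|lborel. ?F t * \<theta>' t) = - (\<integral>x. \<theta> (norm x) * (c * (D x \<bullet> x / (x \<bullet> x))) \<partial>?L)"
      if \<theta>: "interval_test r R \<theta> \<theta>'" for \<theta> \<theta>'
    proof -
      have "(LINT t:{r..R}|lborel. ?F t * \<theta>' t) = c * (\<integral>x. f x * (\<theta>' (norm x) / norm x) \<partial>?L)"
        unfolding c_def by (rule annulus_slicing[OF f(2), symmetric]) (use \<theta> in \<open>simp add: interval_test_def\<close>)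
      also have "\<dots> = - (c * (\<integral>x. \<theta> (norm x) * (D x \<bullet> x / (x \<bullet> x)) \<partial>?L))"
        unfolding annulus_weak[OF f(1) \<theta>] by (rule mult_minus_right)
      also have "c * (\<integral>x. \<theta> (norm x) * (D x \<bullet> x / (x \<bullet> x)) \<partial>?L) = (\<integral>x. c * (\<theta> (norm x) * (D x \<bullet> x / (x \<bullet> x))) \<partial>?L)"
        by (rule integral_mult_right_zero[symmetric])
      also have "\<dots> = (\<integral>x. \<theta> (norm x) * (c * (D x \<bullet> x / (x \<bullet> x))) \<partial>?L)" by (simp only: mult.left_commute)
      finally show ?thesis .
    qed
    show "DERIV ?G t :> - t" for t by (auto intro!: derivative_eq_intros)
    show "continuous_on UNIV (\<lambda>t::real. - t)" by (intro continuous_intros)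
  qed (use rR intE in auto)
  moreover have "(LINT t:{r..R}|lborel. ?F t * (- t)) = - (c * (\<integral>x. f x \<partial>?L))"
  proof -
    have "(LINT t:{r..R}|lborel. ?F t * (- t)) = c * (\<integral>x. f x * (- norm x / norm x) \<partial>?L)"
      unfolding c_def by (rule annulus_slicing[OF f(2), symmetric]) (intro continuous_intros)
    also have "(\<integral>x. f x * (- norm x / norm x) \<partial>?L) = (\<integral>x. - f x \<partial>?L)"
      by (rule Bochner_Integration.integral_cong) (use r in \<open>auto simp: annulus_def\<close>)
    finally show ?thesis by simp
  qed
  moreover have "(\<integral>x. ?G (norm x) * (c * (D x \<bullet> x / (x \<bullet> x))) \<partial>?L) = c * (\<integral>x. annulus_gradient x \<bullet> D x \<partial>?L)"
  proof -
    have "(\<integral>x. ?G (norm x) * (c * (D x \<bullet> x / (x \<bullet> x))) \<partial>?L) = (\<integral>x. c * (annulus_gradient x \<bullet> D x) \<partial>?L)"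
      by (rule Bochner_Integration.integral_cong) (simp_all add: annulus_gradient_def inner_commute)
    then show ?thesis by simp
  qed
  moreover have "?G R = - ((R - r) / 2 * R)" "?G r = (R - r) / 2 * r"
    by (simp_all add: power2_eq_square field_simps)
  ultimately have "?F R * (- ((R - r) / 2 * R)) - ?F r * ((R - r) / 2 * r) = - (c * (\<integral>x. f x \<partial>?L)) + c * (\<integral>x. annulus_gradient x \<bullet> D x \<partial>?L)" by simp
  then have "c * (\<integral>x. annulus_gradient x \<bullet> D x \<partial>?L) = c * (\<integral>x. f x \<partial>?L) - (R - r) / 2 * (r * ?F r + R * ?F R)"
    by (simp add: algebra_simps)
  then have "(\<integral>x. annulus_gradient x \<bullet> D x \<partial>?L) = (\<integral>x. f x \<partial>?L) - (R - r) / 2 / c * (r * ?F r + R * ?F R)"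
    using c by (simp add: field_simps)
  moreover have "(R - r) / 2 / c = (R - r) * pi / circle_length" using circle_length(2) by (simp add: c_def field_simps)
  ultimately show ?thesis by (simp only: annulus_surface_integral[OF f(2)])
qed

text \<open>The solution is constant on each of the two boundary circles.\<close>

theorem annulus_oscillation:
  "0 \<le> boundary_oscillation annulus"
  "boundary_oscillation annulus \<le> \<bar>(R\<^sup>2 - r\<^sup>2) / 4 - r * R / 4 * (ln (R\<^sup>2) - ln (r\<^sup>2))\<bar>"
proof -
  have ne: "annulus \<noteq> {}"
  proof -
    obtain s where "r < s" "s < R" using dense[OF rR] by blast
    then have "s *\<^sub>R e1 \<in> annulus" using r by (simp add: annulus_def)
    then show ?thesis by blast
  qed
  have conn: "connected annulus"
    using connected_annulus(1)[where a="0 :: real ^ 2" and ?r1.0=r and ?r2.0=R] by (simp add: annulus_def)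
  have pos: "0 < x \<bullet> x" "r\<^sup>2 \<le> x \<bullet> x" "x \<bullet> x \<le> R\<^sup>2" if "x \<in> closed_annulus" for x
    using that r by (auto simp: closed_annulus_def power2_norm_eq_inner[symmetric] intro!: power_mono)
  have G: "GDERIV annulus_solution x :> annulus_gradient x" if x: "x \<in> annulus" for x
  proof -
    have x0: "x \<noteq> 0" using x r by (auto simp: annulus_def)
    have 1: "GDERIV (\<lambda>x. x \<bullet> x) x :> 2 *\<^sub>R x" unfolding gderiv_def
      by (auto intro!: derivative_eq_intros simp: fun_eq_iff inner_commute)
    have "DERIV (\<lambda>s. r * R / 4 * ln s - s / 4) (x \<bullet> x) :> r * R / 4 * (1 / (x \<bullet> x)) - 1 / 4"
      using x0 by (auto intro!: derivative_eq_intros)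
    from GDERIV_DERIV_compose[OF 1 this]
    have "GDERIV annulus_solution x :> (r * R / 4 * (1 / (x \<bullet> x)) - 1 / 4) *\<^sub>R 2 *\<^sub>R x"
      unfolding annulus_solution_def .
    moreover have "(r * R / 4 * (1 / (x \<bullet> x)) - 1 / 4) *\<^sub>R 2 *\<^sub>R x = annulus_gradient x"
      using x0 by (simp add: annulus_gradient_def power2_norm_eq_inner diff_divide_distrib left_diff_distrib)
    ultimately show ?thesis by simp
  qed
  have cs: "continuous_on closed_annulus annulus_solution" "continuous_on closed_annulus annulus_gradient"
    unfolding annulus_solution_def annulus_gradient_def
    using pos(1) by (intro continuous_intros; force)+
  have H1: "H1_with_gradient annulus annulus_solution annulus_gradient"
    by (rule H1_with_gradient_C1[OF annulus_open annulus_bounded G]) (simp_all add: closure_annulus cs)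
  have hoe: "hoelder_on (closure annulus) annulus_solution"
    unfolding hoelder_on_def closure_annulus
  proof (intro exI conjI ballI)
    fix x y assume xy: "x \<in> closed_annulus" "y \<in> closed_annulus"
    have sq: "\<bar>x \<bullet> x - y \<bullet> y\<bar> \<le> 2 * R * dist x y"
    proof -
      have "x \<bullet> x - y \<bullet> y = (norm x - norm y) * (norm x + norm y)"
        by (simp add: power2_norm_eq_inner[symmetric] power2_eq_square algebra_simps)
      moreover have "\<bar>norm x - norm y\<bar> \<le> dist x y" by (simp add: dist_norm norm_triangle_ineq3)
      moreover have "\<bar>norm x + norm y\<bar> \<le> 2 * R" using xy by (auto simp: closed_annulus_def)
      ultimately have "\<bar>x \<bullet> x - y \<bullet> y\<bar> \<le> dist x y * (2 * R)" by (simp add: abs_mult mult_mono)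
      then show ?thesis by (simp add: mult.commute)
    qed
    have ln1: "ln a - ln b \<le> \<bar>a - b\<bar> / r\<^sup>2" if "0 < a" "r\<^sup>2 \<le> b" for a b :: real
    proof -
      have b: "0 < b" using that r by (smt (verit) zero_less_power)
      have "ln a - ln b \<le> (a - b) / b" by (rule ln_diff_le) (use that b in auto)
      also have "\<dots> \<le> \<bar>a - b\<bar> / b" using b by (intro divide_right_mono) auto
      also have "\<dots> \<le> \<bar>a - b\<bar> / r\<^sup>2" using that r b by (intro divide_left_mono mult_pos_pos) auto
      finally show ?thesis .
    qed
    have "\<bar>ln (x \<bullet> x) - ln (y \<bullet> y)\<bar> \<le> \<bar>x \<bullet> x - y \<bullet> y\<bar> / r\<^sup>2"
      using ln1[OF pos(1)[OF xy(1)] pos(2)[OF xy(2)]] ln1[OF pos(1)[OF xy(2)] pos(2)[OF xy(1)]]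
      by (simp add: abs_minus_commute abs_le_iff)
    then have "r * R / 4 * \<bar>ln (x \<bullet> x) - ln (y \<bullet> y)\<bar> \<le> r * R / 4 * (\<bar>x \<bullet> x - y \<bullet> y\<bar> / r\<^sup>2)"
      using r rR by (intro mult_left_mono) auto
    moreover have "annulus_solution x - annulus_solution y = r * R / 4 * (ln (x \<bullet> x) - ln (y \<bullet> y)) - (x \<bullet> x - y \<bullet> y) / 4"
      by (simp add: annulus_solution_def field_simps)
    moreover have "\<bar>r * R / 4 * (ln (x \<bullet> x) - ln (y \<bullet> y))\<bar> = r * R / 4 * \<bar>ln (x \<bullet> x) - ln (y \<bullet> y)\<bar>"
      using r rR by (simp add: abs_mult)
    moreover have "\<bar>r * R / 4 * (ln (x \<bullet> x) - ln (y \<bullet> y)) - (x \<bullet> x - y \<bullet> y) / 4\<bar>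
        \<le> \<bar>r * R / 4 * (ln (x \<bullet> x) - ln (y \<bullet> y))\<bar> + \<bar>(x \<bullet> x - y \<bullet> y) / 4\<bar>" by (rule abs_triangle_ineq4)
    moreover have "\<bar>(x \<bullet> x - y \<bullet> y) / 4\<bar> = \<bar>x \<bullet> x - y \<bullet> y\<bar> / 4" by simp
    ultimately have "\<bar>annulus_solution x - annulus_solution y\<bar> \<le> r * R / 4 * (\<bar>x \<bullet> x - y \<bullet> y\<bar> / r\<^sup>2) + \<bar>x \<bullet> x - y \<bullet> y\<bar> / 4"
      by (simp only:)
    also have "\<dots> = (r * R / 4 / r\<^sup>2 + 1 / 4) * \<bar>x \<bullet> x - y \<bullet> y\<bar>" by (simp add: algebra_simps)
    also have "\<dots> \<le> (r * R / 4 / r\<^sup>2 + 1 / 4) * (2 * R * dist x y)"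
      using sq r rR by (intro mult_left_mono) auto
    finally show "\<bar>annulus_solution x - annulus_solution y\<bar> \<le> (r * R / 4 / r\<^sup>2 + 1 / 4) * (2 * R) * dist x y powr 1"
      by (simp add: mult.assoc)
  qed simp_all
  have osc: "\<bar>annulus_solution x - annulus_solution y\<bar> \<le> \<bar>(R\<^sup>2 - r\<^sup>2) / 4 - r * R / 4 * (ln (R\<^sup>2) - ln (r\<^sup>2))\<bar>"
    if "x \<in> frontier annulus" "y \<in> frontier annulus" for x y
  proof -
    define P where "P s = r * R / 4 * ln (s\<^sup>2) - s\<^sup>2 / 4" for s
    have "annulus_solution z = P s" if "z \<in> sphere 0 s" for z s
      using that by (auto simp: annulus_solution_def P_def power2_norm_eq_inner)
    then have val: "annulus_solution z \<in> {P r, P R}" if "z \<in> frontier annulus" for z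
      using that unfolding frontier_annulus by blast
    have "(R\<^sup>2 - r\<^sup>2) / 4 - r * R / 4 * (ln (R\<^sup>2) - ln (r\<^sup>2)) = P r - P R"
      by (simp add: P_def field_simps)
    then show ?thesis using val[OF that(1)] val[OF that(2)] by auto
  qed
  note main = boundary_oscillation_le[OF annulus_open annulus_bounded conn ne annulus_surface_finite hoe H1 _ osc]
  have div: "(\<integral>x. annulus_gradient x \<bullet> D x \<partial>lebesgue_on annulus)
      = (\<integral>x. f x \<partial>lebesgue_on annulus) - (R - r) * pi / circle_length * (\<integral>x. f x \<partial>surface_measure annulus)"
    if "H1_with_gradient annulus f D" "continuous_on (closure annulus) f" for f D
    by (rule annulus_divergence[OF that(1)]) (use that(2) closure_annulus in simp)
  show "0 \<le> boundary_oscillation annulus" by (rule main(1)[OF div])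
  show "boundary_oscillation annulus \<le> \<bar>(R\<^sup>2 - r\<^sup>2) / 4 - r * R / 4 * (ln (R\<^sup>2) - ln (r\<^sup>2))\<bar>" by (rule main(2)[OF div])
qed

end

declare One_nat_def [simp]

section \<open>Degenerating families of fixed volume\<close>

text \<open>One of two points is at least half their distance away from the centre of the
  ball.\<close>

lemma hausdorff_dist_ball_ge:
  fixes A :: "'a::euclidean_space set"
  assumes A: "bounded A" and xy: "x \<in> A" "y \<in> A" and \<rho>: "0 < \<rho>"
  shows "dist x y / 2 - \<rho> \<le> hausdorff_dist A (ball c \<rho>)"
proof -
  let ?B = "ball c \<rho>"
  have lower: "dist z c - \<rho> \<le> infdist z ?B" for z
  proof -
    have "dist z c - \<rho> \<le> (INF b\<in>?B. dist z b)"
    proof (rule cINF_greatest)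
      fix b assume "b \<in> ?B"
      then show "dist z c - \<rho> \<le> dist z b" using dist_triangle[of z c b] by (simp add: dist_commute)
    qed (use \<rho> in auto)
    then show ?thesis using \<rho> by (simp add: infdist_notempty)
  qed
  obtain M where M: "\<And>z. z \<in> A \<Longrightarrow> dist c z \<le> M" using A bounded_any_center[of A c] by blast
  have "bdd_above ((\<lambda>z. infdist z ?B) ` A)"
  proof (rule bdd_aboveI2)
    fix z assume "z \<in> A"
    then show "infdist z ?B \<le> M" using infdist_le[of c ?B z] \<rho> M[of z] by (simp add: dist_commute)
  qed
  then have up: "infdist z ?B \<le> (SUP z\<in>A. infdist z ?B)" if "z \<in> A" for z using that by (rule cSUP_upper[rotated])
  have "dist x y \<le> dist x c + dist y c" using dist_triangle[of x y c] by (simp add: dist_commute)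
  then have "dist x y / 2 - \<rho> \<le> (SUP z\<in>A. infdist z ?B)"
    using lower[of x] lower[of y] up[OF xy(1)] up[OF xy(2)] by linarith
  then show ?thesis unfolding hausdorff_dist_def by (rule max.coboundedI1)
qed

text \<open>The volume fixes the radius of the balls, while the diameter of the sets tends to
  infinity.\<close>

lemma elongated_sets_far_from_balls:
  fixes \<Omega> :: "nat \<Rightarrow> 'a::euclidean_space set"
  assumes \<Omega>: "\<And>k. bounded (\<Omega> k)" "\<And>k. measure lebesgue (\<Omega> k) = V"
    and pq: "\<And>k. p k \<in> \<Omega> k" "\<And>k. q k \<in> \<Omega> k" "filterlim (\<lambda>k. dist (p k) (q k)) at_top sequentially"
    and T: "\<And>k. rigid_motion (T k) \<and> 0 < r k \<and> measure lebesgue (ball (c k) (r k)) = measure lebesgue (\<Omega> k)"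
  shows "filterlim (\<lambda>k. hausdorff_dist (T k ` \<Omega> k) (ball (c k) (r k))) at_top sequentially"
proof -
  have r: "r k = r 0" for k
  proof -
    have "unit_ball_vol (real DIM('a)) * r k ^ DIM('a) = V" for k
      using T[of k] \<Omega>(2)[of k] content_ball[of "r k" "c k"] by simp
    from this[of k] this[of 0]
    have "unit_ball_vol (real DIM('a)) * r k ^ DIM('a) = unit_ball_vol (real DIM('a)) * r 0 ^ DIM('a)" by simp
    moreover have "0 < unit_ball_vol (real DIM('a))" by simp
    then have "unit_ball_vol (real DIM('a)) \<noteq> 0" by linarith
    ultimately have "r k ^ DIM('a) = r 0 ^ DIM('a)" by simp
    then show ?thesis using T[of k] T[of 0] power_eq_iff_eq_base[of "DIM('a)" "r k" "r 0"] by simp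
  qed
  have ge: "dist (p k) (q k) / 2 - r 0 \<le> hausdorff_dist (T k ` \<Omega> k) (ball (c k) (r k))" for k
  proof -
    obtain a Q where Q: "orthogonal_transformation Q" "T k = (\<lambda>x. a + Q x)" using T[of k] unfolding rigid_motion_def by blast
    have iso: "dist (T k x) (T k y) = dist x y" for x y
      unfolding Q(2) dist_norm using Q(1) by (simp add: orthogonal_transformation_isometry[unfolded dist_norm])
    obtain M where M: "\<And>x y. x \<in> \<Omega> k \<Longrightarrow> y \<in> \<Omega> k \<Longrightarrow> dist x y \<le> M"
      using \<Omega>(1)[of k] unfolding bounded_two_points by blast
    have "bounded (T k ` \<Omega> k)" unfolding bounded_two_points using M iso by auto
    from hausdorff_dist_ball_ge[OF this, of "T k (p k)" "T k (q k)" "r k" "c k"]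
    show ?thesis using pq T[of k] r[of k] by (simp add: iso)
  qed
  have "filterlim (\<lambda>k. dist (p k) (q k) / 2 - r 0) at_top sequentially"
  proof -
    have "filterlim (\<lambda>k. - r 0 + 1 / 2 * dist (p k) (q k)) at_top sequentially"
      by (intro filterlim_tendsto_add_at_top[OF tendsto_const] filterlim_tendsto_pos_mult_at_top[OF tendsto_const _ pq(3)]) simp
    then show ?thesis by simp
  qed
  then show ?thesis by (rule filterlim_at_top_mono[OF _ always_eventually[OF allI[OF ge]]])
qed

text \<open>One half side is \<open>t ^ - (n - 1)\<close> and the others are \<open>t\<close>,
  so the volume is constant. The quotient of volume and perimeter is at most the shortest half
  side, and the bound for the oscillation becomes a multiple of \<open>t ^ - (n - 2)\<close>,
  which tends to zero since \<open>n\<close> is at least three.\<close>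

theorem flat_boxes:
  assumes dim: "3 \<le> DIM('a::euclidean_space)"
  shows "\<exists>(\<Omega> :: nat \<Rightarrow> 'a set) V.
         V > 0 \<and> (\<forall>k. open_rectangle (\<Omega> k) \<and> measure lebesgue (\<Omega> k) = V) \<and>
         (\<lambda>k. boundary_oscillation (\<Omega> k)) \<longlonglongrightarrow> 0 \<and>
         (\<forall>T c r. (\<forall>k. rigid_motion (T k) \<and> r k > 0 \<and>
                       measure lebesgue (ball (c k) (r k)) = measure lebesgue (\<Omega> k)) \<longrightarrow>
            filterlim (\<lambda>k. hausdorff_dist (T k ` \<Omega> k) (ball (c k) (r k))) at_top sequentially)"
proof -
  let ?n = "DIM('a)"
  obtain i :: 'a where i: "i \<in> Basis" using nonempty_Basis by blast
  have "card (Basis - {i}) \<noteq> 0" using i dim by simp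
  then obtain j where j: "j \<in> Basis" "j \<noteq> i" by (metis card_eq_0_iff finite_Basis DiffE all_not_in_conv finite_Diff singletonI)
  define t where "t k = real k + 1" for k
  have t: "1 \<le> t k" for k by (simp add: t_def)
  then have t0: "0 < t k" for k by (meson less_le_trans zero_less_one)
  define l :: "nat \<Rightarrow> 'a" where "l k = (\<Sum>b\<in>Basis. (if b = i then 1 / t k ^ (?n - 1) else t k) *\<^sub>R b)" for k
  have lb: "l k \<bullet> b = (if b = i then 1 / t k ^ (?n - 1) else t k)" if "b \<in> Basis" for k b
    using that by (simp add: l_def)
  have lpos: "0 < l k \<bullet> b" if "b \<in> Basis" for k b using t0[of k] that by (simp add: lb)
  define \<Omega> where "\<Omega> k = box (- l k) (l k)" for k
  have rect: "open_rectangle (\<Omega> k)" for k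
    unfolding open_rectangle_def \<Omega>_def using lpos by (intro exI[of _ "- l k"] exI[of _ "l k"]) (simp add: less_le_trans)
  have vol: "measure lebesgue (\<Omega> k) = 2 ^ ?n" for k
  proof -
    have "measure lebesgue (\<Omega> k) = (\<Prod>b\<in>Basis. (l k - - l k) \<bullet> b)"
      unfolding \<Omega>_def by (subst measure_completion) (auto intro!: measure_lborel_box simp: less_imp_le lpos)
    also have "\<dots> = (\<Prod>b\<in>(Basis::'a set). 2 * (if b = i then 1 / t k ^ (?n - 1) else t k))"
      by (rule prod.cong) (auto simp: lb inner_add_left)
    also have "\<dots> = 2 * (1 / t k ^ (?n - 1)) * (2 * t k) ^ (?n - 1)"
      using i by (subst prod.remove[OF finite_Basis i]) simp
    also have "\<dots> = 2 * 2 ^ (?n - 1)" using t0[of k] by (simp add: power_mult_distrib)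
    also have "\<dots> = 2 ^ ?n" using dim by (simp add: power_Suc[symmetric] del: power_Suc)
    finally show ?thesis .
  qed
  have osc: "0 \<le> boundary_oscillation (\<Omega> k)" "boundary_oscillation (\<Omega> k) \<le> real ?n / 2 * (1 / t k)" for k
  proof -
    show "0 \<le> boundary_oscillation (\<Omega> k)" unfolding \<Omega>_def by (rule box_oscillation(1)[OF lpos])
    have "box_flux (l k) \<le> 1 / t k ^ (?n - 1)"
    proof -
      have "1 / (l k \<bullet> i) \<le> (\<Sum>b\<in>Basis. 1 / (l k \<bullet> b))"
        using lpos i by (intro member_le_sum) (auto simp: less_imp_le)
      then have "1 / (\<Sum>b\<in>Basis. 1 / (l k \<bullet> b)) \<le> 1 / (1 / (l k \<bullet> i))"
      proof (rule divide_left_mono)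
        have "0 < 1 / (l k \<bullet> i)" using lpos[OF i] by simp
        with \<open>1 / (l k \<bullet> i) \<le> _\<close> show "0 < (\<Sum>b\<in>Basis. 1 / (l k \<bullet> b)) * (1 / (l k \<bullet> i))"
          by (intro mult_pos_pos) linarith+
      qed simp_all
      then show ?thesis using box_flux_def[OF lpos] i by (simp add: lb)
    qed
    moreover have "(\<Sum>b\<in>Basis. l k \<bullet> b) \<le> real ?n * t k"
    proof -
      have "1 / t k ^ (?n - 1) \<le> 1" using t[of k] by (simp add: one_le_power)
      then have "1 / t k ^ (?n - 1) \<le> t k" using t[of k] by (rule order_trans)
      then have "l k \<bullet> b \<le> t k" if "b \<in> Basis" for b using that by (simp add: lb)
      then have "(\<Sum>b\<in>Basis. l k \<bullet> b) \<le> (\<Sum>b\<in>(Basis::'a set). t k)" by (rule sum_mono)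
      then show ?thesis by simp
    qed
    moreover have "0 \<le> (\<Sum>b\<in>Basis. l k \<bullet> b)" by (intro sum_nonneg less_imp_le lpos)
    moreover have "0 < t k ^ (?n - 1)" using t0 by simp
    ultimately have "box_flux (l k) / 2 * (\<Sum>b\<in>Basis. l k \<bullet> b) \<le> (1 / t k ^ (?n - 1)) / 2 * (real ?n * t k)"
      by (intro mult_mono divide_right_mono) auto
    also have "\<dots> = real ?n / 2 * (t k / t k ^ (?n - 1))" by simp
    also have "\<dots> \<le> real ?n / 2 * (1 / t k)"
    proof (rule mult_left_mono)
      have "t k ^ 2 \<le> t k ^ (?n - 1)" using t dim by (intro power_increasing) auto
      then show "t k / t k ^ (?n - 1) \<le> 1 / t k"
        using t0[of k] by (simp add: divide_simps power2_eq_square)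
    qed simp
    finally show "boundary_oscillation (\<Omega> k) \<le> real ?n / 2 * (1 / t k)"
      unfolding \<Omega>_def using box_oscillation(2)[OF lpos] by (rule order_trans[rotated])
  qed
  have lim: "(\<lambda>k. boundary_oscillation (\<Omega> k)) \<longlonglongrightarrow> 0"
  proof (rule tendsto_sandwich[OF _ _ tendsto_const])
    show "(\<lambda>k. real ?n / 2 * (1 / t k)) \<longlonglongrightarrow> 0" unfolding t_def by real_asymp
  qed (use osc in auto)
  have far: "filterlim (\<lambda>k. hausdorff_dist (T k ` \<Omega> k) (ball (c k) (r k))) at_top sequentially"
    if "\<forall>k. rigid_motion (T k) \<and> r k > 0 \<and> measure lebesgue (ball (c k) (r k)) = measure lebesgue (\<Omega> k)" for T c r
  proof (rule elongated_sets_far_from_balls[where V="2 ^ ?n" and p="\<lambda>k. (t k / 2) *\<^sub>R j" and q="\<lambda>k. - ((t k / 2) *\<^sub>R j)"])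
    have "\<bar>((t k / 2) *\<^sub>R j) \<bullet> b\<bar> < l k \<bullet> b" if "b \<in> Basis" for k b
      using that j lpos[OF that, of k] t0[of k] by (auto simp: inner_Basis lb)
    then have "- (l k \<bullet> b) < ((t k / 2) *\<^sub>R j) \<bullet> b \<and> ((t k / 2) *\<^sub>R j) \<bullet> b < l k \<bullet> b" if "b \<in> Basis" for k b
      using that by (simp add: abs_less_iff minus_less_iff)
    then show "(t k / 2) *\<^sub>R j \<in> \<Omega> k" "- ((t k / 2) *\<^sub>R j) \<in> \<Omega> k" for k
      by (auto simp: \<Omega>_def mem_box minus_less_iff less_minus_iff)
    have "dist ((t k / 2) *\<^sub>R j) (- ((t k / 2) *\<^sub>R j)) = t k" for k
    proof -
      have "dist ((t k / 2) *\<^sub>R j) (- ((t k / 2) *\<^sub>R j)) = norm (t k *\<^sub>R j)"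
        by (simp add: dist_norm scaleR_add_left[symmetric])
      then show ?thesis using j t0[of k] by simp
    qed
    moreover have "filterlim t at_top sequentially" unfolding t_def by real_asymp
    ultimately show "filterlim (\<lambda>k. dist ((t k / 2) *\<^sub>R j) (- ((t k / 2) *\<^sub>R j))) at_top sequentially" by simp
  qed (use that vol in \<open>auto simp: \<Omega>_def\<close>)
  show ?thesis by (intro exI[of _ \<Omega>] exI[of _ "2 ^ ?n"]) (use rect vol lim far in auto)
qed

text \<open>For radii \<open>t\<close> and \<open>s\<close> with \<open>s\<^sup>2 - t\<^sup>2 =
  1\<close> the bound for the oscillation is a quarter of \<open>\<bar>1 - t s ln (s\<^sup>2 /
  t\<^sup>2)\<bar>\<close>. The elementary bounds of the logarithm place \<open>t s ln
  (s\<^sup>2 / t\<^sup>2)\<close> between \<open>t / s\<close> and \<open>s / t\<close>, an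
  interval that contains \<open>1\<close> and has length \<open>1 / (t s)\<close>.\<close>

theorem thin_annuli:
  "\<exists>(A :: nat \<Rightarrow> (real ^ 2) set) V.
         V > 0 \<and> (\<forall>k. open_annulus (A k) \<and> measure lebesgue (A k) = V) \<and>
         (\<lambda>k. boundary_oscillation (A k)) \<longlonglongrightarrow> 0 \<and>
         (\<forall>T c r. (\<forall>k. rigid_motion (T k) \<and> r k > 0 \<and>
                       measure lebesgue (ball (c k) (r k)) = measure lebesgue (A k)) \<longrightarrow>
            filterlim (\<lambda>k. hausdorff_dist (T k ` A k) (ball (c k) (r k))) at_top sequentially)"
proof -
  define t where "t k = real k + 1" for k
  define s where "s k = sqrt ((t k)\<^sup>2 + 1)" for k
  have t: "0 < t k" for k by (simp add: t_def)
  have s2: "(s k)\<^sup>2 = (t k)\<^sup>2 + 1" for k by (simp add: s_def)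
  have ts: "t k < s k" for k
    using t[of k] real_less_rsqrt[of "t k" "(t k)\<^sup>2 + 1"] by (simp add: s_def)
  define A where "A k = annulus (t k) (s k)" for k
  have A_def': "A k = {x. t k < norm x \<and> norm x < s k}" for k
    by (simp add: A_def annulus_def[OF t ts])
  have ann: "open_annulus (A k)" for k
    unfolding open_annulus_def A_def' using t[of k] ts[of k] by (intro exI[of _ 0] exI[of _ "t k"] exI[of _ "s k"]) simp
  have bdd: "bounded (A k)" for k unfolding A_def by (rule annulus_bounded[OF t ts])
  have vol: "measure lebesgue (A k) = pi" for k
  proof -
    have A_eq: "A k = ball 0 (s k) - cball 0 (t k)" by (auto simp: A_def')
    have "measure lebesgue (A k) = measure lebesgue (ball (0 :: real ^ 2) (s k)) - measure lebesgue (cball (0 :: real ^ 2) (t k))"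
      unfolding A_eq
    proof (rule measurable_measure_Diff)
      show "cball (0 :: real ^ 2) (t k) \<subseteq> ball 0 (s k)" using ts[of k] by (auto simp: subset_iff)
    qed (simp_all add: fmeasurableD)
    also have "\<dots> = pi * (s k)\<^sup>2 - pi * (t k)\<^sup>2"
      using t[of k] ts[of k] content_ball[of "s k" "0 :: real ^ 2"] content_cball[of "t k" "0 :: real ^ 2"] by (simp add: unit_ball_vol_2)
    finally show ?thesis by (simp add: s2 algebra_simps)
  qed
  have small: "\<bar>((s k)\<^sup>2 - (t k)\<^sup>2) / 4 - t k * s k / 4 * (ln ((s k)\<^sup>2) - ln ((t k)\<^sup>2))\<bar> \<le> 1 / (t k)\<^sup>2" for k
  proof -
    let ?t = "t k" and ?s = "s k"
    have s: "0 < ?s" using t[of k] ts[of k] by linarith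
    define L where "L = ln (?s\<^sup>2) - ln (?t\<^sup>2)"
    have "L \<le> (?s\<^sup>2 - ?t\<^sup>2) / ?t\<^sup>2" unfolding L_def by (rule ln_diff_le) (use s t[of k] in auto)
    then have up: "L \<le> 1 / ?t\<^sup>2" by (simp add: s2)
    have "- L \<le> (?t\<^sup>2 - ?s\<^sup>2) / ?s\<^sup>2"
      using ln_diff_le[of "?t\<^sup>2" "?s\<^sup>2"] s t[of k] by (simp add: L_def)
    also have "\<dots> = - (1 / ?s\<^sup>2)" using s2[of k] by simp
    finally have low: "1 / ?s\<^sup>2 \<le> L" by linarith
    have "?t * ?s * L \<le> ?t * ?s * (1 / ?t\<^sup>2)" using up s t[of k] by (intro mult_left_mono) auto
    also have "\<dots> = ?s / ?t" using t[of k] by (simp add: power2_eq_square)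
    finally have 1: "?t * ?s * L \<le> ?s / ?t" .
    have "?t * ?s * (1 / ?s\<^sup>2) \<le> ?t * ?s * L" using low s t[of k] by (intro mult_left_mono) auto
    moreover have "?t * ?s * (1 / ?s\<^sup>2) = ?t / ?s" using s by (simp add: power2_eq_square)
    ultimately have 2: "?t / ?s \<le> ?t * ?s * L" by simp
    have 3: "?t / ?s \<le> 1" "1 \<le> ?s / ?t" using s t[of k] ts[of k] by simp_all
    have "?s / ?t - ?t / ?s = (?s\<^sup>2 - ?t\<^sup>2) / (?t * ?s)" using s t[of k] by (simp add: field_simps power2_eq_square)
    also have "\<dots> = 1 / (?t * ?s)" by (simp add: s2)
    also have "\<dots> \<le> 1 / ?t\<^sup>2"
      unfolding power2_eq_square using t[of k] ts[of k] s by (intro divide_left_mono mult_left_mono) auto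
    finally have 4: "?s / ?t - ?t / ?s \<le> 1 / ?t\<^sup>2" .
    have 5: "\<bar>1 - ?t * ?s * L\<bar> \<le> 1 / ?t\<^sup>2" using 1 2 3 4 by linarith
    have eq: "((s k)\<^sup>2 - (t k)\<^sup>2) / 4 - t k * s k / 4 * (ln ((s k)\<^sup>2) - ln ((t k)\<^sup>2)) = (1 - ?t * ?s * L) / 4"
      unfolding L_def[symmetric] by (simp add: s2 field_simps)
    have "\<bar>X / 4\<bar> \<le> \<bar>X\<bar>" for X :: real by simp
    then show ?thesis unfolding eq using 5 by (rule order_trans)
  qed
  have lim: "(\<lambda>k. boundary_oscillation (A k)) \<longlonglongrightarrow> 0"
  proof (rule tendsto_sandwich[OF _ _ tendsto_const])
    show "(\<lambda>k. 1 / (t k)\<^sup>2) \<longlonglongrightarrow> 0" unfolding t_def by real_asymp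
    show "\<forall>\<^sub>F k in sequentially. 0 \<le> boundary_oscillation (A k)"
      unfolding A_def using annulus_oscillation(1)[OF t ts] by simp
    have "boundary_oscillation (A k) \<le> 1 / (t k)\<^sup>2" for k
      unfolding A_def using annulus_oscillation(2)[OF t ts] small by (rule order_trans)
    then show "\<forall>\<^sub>F k in sequentially. boundary_oscillation (A k) \<le> 1 / (t k)\<^sup>2" by simp
  qed
  have far: "filterlim (\<lambda>k. hausdorff_dist (T k ` A k) (ball (c k) (r k))) at_top sequentially"
    if "\<forall>k. rigid_motion (T k) \<and> r k > 0 \<and> measure lebesgue (ball (c k) (r k)) = measure lebesgue (A k)" for T c r
  proof (rule elongated_sets_far_from_balls[where V=pi and p="\<lambda>k. ((t k + s k) / 2) *\<^sub>R e1" and q="\<lambda>k. - (((t k + s k) / 2) *\<^sub>R e1)"])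
    show "((t k + s k) / 2) *\<^sub>R e1 \<in> A k" "- (((t k + s k) / 2) *\<^sub>R e1) \<in> A k" for k
      using t[of k] ts[of k] by (auto simp: A_def')
    have "dist (((t k + s k) / 2) *\<^sub>R e1) (- (((t k + s k) / 2) *\<^sub>R e1)) = t k + s k" for k
    proof -
      have "dist (((t k + s k) / 2) *\<^sub>R e1) (- (((t k + s k) / 2) *\<^sub>R e1)) = norm ((t k + s k) *\<^sub>R e1)"
        by (simp add: dist_norm scaleR_add_left[symmetric])
      then show ?thesis using t[of k] ts[of k] by simp
    qed
    moreover have "filterlim (\<lambda>k. t k + s k) at_top sequentially" unfolding s_def t_def by real_asymp
    ultimately show "filterlim (\<lambda>k. dist (((t k + s k) / 2) *\<^sub>R e1) (- (((t k + s k) / 2) *\<^sub>R e1))) at_top sequentially" by simp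
  qed (use that vol bdd in auto)
  show ?thesis by (intro exI[of _ A] exI[of _ pi]) (use ann vol lim far in auto)
qed

theorem theorem1p1:
  shows "(CARD('n::finite) \<ge> 3 \<longrightarrow>
      (\<exists>(\<Omega> :: nat \<Rightarrow> (real ^ 'n) set) V.
         V > 0 \<and> (\<forall>k. open_rectangle (\<Omega> k) \<and> measure lebesgue (\<Omega> k) = V) \<and>
         (\<lambda>k. boundary_oscillation (\<Omega> k)) \<longlonglongrightarrow> 0 \<and>
         (\<forall>T c r. (\<forall>k. rigid_motion (T k) \<and> r k > 0 \<and>
                       measure lebesgue (ball (c k) (r k)) = measure lebesgue (\<Omega> k)) \<longrightarrow>
            filterlim (\<lambda>k. hausdorff_dist (T k ` \<Omega> k) (ball (c k) (r k))) at_top sequentially)))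
    \<and> (\<exists>(A :: nat \<Rightarrow> (real ^ 2) set) V.
         V > 0 \<and> (\<forall>k. open_annulus (A k) \<and> measure lebesgue (A k) = V) \<and>
         (\<lambda>k. boundary_oscillation (A k)) \<longlonglongrightarrow> 0 \<and>
         (\<forall>T c r. (\<forall>k. rigid_motion (T k) \<and> r k > 0 \<and>
                       measure lebesgue (ball (c k) (r k)) = measure lebesgue (A k)) \<longrightarrow>
            filterlim (\<lambda>k. hausdorff_dist (T k ` A k) (ball (c k) (r k))) at_top sequentially))"
  by (intro conjI impI flat_boxes thin_annuli) simp

end
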